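(* Assume that $t\mapsto g(t)/t^{q-1}$ is non-increasing on $(0,\infty)$. Let $\Omega\subset\mathbb R^n$ be open. Let $h_1,h_2\in L^g_s(\mathbb R^n)$ with $h_1\le h_2$ a.e. in $\mathbb R^n$. Let $\{u_j\}$ be an increasing sequence of supersolutions of $\mathcal Lu=0$ in $\Omega$ such that $h_1\le u_j\le h_2$ a.e. in $\mathbb R^n$ and $\{u_j\}$ is uniformly locally essentially bounded from above in $\Omega$. If $u_j$ converges to a function $u$ pointwise almost everywhere in $\Omega$, then $u$ is a supersolution of $\mathcal Lu=0$ in $\Omega$.
   Context: Fix $n\in\mathbb N$, $s\in(0,1)$, $\Lambda\ge1$. $G(t)=\int_0^tg$ is a differentiable Young function with $g=G'$ strictly increasing, $G(1)=1$, and $1<p\le q$ with $pG(t)\le tg(t)\le qG(t)$ for $t\ge0$. $k$ measurable with $\Lambda^{-1}\le k(x,y)=k(y,x)\le\Lambda$ a.e. $D^su(x,y)=(u(x)-u(y))/|x-y|^s$. $W^{s,G}_{\mathrm{loc}}(\Omega)$: measurable $u$ with $\int_DG(|u|)+\int_D\int_DG(|D^su|)|x-y|^{-n}dydx<\infty$ for every open $D\Subset\Omega$. $L^g_s(\mathbb R^n)$: measurable $u$ with $g(|u|)$ locally integrable and $\int g(|u(x)|/(1+|x|)^s)(1+|x|)^{-n-s}dx<\infty$. A supersolution of $\mathcal Lu=0$ in $\Omega$ is $u\in W^{s,G}_{\mathrm{loc}}(\Omega)$ with $u_-\in L^g_s(\mathbb R^n)$ and $\int\int g(|D^su|)\frac{D^su}{|D^su|}D^s\varphi\frac{k(x,y)}{|x-y|^n}dydx\ge0$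 for all nonnegative $\varphi\in C_c^\infty(\Omega)$.
   Formalization: Convergence of u_j to u is assumed a.e. in all of R^n, not only in Ω: with u arbitrary outside Ω the claim fails (u_j=0, u=0 in Ω, u=1 outside). k is taken measurable for the product of the Lebesgue σ-algebras, a null-set change. *)

theory Defs
  imports "HOL-Analysis.Analysis"
begin

definition young_growth :: "(real \<Rightarrow> real) \<Rightarrow> (real \<Rightarrow> real) \<Rightarrow> real \<Rightarrow> real \<Rightarrow> bool" where
  "young_growth G g p q \<longleftrightarrow>
     (\<forall>t\<ge>0. G t = integral {0..t} g) \<and>
     (\<forall>t\<ge>0. (G has_real_derivative g t) (at t within {0..})) \<and>
     strict_mono_on {0..} g \<and> g 0 = 0 \<and>
     convex_on {0..} G \<and>
     G 1 = 1 \<and> 1 < p \<and> p \<le> q \<and>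
     (\<forall>t\<ge>0. p * G t \<le> t * g t \<and> t * g t \<le> q * G t)"

definition kernel_ok :: "real \<Rightarrow> ('a::euclidean_space \<Rightarrow> 'a \<Rightarrow> real) \<Rightarrow> bool" where
  "kernel_ok \<Lambda> k \<longleftrightarrow> 1 \<le> \<Lambda> \<and>
     (\<lambda>z. k (fst z) (snd z)) \<in> borel_measurable (lebesgue \<Otimes>\<^sub>M lebesgue) \<and>
     (AE z in lebesgue \<Otimes>\<^sub>M lebesgue.
        1 / \<Lambda> \<le> k (fst z) (snd z) \<and> k (fst z) (snd z) \<le> \<Lambda> \<and> k (fst z) (snd z) = k (snd z) (fst z))"

definition Ds :: "real \<Rightarrow> ('a::euclidean_space \<Rightarrow> real) \<Rightarrow> 'a \<Rightarrow> 'a \<Rightarrow> real" where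
  "Ds s u x y = (u x - u y) / (norm (x - y) powr s)"

definition compactly_contained :: "'a::euclidean_space set \<Rightarrow> 'a set \<Rightarrow> bool" where
  "compactly_contained D \<Omega> \<longleftrightarrow> compact (closure D) \<and> closure D \<subseteq> \<Omega>"

definition W_sG_loc :: "real \<Rightarrow> (real \<Rightarrow> real) \<Rightarrow> 'a::euclidean_space set \<Rightarrow> ('a \<Rightarrow> real) \<Rightarrow> bool" where
  "W_sG_loc s G \<Omega> u \<longleftrightarrow> u \<in> borel_measurable lebesgue \<and>
     (\<forall>D. open D \<and> compactly_contained D \<Omega> \<longrightarrow>
        (\<integral>\<^sup>+ x. indicator D x * ennreal (G \<bar>u x\<bar>) \<partial>lebesgue) < \<infinity> \<and>
        (\<integral>\<^sup>+ z. indicator (D \<times> D) z *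
            ennreal (G \<bar>Ds s u (fst z) (snd z)\<bar> / norm (fst z - snd z) ^ DIM('a))
          \<partial>(lebesgue \<Otimes>\<^sub>M lebesgue)) < \<infinity>)"

definition tail_space :: "real \<Rightarrow> (real \<Rightarrow> real) \<Rightarrow> ('a::euclidean_space \<Rightarrow> real) \<Rightarrow> bool" where
  "tail_space s g u \<longleftrightarrow> u \<in> borel_measurable lebesgue \<and>
     (\<forall>K. compact K \<longrightarrow> set_integrable lebesgue K (\<lambda>x. g \<bar>u x\<bar>)) \<and>
     (\<integral>\<^sup>+ x. ennreal (g (\<bar>u x\<bar> / (1 + norm x) powr s) * (1 + norm x) powr (- real DIM('a) - s))
        \<partial>lebesgue) < \<infinity>"

primrec Ck :: "nat \<Rightarrow> ('a::euclidean_space \<Rightarrow> real) \<Rightarrow> bool" where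
  "Ck 0 f = continuous_on UNIV f"
| "Ck (Suc k) f = ((\<forall>x. f differentiable (at x)) \<and>
      (\<forall>v. Ck k (\<lambda>x. frechet_derivative f (at x) v)))"

definition test_fun :: "'a::euclidean_space set \<Rightarrow> ('a \<Rightarrow> real) \<Rightarrow> bool" where
  "test_fun \<Omega> \<phi> \<longleftrightarrow> (\<forall>k. Ck k \<phi>) \<and>
     compact (closure {x. \<phi> x \<noteq> 0}) \<and> closure {x. \<phi> x \<noteq> 0} \<subseteq> \<Omega>"

definition supersolution ::
  "real \<Rightarrow> (real \<Rightarrow> real) \<Rightarrow> (real \<Rightarrow> real) \<Rightarrow> ('a::euclidean_space \<Rightarrow> 'a \<Rightarrow> real) \<Rightarrow> 'a set \<Rightarrow> ('a \<Rightarrow> real) \<Rightarrow> bool" where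
  "supersolution s G g k \<Omega> u \<longleftrightarrow>
     W_sG_loc s G \<Omega> u \<and> tail_space s g (\<lambda>x. max (- u x) 0) \<and>
     (\<forall>\<phi>. test_fun \<Omega> \<phi> \<and> (\<forall>x. 0 \<le> \<phi> x) \<longrightarrow>
        (let F = (\<lambda>z. g \<bar>Ds s u (fst z) (snd z)\<bar> * sgn (Ds s u (fst z) (snd z)) *
                       Ds s \<phi> (fst z) (snd z) * k (fst z) (snd z) / norm (fst z - snd z) ^ DIM('a))
         in integrable (lebesgue \<Otimes>\<^sub>M lebesgue) F \<and> 0 \<le> (\<integral> z. F z \<partial>(lebesgue \<Otimes>\<^sub>M lebesgue))))"

end

theory Submission
  imports Defs
begin

text \<open>The supersolutions \<open>uj\<close> have one common majorant \<open>h\<close>, integrable in the Orlicz sense near a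
  given compact set and with a finite tail. Testing the inequality for \<open>uj\<close> with
  \<open>(M - uj) * eta ^ N\<close>, where \<open>M\<close> is a local upper bound, \<open>eta\<close> a cutoff function and \<open>N \<ge> q\<close>,
  bounds the local energy of \<open>uj\<close> by a quantity depending only on \<open>h\<close>; the monotonicity of
  \<open>g t / t powr (q - 1)\<close> absorbs the error terms. This test function is not smooth, but its
  mollifications are admissible: by Jensen's inequality they do not increase the energy. Fatou's
  lemma then gives the local energy of the limit. Both passages to the limit in the form, along
  the mollifications and along \<open>uj\<close>, follow from uniform integrability: by Young's inequality
  with a small factor the integrand is at most a small multiple of a sequence bounded in \<open>L\<^sup>1\<close> plus
  a fixed integrable function.\<close>

subsection \<open>Integrals and limits\<close>

text \<open>The form is not local: a test function supported in \<open>S\<close> interacts with the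
  whole space, where the functions \<open>uj\<close> are controlled only by barriers of class
  \<open>L^g\<close>. The pair integral is therefore split into \<open>D \<times> D\<close>, where
  energies live, and the pairs with one point in \<open>S\<close> and the other outside
  \<open>D\<close>. On the latter \<open>|x - y|\<close> dominates a multiple of
  \<open>1 + |y|\<close>, and the integrand is dominated by a function of \<open>x\<close> times a
  tail weight in \<open>y\<close>. The barriers are too weak near \<open>S\<close> as well, since
  integrability of \<open>g |h1|\<close> does not give that of \<open>G |h1|\<close>. Monotonicity
  supplies the missing lower bound: \<open>uj 0 \<le> uj j \<le> M\<close>, and \<open>uj 0\<close>
  has a finite local \<open>G\<close>-integral. In each passage to the limit one argument of the
  form stays fixed. The small factor in Young's inequality must fall on the moving argument, so the
  inequality is needed in two versions. The exponent \<open>N \<ge> q\<close> comes from the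
  absorption: differentiating \<open>eta ^ N\<close> leaves \<open>eta ^ (N - 1)\<close>, which is
  at most \<open>eta powr (q - 1)\<close>, the factor that can be moved inside
  \<open>g\<close>.\<close>

lemma ennreal_le_suminf: "f k \<le> (\<Sum>k. f k)" for f :: "nat \<Rightarrow> ennreal"
  using sum_le_suminf[of f "{k}"] by simp

lemma nn_integral_suminf_cmult_cball:
  "(\<integral>\<^sup>+ x. (\<Sum>k. ennreal (c k) * indicator (cball (0::'a::euclidean_space) (r k)) x) \<partial>lborel)
    = (\<Sum>k. ennreal (c k) * emeasure lborel (cball (0::'a) (r k)))"
proof -
  have "(\<integral>\<^sup>+ x. (\<Sum>k. ennreal (c k) * indicator (cball (0::'a::euclidean_space) (r k)) x) \<partial>lborel)
    = (\<Sum>k. \<integral>\<^sup>+ x. ennreal (c k) * indicator (cball (0::'a) (r k)) x \<partial>lborel)"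
    by (rule nn_integral_suminf) (intro borel_measurable_times_ennreal borel_measurable_const borel_measurable_indicator, simp)
  also have "\<dots> = (\<Sum>k. ennreal (c k) * emeasure lborel (cball (0::'a) (r k)))"
    by (intro suminf_cong nn_integral_cmult_indicator) simp
  finally show ?thesis .
qed

text \<open>Dyadic shells: at radius about \<open>R / 2 ^ k\<close> the integrand is of order
  \<open>(R / 2 ^ k) powr (b - n)\<close> and the volume of order \<open>(R / 2 ^ k) ^ n\<close>, so
  the terms form a geometric series of ratio \<open>1 / 2 powr b\<close>. The bound
  \<open>b < 1\<close> makes \<open>b - n\<close> negative in every dimension. With
  \<open>b = 1 - s\<close> this is the singularity that Lipschitz functions leave in the
  energy.\<close>

lemma nn_integral_radial_powr_ball:
  fixes b R :: real
  assumes b: "0 < b" "b < 1"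
  shows "(\<integral>\<^sup>+ x. indicator (cball (0::'a::euclidean_space) R) x *
      ennreal (norm x powr b / norm x ^ DIM('a)) \<partial>lborel) < \<infinity>"
proof (cases "0 < R")
  case False
  then have eq: "indicator (cball 0 R) x * ennreal (norm x powr b / norm x ^ DIM('a)) = 0" for x :: 'a
  proof (cases "x = 0")
    case nz: False
    then have "\<not> norm x \<le> R" using False by (metis not_le order.trans zero_less_norm_iff linorder_not_less)
    then show ?thesis by (simp add: indicator_def)
  qed simp
  show ?thesis unfolding eq by simp
next
  case R: True
  define n where "n = DIM('a)"
  have n: "0 < n" by (simp add: n_def)
  define a where "a k = R / 2 ^ k" for k :: nat
  have a: "0 < a k" for k using R by (simp add: a_def)
  have "(\<integral>\<^sup>+ x. indicator (cball (0::'a) R) x * ennreal (norm x powr b / norm x ^ n) \<partial>lborel)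
      \<le> (\<integral>\<^sup>+ x. (\<Sum>k. ennreal (a (Suc k) powr (b - n)) * indicator (cball (0::'a) (a k)) x) \<partial>lborel)"
  proof (rule nn_integral_mono)
    fix x :: 'a
    show "indicator (cball 0 R) x * ennreal (norm x powr b / norm x ^ n)
        \<le> (\<Sum>k. ennreal (a (Suc k) powr (b - n)) * indicator (cball 0 (a k)) x)"
    proof (cases "x \<noteq> 0 \<and> norm x \<le> R")
      case True
      have "\<exists>k. a (Suc k) < norm x \<and> norm x \<le> a k"
      proof -
        \<comment> \<open>This least index is positive because \<open>norm x \<le> R = a 0\<close>;
          its predecessor is the index of the shell.\<close>
        define k where "k = (LEAST k. a k < norm x)"
        have "\<exists>k. a k < norm x"
        proof -
          obtain k where "(1 / 2) ^ k < norm x / R"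
            using real_arch_pow_inv[of "norm x / R" "1 / 2"] True R by auto
          then show ?thesis using R by (intro exI[of _ k]) (simp add: a_def field_simps)
        qed
        then have k: "a k < norm x" unfolding k_def by (rule LeastI_ex)
        have "k \<noteq> 0"
        proof
          assume "k = 0"
          then show False using k True by (simp add: a_def)
        qed
        then obtain j where j: "k = Suc j" by (cases k) auto
        then have "\<not> a j < norm x" using not_less_Least[of j "\<lambda>k. a k < norm x"] by (simp add: k_def)
        then show ?thesis using k j by auto
      qed
      then obtain k where k: "a (Suc k) < norm x" "norm x \<le> a k" by auto
      have "norm x powr b / norm x ^ n = norm x powr (b - n)"
        using True by (simp add: powr_diff powr_realpow)
      also have "\<dots> \<le> a (Suc k) powr (b - n)"
        using b n k a[of "Suc k"] by (intro powr_mono2') auto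
      finally have "indicator (cball 0 R) x * ennreal (norm x powr b / norm x ^ n)
        \<le> ennreal (a (Suc k) powr (b - n)) * indicator (cball 0 (a k)) x"
        using True k by (auto simp: indicator_def intro: ennreal_leI)
      also have "\<dots> \<le> (\<Sum>k. ennreal (a (Suc k) powr (b - n)) * indicator (cball 0 (a k)) x)"
        by (rule ennreal_le_suminf)
      finally show ?thesis .
    qed (auto simp: indicator_def)
  qed
  also have "\<dots> = (\<Sum>k. ennreal (a (Suc k) powr (b - n)) * emeasure lborel (cball (0::'a) (a k)))"
    by (rule nn_integral_suminf_cmult_cball)
  also have "\<dots> = (\<Sum>k. ennreal ((R / 2) powr (b - n) * unit_ball_vol (real n) * R ^ n * (1 / 2 powr b) ^ k))"
  proof (rule suminf_cong)
    fix k
    have "a (Suc k) powr (b - n) * (unit_ball_vol (real n) * a k ^ n)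
        = (R / 2) powr (b - n) * unit_ball_vol (real n) * R ^ n * ((1 / 2 ^ k) powr (b - n) * (1 / 2 ^ k) ^ n)"
    proof -
      have "a (Suc k) = R / 2 * (1 / 2 ^ k)" by (simp add: a_def)
      then have "a (Suc k) powr (b - n) = (R / 2) powr (b - n) * (1 / 2 ^ k) powr (b - n)"
        using R by (simp add: powr_mult[symmetric])
      moreover have "a k ^ n = R ^ n * (1 / 2 ^ k) ^ n"
        by (simp add: a_def power_mult_distrib[symmetric])
      ultimately show ?thesis by simp
    qed
    also have "(1 / 2 ^ k) powr (b - n) * (1 / 2 ^ k) ^ n = (1 / 2 ^ k :: real) powr b"
      by (simp add: powr_diff powr_realpow)
    also have "\<dots> = (1 / 2 powr b) ^ k"
      by (simp add: powr_divide powr_power[symmetric] power_one_over powr_powr powr_realpow[symmetric] mult.commute)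
    finally show "ennreal (a (Suc k) powr (b - n)) * emeasure lborel (cball (0::'a) (a k)) =
        ennreal ((R / 2) powr (b - n) * unit_ball_vol (real n) * R ^ n * (1 / 2 powr b) ^ k)"
      using a[of k] R by (simp add: emeasure_cball n_def ennreal_mult[symmetric] ac_simps)
  qed
  also have "\<dots> < \<infinity>"
  proof -
    have "summable (\<lambda>k. (R / 2) powr (b - n) * unit_ball_vol (real n) * R ^ n * (1 / 2 powr b) ^ k)"
      using b by (intro summable_mult summable_geometric) simp
    then show ?thesis
      using R by (subst suminf_ennreal2) (auto intro!: mult_nonneg_nonneg)
  qed
  finally show ?thesis by (simp add: n_def)
qed

text \<open>On the shell \<open>2 ^ k \<le> 1 + |x| < 2 ^ (k + 1)\<close> the volume is of order
  \<open>2 ^ (k n)\<close> and the integrand at most \<open>2 powr (- k (n + s))\<close>, so the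
  series is geometric of ratio \<open>2 powr (- s)\<close>. It makes the constant part of the tail
  weight integrable.\<close>

lemma nn_integral_decay_powr:
  fixes s :: real
  assumes s: "0 < s"
  shows "(\<integral>\<^sup>+ x. ennreal ((1 + norm (x::'a::euclidean_space)) powr (- real DIM('a) - s)) \<partial>lborel) < \<infinity>"
proof -
  define n where "n = DIM('a)"
  have "(\<integral>\<^sup>+ x. ennreal ((1 + norm (x::'a)) powr (- real n - s)) \<partial>lborel)
      \<le> (\<integral>\<^sup>+ x. (\<Sum>k. ennreal ((2 ^ k) powr (- real n - s)) * indicator (cball (0::'a) (2 ^ Suc k)) x) \<partial>lborel)"
  proof (rule nn_integral_mono)
    fix x :: 'a
    define k where "k = (LEAST k. 1 + norm x < 2 ^ Suc k)"
    have "\<exists>k. 1 + norm x < 2 ^ Suc k"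
    proof -
      obtain k where "1 + norm x < 2 ^ k" using real_arch_pow[of 2 "1 + norm x"] by auto
      then have "1 + norm x < 2 ^ Suc k" by (rule less_le_trans) simp
      then show ?thesis by blast
    qed
    then have k: "1 + norm x < 2 ^ Suc k" unfolding k_def by (rule LeastI_ex)
    have k2: "2 ^ k \<le> 1 + norm x"
    proof (cases k)
      case (Suc j)
      then have "\<not> 1 + norm x < 2 ^ Suc j"
        using not_less_Least[of j "\<lambda>k. 1 + norm x < 2 ^ Suc k"] by (simp add: k_def)
      then show ?thesis using Suc by simp
    qed simp
    have "(1 + norm x) powr (- real n - s) \<le> (2 ^ k) powr (- real n - s)"
      using s k2 by (intro powr_mono2') auto
    then have "ennreal ((1 + norm x) powr (- real n - s))
      \<le> ennreal ((2 ^ k) powr (- real n - s)) * indicator (cball 0 (2 ^ Suc k)) x"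
      using k by (auto simp: indicator_def intro: ennreal_leI)
    also have "\<dots> \<le> (\<Sum>k. ennreal ((2 ^ k) powr (- real n - s)) * indicator (cball 0 (2 ^ Suc k)) x)"
      by (rule ennreal_le_suminf)
    finally show "ennreal ((1 + norm x) powr (- real n - s)) \<le> \<dots>" .
  qed
  also have "\<dots> = (\<Sum>k. ennreal ((2 ^ k) powr (- real n - s)) * emeasure lborel (cball (0::'a) (2 ^ Suc k)))"
    by (rule nn_integral_suminf_cmult_cball)
  also have "\<dots> = (\<Sum>k. ennreal (unit_ball_vol (real n) * 2 ^ n * (1 / 2 powr s) ^ k))"
  proof (rule suminf_cong)
    fix k
    have "(2 ^ k) powr (- real n - s) * (unit_ball_vol (real n) * (2 ^ Suc k) ^ n)
        = unit_ball_vol (real n) * 2 ^ n * ((2 ^ k) powr (- real n - s) * (2 ^ k) ^ n)"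
      by (simp add: power_mult_distrib)
    also have "(2 ^ k) powr (- real n - s) * (2 ^ k) ^ n = (2 ^ k :: real) powr (- s)"
      by (simp add: powr_diff powr_realpow powr_minus divide_inverse)
    also have "\<dots> = (1 / 2 powr s) ^ k"
    proof -
      have "(2 ^ k :: real) powr (- s) = (2 powr (- s)) ^ k"
        by (simp add: powr_realpow[symmetric] powr_powr mult.commute)
      then show ?thesis by (simp add: powr_minus inverse_eq_divide)
    qed
    finally show "ennreal ((2 ^ k) powr (- real n - s)) * emeasure lborel (cball (0::'a) (2 ^ Suc k)) =
        ennreal (unit_ball_vol (real n) * 2 ^ n * (1 / 2 powr s) ^ k)"
      by (simp add: emeasure_cball n_def ennreal_mult[symmetric])
  qed
  also have "\<dots> < \<infinity>"
  proof -
    have "summable (\<lambda>k. unit_ball_vol (real n) * 2 ^ n * (1 / 2 powr s) ^ k)"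
      using s by (intro summable_mult summable_geometric) simp
    then show ?thesis
      by (subst suminf_ennreal2) (auto intro!: mult_nonneg_nonneg)
  qed
  finally show ?thesis by (simp add: n_def)
qed

text \<open>A Vitali theorem in which one integrable level \<open>H\<close> per \<open>e\<close>
  replaces both equi-integrability and tightness. Truncating at \<open>- H\<close> and
  \<open>H\<close> changes each integral by at most \<open>e\<close>, and the truncated sequence is
  dominated by \<open>H\<close>. Since \<open>ennreal\<close> sends negative reals to zero,
  \<open>ennreal (\<bar>f m x\<bar> - H x)\<close> is the excess over the level.\<close>

lemma uniformly_integrable_limit:
  fixes f :: "nat \<Rightarrow> 'a \<Rightarrow> real" and f' :: "'a \<Rightarrow> real"
  assumes f [measurable]: "\<And>m. f m \<in> borel_measurable M" "f' \<in> borel_measurable M"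
    and lim: "AE x in M. (\<lambda>m. f m x) \<longlonglongrightarrow> f' x"
    and ui: "\<And>e. 0 < e \<Longrightarrow> \<exists>H. integrable M H \<and> (\<forall>x. 0 \<le> H x) \<and>
        (\<forall>m. (\<integral>\<^sup>+ x. ennreal (\<bar>f m x\<bar> - H x) \<partial>M) \<le> ennreal e)"
  shows "integrable M f'" and "(\<lambda>m. integral\<^sup>L M (f m)) \<longlonglongrightarrow> integral\<^sup>L M f'"
proof -
  \<comment> \<open>The truncation differs from \<open>h\<close> by exactly the excess. This gives
    integrability as well: \<open>h\<close> is the truncation plus a function bounded by the
    excess.\<close>
  have tail: "integrable M h \<and> \<bar>integral\<^sup>L M h - (\<integral>x. max (- H x) (min (H x) (h x)) \<partial>M)\<bar> \<le> e"
    if [measurable]: "h \<in> borel_measurable M" and H: "integrable M H" "\<And>x. 0 \<le> H x"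
      and le: "(\<integral>\<^sup>+ x. ennreal (\<bar>h x\<bar> - H x) \<partial>M) \<le> ennreal e" and e: "0 < e" for h H e
  proof -
    have [measurable]: "H \<in> borel_measurable M" using H by auto
    let ?c = "\<lambda>x. max (- H x) (min (H x) (h x))"
    let ?d = "\<lambda>x. max 0 (\<bar>h x\<bar> - H x)"
    have c: "integrable M ?c"
      by (rule Bochner_Integration.integrable_bound[OF H(1)]) (use H(2) in \<open>auto simp: max_def min_def\<close>)
    have deq: "(\<integral>\<^sup>+ x. ennreal (?d x) \<partial>M) = (\<integral>\<^sup>+ x. ennreal (\<bar>h x\<bar> - H x) \<partial>M)"
      by (intro nn_integral_cong) (auto simp: max_def ennreal_neg)
    have "(\<integral>\<^sup>+ x. ennreal (?d x) \<partial>M) < \<infinity>"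
      unfolding deq using le by (auto intro: le_less_trans)
    then have d: "integrable M ?d"
      by (intro integrableI_nonneg) auto
    have hd: "\<bar>h x - ?c x\<bar> = ?d x" for x using H(2)[of x] by (auto simp: max_def min_def)
    have hc: "integrable M (\<lambda>x. h x - ?c x)"
      by (rule Bochner_Integration.integrable_bound[OF d]) (use hd in auto)
    have h: "integrable M h"
      using Bochner_Integration.integrable_add[OF hc c] by simp
    have "\<bar>integral\<^sup>L M h - integral\<^sup>L M ?c\<bar> = \<bar>\<integral>x. h x - ?c x \<partial>M\<bar>"
      using h c by simp
    also have "\<dots> \<le> (\<integral>x. ?d x \<partial>M)"
      using integral_abs_bound[of M "\<lambda>x. h x - ?c x"] by (simp add: hd)
    also have "\<dots> \<le> e"
    proof -
      have "ennreal (\<integral>x. ?d x \<partial>M) = (\<integral>\<^sup>+ x. ennreal (?d x) \<partial>M)"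
        using d by (subst nn_integral_eq_integral) auto
      then have "ennreal (\<integral>x. ?d x \<partial>M) \<le> ennreal e" using deq le by simp
      then show ?thesis using e by (subst (asm) ennreal_le_iff) auto
    qed
    finally show ?thesis using h by simp
  qed
  \<comment> \<open>Fatou's lemma passes the excess bound to the limit with the same level.\<close>
  have lim': "(\<integral>\<^sup>+ x. ennreal (\<bar>f' x\<bar> - H x) \<partial>M) \<le> ennreal e"
    if [measurable]: "H \<in> borel_measurable M"
      and le: "\<And>m. (\<integral>\<^sup>+ x. ennreal (\<bar>f m x\<bar> - H x) \<partial>M) \<le> ennreal e" for H e
  proof -
    have "(\<integral>\<^sup>+ x. ennreal (\<bar>f' x\<bar> - H x) \<partial>M) = (\<integral>\<^sup>+ x. liminf (\<lambda>m. ennreal (\<bar>f m x\<bar> - H x)) \<partial>M)"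
    proof (intro nn_integral_cong_AE, use lim in eventually_elim)
      fix x assume "(\<lambda>m. f m x) \<longlonglongrightarrow> f' x"
      then have "(\<lambda>m. ennreal (\<bar>f m x\<bar> - H x)) \<longlonglongrightarrow> ennreal (\<bar>f' x\<bar> - H x)"
        by (intro tendsto_intros)
      then show "ennreal (\<bar>f' x\<bar> - H x) = liminf (\<lambda>m. ennreal (\<bar>f m x\<bar> - H x))"
        by (simp add: lim_imp_Liminf)
    qed
    also have "\<dots> \<le> liminf (\<lambda>m. \<integral>\<^sup>+ x. ennreal (\<bar>f m x\<bar> - H x) \<partial>M)"
      by (intro nn_integral_liminf) auto
    also have "\<dots> \<le> ennreal e"
      using le by (intro Liminf_le) (auto intro!: always_eventually)
    finally show ?thesis .
  qed
  show I: "integrable M f'"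
    using ui[of 1] tail lim' by (meson borel_measurable_integrable f(2) zero_less_one)
  show "(\<lambda>m. integral\<^sup>L M (f m)) \<longlonglongrightarrow> integral\<^sup>L M f'"
  proof (rule LIMSEQ_I)
    fix r :: real assume "0 < r"
    \<comment> \<open>Two truncation errors of at most \<open>e\<close> and one error below
      \<open>e\<close> from dominated convergence stay below \<open>r\<close>.\<close>
    define e where "e = r / 4"
    have e: "0 < e" using \<open>0 < r\<close> by (simp add: e_def)
    obtain H where H: "integrable M H" "\<And>x. 0 \<le> H x"
      and le: "\<And>m. (\<integral>\<^sup>+ x. ennreal (\<bar>f m x\<bar> - H x) \<partial>M) \<le> ennreal e"
      using ui[OF e] by auto
    have [measurable]: "H \<in> borel_measurable M" using H by auto
    let ?c = "\<lambda>h x. max (- H x) (min (H x) (h x))"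
    have "(\<lambda>m. integral\<^sup>L M (?c (f m))) \<longlonglongrightarrow> integral\<^sup>L M (?c f')"
    proof (rule integral_dominated_convergence[OF _ _ H(1)])
      show "AE x in M. (\<lambda>m. ?c (f m) x) \<longlonglongrightarrow> ?c f' x"
        using lim by eventually_elim (intro tendsto_intros)
    qed (use H(2) in \<open>auto simp: max_def min_def\<close>)
    from LIMSEQ_D[OF this e] obtain N where
        N: "\<And>m. N \<le> m \<Longrightarrow> \<bar>integral\<^sup>L M (?c (f m)) - integral\<^sup>L M (?c f')\<bar> < e"
      by auto
    have "\<bar>integral\<^sup>L M (f m) - integral\<^sup>L M f'\<bar> < r" if "N \<le> m" for m
    proof -
      have "\<bar>integral\<^sup>L M (f m) - integral\<^sup>L M (?c (f m))\<bar> \<le> e"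
        "\<bar>integral\<^sup>L M f' - integral\<^sup>L M (?c f')\<bar> \<le> e"
        using tail[OF f(1) H le e, of m] tail[OF f(2) H lim'[OF _ le] e] by simp_all
      moreover have "r = 4 * e" by (simp add: e_def)
      ultimately show ?thesis using N[OF that] e by linarith
    qed
    then show "\<exists>N. \<forall>m\<ge>N. norm (integral\<^sup>L M (f m) - integral\<^sup>L M f') < r" by auto
  qed
qed

subsection \<open>Smooth mollifiers\<close>

text \<open>\<open>Ck\<close> speaks of \<open>frechet_derivative\<close>, which is given by choice.
  Uniqueness of the derivative lets any explicit one take its place.\<close>

lemma Ck_SucI:
  assumes "\<And>x. (f has_derivative f' x) (at x)" "\<And>v. Ck k (\<lambda>x. f' x v)"
  shows "Ck (Suc k) f"
proof -
  have "frechet_derivative f (at x) = f' x" for x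
    using frechet_derivative_at[OF assms(1)[of x]] by simp
  then show ?thesis using assms by (auto simp: differentiable_def)
qed

lemma Ck_Suc_has_derivative:
  "Ck (Suc k) f \<Longrightarrow> (f has_derivative frechet_derivative f (at x)) (at x)"
  using frechet_derivative_works[of f "at x"] by simp

lemma Ck_Suc_deriv: "Ck (Suc k) f \<Longrightarrow> Ck k (\<lambda>x. frechet_derivative f (at x) v)"
  by simp

lemma Ck_Suc_imp: "Ck (Suc k) f \<Longrightarrow> Ck k f"
proof (induction k arbitrary: f)
  case 0
  then show ?case
    by (auto intro!: continuous_at_imp_continuous_on differentiable_imp_continuous_within)
next
  case (Suc k)
  show ?case
    by (rule Ck_SucI[OF Ck_Suc_has_derivative[OF Suc.prems]]) (intro Suc.IH Ck_Suc_deriv[OF Suc.prems])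
qed

lemma Ck_imp_continuous: "Ck k f \<Longrightarrow> continuous_on UNIV f"
  by (induction k) (auto dest: Ck_Suc_imp simp del: Ck.simps(2))

lemma Ck_const: "Ck k (\<lambda>x. c)"
  by (induction k arbitrary: c) (auto intro!: Ck_SucI[where f'="\<lambda>_ _. 0"] simp del: Ck.simps(2))

lemma Ck_add: "Ck k f \<Longrightarrow> Ck k h \<Longrightarrow> Ck k (\<lambda>x. f x + h x)"
proof (induction k arbitrary: f h)
  case (Suc k)
  show ?case
    by (rule Ck_SucI[OF has_derivative_add[OF Suc.prems[THEN Ck_Suc_has_derivative]]])
      (intro Suc.IH Suc.prems[THEN Ck_Suc_deriv])
qed (auto intro: continuous_intros)

lemma Ck_mult: "Ck k f \<Longrightarrow> Ck k h \<Longrightarrow> Ck k (\<lambda>x. f x * h x)"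
proof (induction k arbitrary: f h)
  case (Suc k)
  show ?case
    by (rule Ck_SucI[OF has_derivative_mult[OF Suc.prems[THEN Ck_Suc_has_derivative]]])
      (intro Ck_add Suc.IH Suc.prems[THEN Ck_Suc_deriv] Suc.prems[THEN Ck_Suc_imp])
qed (auto intro: continuous_intros)

lemma Ck_inner: "Ck k (\<lambda>x. x \<bullet> v)"
proof (cases k)
  case (Suc j)
  show ?thesis unfolding Suc
    by (rule Ck_SucI[where f'="\<lambda>_ h. h \<bullet> v"])
      (auto intro!: Ck_const derivative_eq_intros)
qed (auto intro: continuous_intros)

text \<open>Closed under differentiation up to linear combinations, so that smoothness of
  \<open>exp (- 1 / t)\<close> continued by zero needs no explicit formula for its derivatives.\<close>
definition flat :: "nat \<Rightarrow> real \<Rightarrow> real" where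
  "flat m t = (if t \<le> 0 then 0 else exp (- 1 / t) / t ^ m)"

lemma flat_nonneg: "0 \<le> flat m t"
  by (simp add: flat_def)

text \<open>The exponential beats powers:
  \<open>exp (1 / t) \<ge> (1 / (t (m + 2))) ^ (m + 2)\<close>. Taking two powers more than
  \<open>m\<close> leaves the factor \<open>t ^ 2\<close>, so that the difference quotient at zero
  is still of order \<open>t\<close>.\<close>

lemma flat_le:
  assumes "0 < t" shows "flat m t \<le> (real m + 2) ^ (m + 2) * t ^ 2"
proof -
  have "(1 / t / real (m + 2)) ^ (m + 2) \<le> (1 + 1 / t / real (m + 2)) ^ (m + 2)"
    using assms by (intro power_mono) auto
  also have "\<dots> \<le> exp (1 / t)"
    using assms by (intro exp_ge_one_plus_x_over_n_power_n) (auto intro: order_trans[of _ 0])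
  finally have le: "1 \<le> exp (1 / t) * (t ^ (m + 2) * (real m + 2) ^ (m + 2))"
    using assms by (simp only: power_divide divide_divide_eq_left pos_divide_le_eq power_mult_distrib
        zero_less_power mult_pos_pos power_one of_nat_0_less_iff) (simp add: ac_simps)
  have "flat m t = exp (- 1 / t) / t ^ m * 1" using assms by (simp add: flat_def)
  also have "\<dots> \<le> exp (- 1 / t) / t ^ m * (exp (1 / t) * (t ^ (m + 2) * (real m + 2) ^ (m + 2)))"
    using assms le by (intro mult_left_mono) auto
  also have "\<dots> = (real m + 2) ^ (m + 2) * t ^ 2"
  proof -
    have "exp (- 1 / t) * exp (1 / t) = 1" by (simp add: exp_add[symmetric])
    then have "exp (- 1 / t) / t ^ m * (exp (1 / t) * (t ^ (m + 2) * (real m + 2) ^ (m + 2)))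
      = t ^ (m + 2) / t ^ m * (real m + 2) ^ (m + 2)"
      by (simp add: divide_inverse mult.assoc[symmetric])
    also have "t ^ (m + 2) / t ^ m = t ^ 2" using assms by (simp add: power_add power2_eq_square)
    finally show ?thesis by (simp add: ac_simps)
  qed
  finally show ?thesis .
qed

lemma flat_deriv:
  "(flat m has_real_derivative flat (m + 2) t - real m * flat (m + 1) t) (at t)"
proof (cases t "0::real" rule: linorder_cases)
  case less
  have "\<forall>\<^sub>F x in nhds t. flat m x = 0"
    using less by (intro eventually_nhds_in_open[of "{..<0}", THEN eventually_mono]) (auto simp: flat_def)
  then show ?thesis using less by (subst DERIV_cong_ev[OF refl _ refl, where g="\<lambda>_. 0"]) (auto simp: flat_def)
next
  case greater
  have ev: "\<forall>\<^sub>F x in nhds t. flat m x = exp (- 1 / x) / x ^ m"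
    using greater by (intro eventually_nhds_in_open[of "{0<..}", THEN eventually_mono]) (auto simp: flat_def)
  have "((\<lambda>x. exp (- 1 / x) / x ^ m) has_real_derivative
      (exp (- 1 / t) * (1 / t ^ 2) * t ^ m - exp (- 1 / t) * (real m * t ^ (m - 1))) / (t ^ m * t ^ m)) (at t)"
    using greater by (auto intro!: derivative_eq_intros simp: power2_eq_square)
  also have "(exp (- 1 / t) * (1 / t ^ 2) * t ^ m - exp (- 1 / t) * (real m * t ^ (m - 1))) / (t ^ m * t ^ m)
    = flat (m + 2) t - real m * flat (m + 1) t"
    using greater by (cases m) (auto simp: flat_def field_simps power2_eq_square)
  finally show ?thesis by (subst DERIV_cong_ev[OF refl ev refl])
next
  case equal
  \<comment> \<open>To the right of zero the quotient is controlled by the quadratic bound, to the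
    left it vanishes identically.\<close>
  have "((\<lambda>h. (flat m (0 + h) - flat m 0) / h) \<longlongrightarrow> 0) (at 0)"
  proof (rule Lim_null_comparison)
    show "\<forall>\<^sub>F h in at 0. norm ((flat m (0 + h) - flat m 0) / h) \<le> (real m + 2) ^ (m + 2) * \<bar>h\<bar>"
    proof (rule always_eventually, rule allI)
      fix h :: real
      show "norm ((flat m (0 + h) - flat m 0) / h) \<le> (real m + 2) ^ (m + 2) * \<bar>h\<bar>"
      proof (cases "0 < h")
        case True
        then show ?thesis using flat_le[of h m] flat_nonneg[of m h]
          by (simp add: flat_def[of m 0] field_simps power2_eq_square)
      next
        case False
        then have "(flat m (0 + h) - flat m 0) / h = 0" by (simp add: flat_def)
        then show ?thesis by (simp only: norm_zero) simp
      qed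
    qed
    have "((\<lambda>h. (real m + 2) ^ (m + 2) * \<bar>h\<bar>) \<longlongrightarrow> (real m + 2) ^ (m + 2) * \<bar>0\<bar>) (at (0::real))"
      by (intro tendsto_mult tendsto_const tendsto_rabs tendsto_ident_at)
    then show "((\<lambda>h. (real m + 2) ^ (m + 2) * \<bar>h\<bar>) \<longlongrightarrow> 0) (at (0::real))" by simp
  qed
  then show ?thesis using equal by (simp add: DERIV_def flat_def)
qed

text \<open>The induction keeps \<open>m\<close> arbitrary because one differentiation raises it by
  one and by two; the inner derivative \<open>- 2 * (x \<bullet> v)\<close> is smooth. For
  \<open>c > 0\<close> the function is a bump on the ball of squared radius
  \<open>c\<close>.\<close>

lemma Ck_flat: "Ck k (\<lambda>x::'a::euclidean_space. flat m (c - x \<bullet> x))"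
proof (induction k arbitrary: m)
  case 0
  have "continuous_on UNIV (flat m)"
    using flat_deriv[of m] by (meson DERIV_isCont continuous_at_imp_continuous_on)
  then have "continuous_on UNIV (\<lambda>x::'a. flat m (c - x \<bullet> x))"
    by (rule continuous_on_compose2) (auto intro!: continuous_intros)
  then show ?case by simp
next
  case (Suc k)
  let ?d = "\<lambda>x. flat (m + 2) (c - x \<bullet> x) - real m * flat (m + 1) (c - x \<bullet> x)"
  show ?case
  proof (rule Ck_SucI[where f'="\<lambda>x h. ?d x * (- 2 * (x \<bullet> h))"])
    fix x :: 'a
    have "((\<lambda>x. c - x \<bullet> x) has_derivative (\<lambda>h. - 2 * (x \<bullet> h))) (at x)"
      by (auto intro!: derivative_eq_intros simp: inner_commute)
    from DERIV_compose_FDERIV[OF flat_deriv this, of m]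
    show "((\<lambda>x. flat m (c - x \<bullet> x)) has_derivative (\<lambda>h. ?d x * (- 2 * (x \<bullet> h)))) (at x)"
      by (simp only: mult.commute)
  next
    fix v :: 'a
    have "Ck k (\<lambda>x. (flat (m + 2) (c - x \<bullet> x) + (- real m) * flat (m + 1) (c - x \<bullet> x)) * (- 2 * (x \<bullet> v)))"
      by (intro Ck_mult Ck_add Ck_const Ck_inner Suc.IH)
    then show "Ck k (\<lambda>x. ?d x * (- 2 * (x \<bullet> v)))" by simp
  qed
qed

lemma uniformly_continuous_bounded_support:
  fixes f :: "'a::euclidean_space \<Rightarrow> real"
  assumes f: "continuous_on UNIV f" and R: "\<And>x. R < norm x \<Longrightarrow> f x = 0"
  shows "uniformly_continuous_on UNIV f"
  unfolding uniformly_continuous_on_def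
proof (intro allI impI)
  fix e :: real assume "0 < e"
  have "uniformly_continuous_on (cball 0 (R + 1)) f"
    by (intro compact_uniformly_continuous continuous_on_subset[OF f]) auto
  then obtain d where d: "0 < d"
    "\<And>x y. norm x \<le> R + 1 \<Longrightarrow> norm y \<le> R + 1 \<Longrightarrow> dist y x < d \<Longrightarrow> dist (f y) (f x) < e"
    unfolding uniformly_continuous_on_def using \<open>0 < e\<close> by (metis mem_cball_0)
  have "dist (f y) (f x) < e" if "dist y x < min d 1" for x y
  proof (cases "norm x \<le> R + 1 \<and> norm y \<le> R + 1")
    \<comment> \<open>If one of the points lies outside \<open>cball 0 (R + 1)\<close>, both have
      norm above \<open>R\<close>, where \<open>f\<close> vanishes.\<close>
    case False
    have "\<bar>norm y - norm x\<bar> < 1" using that norm_triangle_ineq3[of y x] by (simp add: dist_norm)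
    then have "R < norm x" "R < norm y" using False by auto
    then show ?thesis using R \<open>0 < e\<close> by simp
  qed (use d that in auto)
  then show "\<exists>d>0. \<forall>x\<in>UNIV. \<forall>x'\<in>UNIV. dist x' x < d \<longrightarrow> dist (f x') (f x) < e"
    using d(1) by (intro exI[of _ "min d 1"]) auto
qed

lemma bounded_bounded_support:
  fixes f :: "'a::euclidean_space \<Rightarrow> real"
  assumes f: "continuous_on UNIV f" and R: "\<And>x. R < norm x \<Longrightarrow> f x = 0"
  obtains B where "0 < B" "\<And>x. \<bar>f x\<bar> \<le> B"
proof -
  have "compact (f ` cball 0 R)"
    by (intro compact_continuous_image continuous_on_subset[OF f]) auto
  then obtain B where B: "\<And>x. norm x \<le> R \<Longrightarrow> \<bar>f x\<bar> \<le> B"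
    using compact_imp_bounded bounded_real by (metis image_eqI mem_cball_0)
  have "\<bar>f x\<bar> \<le> \<bar>B\<bar> + 1" for x
    using B[of x] R[of x] by (cases "norm x \<le> R") auto
  then show ?thesis by (intro that[of "\<bar>B\<bar> + 1"]) auto
qed

lemma frechet_derivative_bounded_support:
  fixes f :: "'a::euclidean_space \<Rightarrow> real"
  assumes R: "\<And>x. R < norm x \<Longrightarrow> f x = 0" and x: "R < norm x"
  shows "frechet_derivative f (at x) v = 0"
proof -
  have "open {x. R < norm x}" by (intro open_Collect_less continuous_intros)
  then have "(f has_derivative (\<lambda>_. 0)) (at x)"
    using x R by (rule_tac has_derivative_transform_within_open[of "\<lambda>_. 0" "\<lambda>_. 0" x UNIV "{x. R < norm x}"]) auto
  then have "(\<lambda>_. 0) = frechet_derivative f (at x)" by (rule frechet_derivative_at)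
  then show ?thesis by metis
qed

text \<open>The derivative is continuous with bounded support, hence uniformly continuous, so one
  \<open>d\<close> serves all base points. This uniformity is what allows a convolution to be
  differentiated under the integral sign by a direct estimate.\<close>

lemma Ck_uniform_linearization:
  fixes f :: "'a::euclidean_space \<Rightarrow> real"
  assumes f: "Ck (Suc 0) f" and R: "\<And>x. R < norm x \<Longrightarrow> f x = 0" and e: "0 < e"
  shows "\<exists>d>0. \<forall>x h. norm h < d \<longrightarrow> \<bar>f (x + h) - f x - frechet_derivative f (at x) h\<bar> \<le> e * norm h"
proof -
  let ?D = "\<lambda>x. frechet_derivative f (at x)"
  have uc: "uniformly_continuous_on UNIV (\<lambda>x. ?D x b)" for b
    using f by (intro uniformly_continuous_bounded_support[of _ R] frechet_derivative_bounded_support R) auto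
  \<comment> \<open>Uniform continuity is available for each fixed direction; expanding
    \<open>h\<close> in the basis costs a factor \<open>DIM('a)\<close>.\<close>
  define e' where "e' = e / DIM('a)"
  have e': "0 < e'" using e by (simp add: e'_def)
  have "\<forall>b. \<exists>d>0. \<forall>x y. dist y x < d \<longrightarrow> \<bar>?D y b - ?D x b\<bar> < e'"
    using uc e' unfolding uniformly_continuous_on_def dist_real_def by auto
  then obtain d where d: "\<And>b. 0 < d b" "\<And>b x y. dist y x < d b \<Longrightarrow> \<bar>?D y b - ?D x b\<bar> < e'"
    by metis
  define d' where "d' = Min (d ` Basis)"
  have d': "0 < d'" "\<And>b. b \<in> Basis \<Longrightarrow> d' \<le> d b" using d(1) by (auto simp: d'_def)
  have lin: "bounded_linear (?D x)" for x
    using Ck_Suc_has_derivative[OF f] has_derivative_bounded_linear by blast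
  have on: "onorm (\<lambda>h. ?D y h - ?D x h) \<le> e" if "dist y x < d'" for x y
  proof (rule onorm_le)
    fix h :: 'a
    have "?D z h = (\<Sum>b\<in>Basis. (h \<bullet> b) * ?D z b)" for z
    proof -
      have "?D z h = ?D z (\<Sum>b\<in>Basis. (h \<bullet> b) *\<^sub>R b)" by (simp add: euclidean_representation)
      also have "\<dots> = (\<Sum>b\<in>Basis. (h \<bullet> b) * ?D z b)"
        using lin[of z] by (simp add: bounded_linear.linear linear_sum linear_scale)
      finally show ?thesis .
    qed
    then have "\<bar>?D y h - ?D x h\<bar> = \<bar>\<Sum>b\<in>Basis. (h \<bullet> b) * (?D y b - ?D x b)\<bar>"
      by (simp add: sum_subtractf algebra_simps)
    also have "\<dots> \<le> (\<Sum>b\<in>(Basis::'a set). norm h * e')"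
    proof (rule order_trans[OF sum_abs sum_mono])
      fix b :: 'a assume b: "b \<in> Basis"
      then have "\<bar>?D y b - ?D x b\<bar> \<le> e'" using d(2)[of y x b] d'(2)[of b] that by auto
      then show "\<bar>(h \<bullet> b) * (?D y b - ?D x b)\<bar> \<le> norm h * e'"
        using Basis_le_norm[OF b, of h] by (simp add: abs_mult mult_mono)
    qed
    also have "\<dots> = e * norm h" by (simp add: e'_def)
    finally show "norm (?D y h - ?D x h) \<le> e * norm h" by simp
  qed
  have "\<bar>f (x + h) - f x - ?D x h\<bar> \<le> e * norm h" if "norm h < d'" for x h
  proof -
    have "norm (f (x + h) - f x - ?D x (x + h - x)) \<le> norm (x + h - x) * e"
    proof (rule differentiable_bound_linearization[where S="ball x d'" and f'="?D"])
      fix t :: real assume t: "t \<in> {0..1}"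
      have "\<bar>t\<bar> * norm h \<le> 1 * norm h" using t by (intro mult_right_mono) auto
      then show "x + t *\<^sub>R (x + h - x) \<in> ball x d'"
        using that by (simp add: dist_norm)
    next
      fix y assume "y \<in> ball x d'"
      then show "onorm (?D y - ?D x) \<le> e"
        using on[of y x] by (simp add: dist_commute fun_diff_def)
    qed (use that d'(1) in \<open>auto intro!: has_derivative_at_withinI[OF Ck_Suc_has_derivative[OF f]]\<close>)
    then show ?thesis by (simp add: mult.commute)
  qed
  then show ?thesis using d'(1) by blast
qed

section \<open>Convolution with a smooth kernel\<close>

definition conv :: "('a::euclidean_space \<Rightarrow> real) \<Rightarrow> ('a \<Rightarrow> real) \<Rightarrow> 'a \<Rightarrow> real" where
  "conv r v x = (\<integral>y. r (x - y) * v y \<partial>lborel)"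

lemma integrable_conv:
  fixes r v :: "'a::euclidean_space \<Rightarrow> real"
  assumes r: "continuous_on UNIV r" "\<And>x. R < norm x \<Longrightarrow> r x = 0" and v: "integrable lborel v"
  shows "integrable lborel (\<lambda>y. r (x - y) * v y)"
proof -
  obtain B where B: "0 < B" "\<And>x. \<bar>r x\<bar> \<le> B" using bounded_bounded_support[OF r] by metis
  have [measurable]: "r \<in> borel_measurable borel" "v \<in> borel_measurable borel"
    using r v by (auto intro: borel_measurable_continuous_onI)
  show ?thesis
    by (rule Bochner_Integration.integrable_bound[OF integrable_mult_right[OF v, of B]])
      (use B in \<open>auto simp: abs_mult intro!: mult_mono\<close>)
qed

text \<open>The derivative falls on the kernel: the derivative of \<open>conv r v\<close> in
  direction \<open>h\<close> is the convolution of \<open>v\<close> with the directional derivative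
  of \<open>r\<close>. That derivative is again a kernel with the same support radius, so the
  induction runs over \<open>k\<close> with \<open>r\<close> arbitrary, and \<open>v\<close> only
  has to be integrable.\<close>

lemma Ck_conv:
  fixes r v :: "'a::euclidean_space \<Rightarrow> real"
  assumes v: "integrable lborel v"
  shows "Ck k r \<Longrightarrow> (\<And>x. R < norm x \<Longrightarrow> r x = 0) \<Longrightarrow> Ck k (conv r v)"
proof (induction k arbitrary: r)
  case 0
  then have r: "continuous_on UNIV r" "\<And>x. R < norm x \<Longrightarrow> r x = 0" by auto
  \<comment> \<open>The summand 1 keeps \<open>I\<close> positive even if \<open>v\<close> vanishes
    almost everywhere; the \<open>L^1\<close> norm is \<open>I - 1\<close>, and
    \<open>(I - 1) / I < 1\<close>.\<close>
  define I where "I = (\<integral>y. \<bar>v y\<bar> \<partial>lborel) + 1"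
  have I: "0 < I" by (simp add: I_def add_nonneg_pos)
  have "uniformly_continuous_on UNIV (conv r v)"
    unfolding uniformly_continuous_on_def
  proof (intro allI impI)
    fix e :: real assume "0 < e"
    then have "0 < e / I" using I by simp
    with uniformly_continuous_bounded_support[OF r]
    obtain d where d: "0 < d" "\<And>x y. dist y x < d \<Longrightarrow> dist (r y) (r x) < e / I"
      unfolding uniformly_continuous_on_def by (metis UNIV_I)
    have "dist (conv r v y) (conv r v x) < e" if "dist y x < d" for x y
    proof -
      have "\<bar>conv r v y - conv r v x\<bar> = \<bar>\<integral>z. (r (y - z) - r (x - z)) * v z \<partial>lborel\<bar>"
        using integrable_conv[OF r v] by (simp add: conv_def left_diff_distrib)
      also have "\<dots> \<le> (\<integral>z. e / I * \<bar>v z\<bar> \<partial>lborel)"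
      proof (rule integral_abs_bound[THEN order_trans], rule integral_mono)
        show "integrable lborel (\<lambda>z. \<bar>(r (y - z) - r (x - z)) * v z\<bar>)"
          using integrable_conv[OF r v] by (simp add: left_diff_distrib)
        fix z show "\<bar>(r (y - z) - r (x - z)) * v z\<bar> \<le> e / I * \<bar>v z\<bar>"
          using d(2)[of "y - z" "x - z"] that
          unfolding abs_mult by (intro mult_right_mono) (auto simp: dist_real_def dist_norm)
      qed (use v in auto)
      also have "\<dots> = e * ((I - 1) / I)" by (simp add: I_def)
      also have "\<dots> < e * 1" using \<open>0 < e\<close> I by (intro mult_strict_left_mono) (auto simp: field_simps)
      finally show ?thesis by (simp add: dist_real_def)
    qed
    then show "\<exists>d>0. \<forall>x\<in>UNIV. \<forall>x'\<in>UNIV. dist x' x < d \<longrightarrow> dist (conv r v x') (conv r v x) < e"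
      using d(1) by blast
  qed
  then show ?case by (simp add: uniformly_continuous_imp_continuous)
next
  case (Suc k)
  let ?D = "\<lambda>x. frechet_derivative r (at x)"
  have r1: "Ck (Suc 0) r"
    using Suc.prems(1) Ck_imp_continuous by auto
  have D0: "\<And>x h. R < norm x \<Longrightarrow> ?D x h = 0"
    by (rule frechet_derivative_bounded_support[OF Suc.prems(2)])
  have Dc: "continuous_on UNIV (\<lambda>x. ?D x h)" for h using r1 by simp
  note intD = integrable_conv[OF Dc D0 v]
  note intr = integrable_conv[OF Ck_imp_continuous[OF Suc.prems(1)] Suc.prems(2) v]
  have lin: "linear (?D x)" for x
    using Ck_Suc_has_derivative[OF Suc.prems(1)] has_derivative_linear by blast
  show ?case
  proof (rule Ck_SucI[where f'="\<lambda>x h. conv (\<lambda>z. ?D z h) v x"])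
    fix x :: 'a
    let ?L = "\<lambda>h. conv (\<lambda>z. ?D z h) v x"
    define I where "I = (\<integral>y. \<bar>v y\<bar> \<partial>lborel) + 1"
    have I: "0 < I" by (simp add: I_def add_nonneg_pos)
    have Llin: "linear ?L"
      using intD by (intro linearI)
        (auto simp: conv_def linear_add[OF lin] linear_scale[OF lin] distrib_right mult.assoc)
    have "(conv r v has_derivative ?L) (at x within UNIV)"
      unfolding has_derivative_within_alt
    proof (intro conjI allI impI)
      show "bounded_linear ?L" using Llin by (simp add: linear_conv_bounded_linear)
    next
      fix e :: real assume "0 < e"
      then have "0 < e / I" using I by simp
      from Ck_uniform_linearization[where R=R, OF r1 Suc.prems(2) this]
      obtain d where d: "0 < d" "\<And>z h. norm h < d \<Longrightarrow> \<bar>r (z + h) - r z - ?D z h\<bar> \<le> e / I * norm h"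
        by auto
      have "norm (conv r v y - conv r v x - ?L (y - x)) \<le> e * norm (y - x)" if "norm (y - x) < d" for y
      proof -
        have "\<bar>conv r v y - conv r v x - ?L (y - x)\<bar>
          = \<bar>\<integral>z. (r (y - z) - r (x - z) - ?D (x - z) (y - x)) * v z \<partial>lborel\<bar>"
          using intr intD by (simp add: conv_def left_diff_distrib)
        also have "\<dots> \<le> (\<integral>z. e / I * norm (y - x) * \<bar>v z\<bar> \<partial>lborel)"
        proof (rule integral_abs_bound[THEN order_trans], rule integral_mono)
          show "integrable lborel (\<lambda>z. \<bar>(r (y - z) - r (x - z) - ?D (x - z) (y - x)) * v z\<bar>)"
            using intr intD by (simp add: left_diff_distrib)
          fix z show "\<bar>(r (y - z) - r (x - z) - ?D (x - z) (y - x)) * v z\<bar> \<le> e / I * norm (y - x) * \<bar>v z\<bar>"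
            using d(2)[OF that, of "x - z"] unfolding abs_mult by (intro mult_right_mono) (auto simp: algebra_simps)
        qed (use v in auto)
        also have "\<dots> = e * norm (y - x) * ((I - 1) / I)" by (simp add: I_def)
        also have "\<dots> \<le> e * norm (y - x) * 1" using \<open>0 < e\<close> I by (intro mult_left_mono) (auto simp: field_simps)
        finally show ?thesis by simp
      qed
      then show "\<exists>d>0. \<forall>y\<in>UNIV. norm (y - x) < d \<longrightarrow> norm (conv r v y - conv r v x - ?L (y - x)) \<le> e * norm (y - x)"
        using d(1) by blast
    qed
    then show "(conv r v has_derivative ?L) (at x)" by simp
  next
    fix h show "Ck k (conv (\<lambda>z. ?D z h) v)"
      using Suc.prems(1) D0 by (intro Suc.IH) auto
  qed
qed

lemma mollifier_exists:
  assumes "0 < e"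
  obtains r :: "'a::euclidean_space \<Rightarrow> real" where
    "\<And>k. Ck k r" "\<And>x. 0 \<le> r x" "\<And>x. e < norm x \<Longrightarrow> r x = 0"
    "integrable lborel r" "integral\<^sup>L lborel r = 1"
proof -
  define f where "f = (\<lambda>x::'a. flat 0 (e ^ 2 - x \<bullet> x))"
  have f: "\<And>k. Ck k f" unfolding f_def by (rule Ck_flat)
  have f0: "f x = 0" if "e \<le> norm x" for x
    using that assms power_mono[of e "norm x" 2] by (auto simp: f_def flat_def power2_norm_eq_inner)
  have fn: "0 \<le> f x" for x by (simp add: f_def flat_nonneg)
  have fc: "continuous_on UNIV f" using Ck_imp_continuous[OF f] .
  have f0': "f 0 > 0" using assms by (simp add: f_def flat_def)
  have fi: "integrable lborel f"
  proof -
    have "integrable lborel (\<lambda>x. indicator (cball 0 e) x *\<^sub>R f x)"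
      by (rule borel_integrable_compact[OF compact_cball]) (rule continuous_on_subset[OF fc], simp)
    also have "(\<lambda>x. indicator (cball 0 e) x *\<^sub>R f x) = f"
      using f0 by (force simp: indicator_def)
    finally show ?thesis .
  qed
  \<comment> \<open>A continuous nonnegative function with integral zero vanishes almost everywhere.
    The open set where it is nonzero would then be null, yet it contains a ball around the
    origin.\<close>
  have pos: "0 < integral\<^sup>L lborel f"
  proof (rule ccontr)
    assume "\<not> 0 < integral\<^sup>L lborel f"
    then have "integral\<^sup>L lborel f = 0" using integral_nonneg_AE[where M=lborel and f=f] fn by (simp add: not_less order_antisym)
    then have "AE x in lborel. f x = 0"
      using integral_nonneg_eq_0_iff_AE[OF fi] fn by auto
    moreover have op: "open {x. f x \<noteq> 0}"
      using fc by (intro open_Collect_neq continuous_intros) auto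
    ultimately have "emeasure lborel {x. f x \<noteq> 0} = 0"
      by (subst (asm) AE_iff_measurable) auto
    moreover obtain d where "0 < d" "ball 0 d \<subseteq> {x. f x \<noteq> 0}"
      using op f0' unfolding open_contains_ball by fastforce
    moreover have "emeasure lborel (ball (0::'a) d) \<noteq> 0"
      using \<open>0 < d\<close> unit_ball_vol_pos[of "real DIM('a)", THEN less_imp_neq] by (auto simp: emeasure_ball)
    ultimately show False using emeasure_mono[of "ball 0 d" "{x. f x \<noteq> 0}" lborel] op by auto
  qed
  show ?thesis
  proof (rule that[of "\<lambda>x. 1 / integral\<^sup>L lborel f * f x"])
    show "Ck k (\<lambda>x. 1 / integral\<^sup>L lborel f * f x)" for k by (intro Ck_mult Ck_const f)
  qed (use pos fi f0 fn in auto)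
qed

subsection \<open>Approximation by mollification\<close>

lemma integrable_indicator_cball: "integrable lborel (\<lambda>x::'a::euclidean_space. B * indicator (cball 0 r) x :: real)"
proof -
  have "emeasure lborel (cball (0::'a) r) < \<infinity>"
    by (intro emeasure_bounded_finite bounded_cball)
  then show ?thesis by (intro integrable_mult_right integrable_real_indicator) auto
qed

text \<open>Clamping \<open>f\<close> to a large level \<open>B\<close> costs little in
  \<open>L^1\<close>. The continuous functions that converge to \<open>f\<close> off a negligible
  set come with no size control, so they are clamped to the same level and multiplied by a cutoff;
  after that dominated convergence applies.\<close>

lemma continuous_L1_approximation:
  fixes f :: "'a::euclidean_space \<Rightarrow> real"
  assumes f: "integrable lborel f" and R: "\<And>x. R < norm x \<Longrightarrow> f x = 0" and e: "0 < e"
  shows "\<exists>c. continuous_on UNIV c \<and> (\<forall>x. R + 1 < norm x \<longrightarrow> c x = 0) \<and>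
    integrable lborel c \<and> (\<integral>x. \<bar>f x - c x\<bar> \<partial>lborel) < e"
proof -
  have fm [measurable]: "f \<in> borel_measurable borel" using f by auto
  let ?cl = "\<lambda>B t::real. max (- B) (min B t)"
  have "(\<lambda>n. \<integral>x. \<bar>f x - ?cl (real n) (f x)\<bar> \<partial>lborel) \<longlonglongrightarrow> (\<integral>x. 0 \<partial>(lborel :: 'a measure))"
  proof (rule integral_dominated_convergence[where w="\<lambda>x. 2 * \<bar>f x\<bar>"])
    show "AE x in lborel. (\<lambda>n. \<bar>f x - ?cl (real n) (f x)\<bar>) \<longlonglongrightarrow> 0"
    proof (rule AE_I2)
      fix x
      obtain N where "\<bar>f x\<bar> \<le> real N" using real_arch_simple by blast
      then have "\<bar>f x - ?cl (real n) (f x)\<bar> = 0" if "N \<le> n" for n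
        using that by (auto simp: max_def min_def)
      then have "\<forall>\<^sub>F n in sequentially. \<bar>f x - ?cl (real n) (f x)\<bar> = 0"
        unfolding eventually_sequentially by blast
      then show "(\<lambda>n. \<bar>f x - ?cl (real n) (f x)\<bar>) \<longlonglongrightarrow> 0" by (rule tendsto_eventually)
    qed
  qed (use f in \<open>auto simp: max_def min_def\<close>)
  then obtain B where B: "(\<integral>x. \<bar>f x - ?cl (real B) (f x)\<bar> \<partial>lborel) < e / 2"
    using order_tendstoD(2)[of _ "0::real" sequentially "e / 2"] e
    by (auto simp: eventually_sequentially)
  have "f measurable_on UNIV"
    using sets.top[of "lebesgue :: 'a measure"]
    by (intro lebesgue_measurable_imp_measurable_on measurable_completion) simp_all
  then obtain N g where N: "negligible N" and g: "\<And>n. continuous_on UNIV (g n)"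
    and gf: "\<And>x. x \<notin> N \<Longrightarrow> (\<lambda>n. g n x) \<longlonglongrightarrow> f x"
    unfolding measurable_on_def by auto
  \<comment> \<open>The cutoff equals 1 where \<open>f\<close> may be nonzero and vanishes beyond
    radius \<open>R + 1\<close>, so multiplying by it does not disturb the limit.\<close>
  define chi where "chi x = max 0 (min 1 (R + 1 - norm x))" for x :: 'a
  define c where "c n x = ?cl (real B) (g n x) * chi x" for n x
  have chi_c: "continuous_on UNIV chi" unfolding chi_def by (intro continuous_intros)
  have c_c: "continuous_on UNIV (c n)" for n
    unfolding c_def by (intro continuous_intros g chi_c)
  have [measurable]: "c n \<in> borel_measurable borel" for n
    by (intro borel_measurable_continuous_onI c_c)
  have c_le: "\<bar>c n x\<bar> \<le> real B * indicator (cball 0 (R + 1)) x" for n x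
    by (cases "norm x \<le> R + 1")
      (auto simp: c_def chi_def abs_mult intro!: mult_left_le[THEN order_trans] mult_mono[of _ _ _ 1, simplified])
  have ci: "integrable lborel (\<lambda>x::'a. real B * indicator (cball 0 (R + 1)) x)"
    by (rule integrable_indicator_cball)
  have c_int: "integrable lborel (c n)" for n
    by (rule Bochner_Integration.integrable_bound[OF ci]) (use c_le in auto)
  have AE: "AE x in lborel. (\<lambda>n. \<bar>?cl (real B) (f x) - c n x\<bar>) \<longlonglongrightarrow> 0"
  proof -
    have "AE x in lebesgue. x \<notin> N"
      using N by (simp add: negligible_iff_null_sets AE_not_in)
    then have "AE x in lborel. x \<notin> N" by (simp add: AE_completion_iff)
    then show ?thesis
    proof eventually_elim
      fix x assume "x \<notin> N"
      then have "(\<lambda>n. \<bar>?cl (real B) (f x) - c n x\<bar>) \<longlonglongrightarrow> \<bar>?cl (real B) (f x) - ?cl (real B) (f x) * chi x\<bar>"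
        unfolding c_def by (intro tendsto_intros gf)
      moreover have "?cl (real B) (f x) * chi x = ?cl (real B) (f x)"
        using R[of x] by (cases "R < norm x") (auto simp: chi_def)
      ultimately show "(\<lambda>n. \<bar>?cl (real B) (f x) - c n x\<bar>) \<longlonglongrightarrow> 0" by simp
    qed
  qed
  have "(\<lambda>n. \<integral>x. \<bar>?cl (real B) (f x) - c n x\<bar> \<partial>lborel) \<longlonglongrightarrow> (\<integral>x. 0 \<partial>(lborel :: 'a measure))"
  proof (rule integral_dominated_convergence[where w="\<lambda>x. \<bar>f x\<bar> + real B * indicator (cball 0 (R + 1)) x"])
    show "AE x in lborel. norm \<bar>?cl (real B) (f x) - c n x\<bar> \<le> \<bar>f x\<bar> + real B * indicator (cball 0 (R + 1)) x" for n
    proof (rule AE_I2)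
      fix x
      have "\<bar>?cl (real B) (f x)\<bar> \<le> \<bar>f x\<bar>" by (auto simp: max_def min_def)
      then show "norm \<bar>?cl (real B) (f x) - c n x\<bar> \<le> \<bar>f x\<bar> + real B * indicator (cball 0 (R + 1)) x"
        using c_le[of n x] abs_triangle_ineq4[of "?cl (real B) (f x)" "c n x"] by simp
    qed
  qed (use f ci AE in auto)
  then obtain n where n: "(\<integral>x. \<bar>?cl (real B) (f x) - c n x\<bar> \<partial>lborel) < e / 2"
    using order_tendstoD(2)[of _ "0::real" sequentially "e / 2"] e
    by (auto simp: eventually_sequentially)
  have cli: "integrable lborel (\<lambda>x. ?cl (real B) (f x))"
    by (rule Bochner_Integration.integrable_bound[OF f]) (auto simp: max_def min_def)
  have "(\<integral>x. \<bar>f x - c n x\<bar> \<partial>lborel)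
      \<le> (\<integral>x. \<bar>f x - ?cl (real B) (f x)\<bar> + \<bar>?cl (real B) (f x) - c n x\<bar> \<partial>lborel)"
    using f cli c_int by (intro integral_mono) auto
  also have "\<dots> < e" using f cli c_int B n by (subst Bochner_Integration.integral_add) auto
  finally show ?thesis
    using c_c[of n] c_int[of n] by (intro exI[of _ "c n"]) (auto simp: c_def chi_def)
qed

lemma lborel_reflect: "lborel = distr lborel borel (\<lambda>z. x - z :: 'a::euclidean_space)"
  using lborel_affine[of "-1" x] by (simp add: density_1)

lemma lborel_shift: "lborel = distr lborel borel (\<lambda>z. z - x :: 'a::euclidean_space)"
proof -
  have "(+) (- x) = (\<lambda>z. z - x)" by auto
  then show ?thesis using lborel_distr_plus[of "- x"] by simp
qed

lemma nn_integral_lborel_reflect: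
  "f \<in> borel_measurable borel \<Longrightarrow> (\<integral>\<^sup>+ z. f (x - z :: 'a::euclidean_space) \<partial>lborel) = (\<integral>\<^sup>+ z. f z \<partial>lborel)"
  by (subst (2) lborel_reflect[of x]) (simp add: nn_integral_distr)

lemma nn_integral_lborel_shift:
  "f \<in> borel_measurable borel \<Longrightarrow> (\<integral>\<^sup>+ z. f (z - x :: 'a::euclidean_space) \<partial>lborel) = (\<integral>\<^sup>+ z. f z \<partial>lborel)"
  by (subst (2) lborel_shift[of x]) (simp add: nn_integral_distr)

lemma conv_alt:
  fixes r v :: "'a::euclidean_space \<Rightarrow> real"
  assumes [measurable]: "r \<in> borel_measurable borel" "v \<in> borel_measurable borel"
  shows "conv r v x = (\<integral>z. r z * v (x - z) \<partial>lborel)"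
  unfolding conv_def by (subst (2) lborel_reflect[of x]) (simp add: integral_distr)

lemma integrable_conv_alt:
  fixes r v :: "'a::euclidean_space \<Rightarrow> real"
  assumes [measurable]: "r \<in> borel_measurable borel" "v \<in> borel_measurable borel"
  shows "integrable lborel (\<lambda>y. r (x - y) * v y) \<longleftrightarrow> integrable lborel (\<lambda>z. r z * v (x - z))"
proof -
  have "integrable lborel (\<lambda>z. r z * v (x - z)) \<longleftrightarrow> integrable (distr lborel borel (\<lambda>z. x - z)) (\<lambda>z. r z * v (x - z))"
    using lborel_reflect[of x] by metis
  also have "\<dots> \<longleftrightarrow> integrable lborel (\<lambda>z. r (x - z) * v z)"
    by (subst integrable_distr_eq) auto
  finally show ?thesis by simp
qed

text \<open>The radius \<open>e\<close> is only an upper bound for the support, so a kernel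
  satisfies the locale for every larger radius too.\<close>

locale mollifier =
  fixes r :: "'a::euclidean_space \<Rightarrow> real" and e :: real
  assumes Ck_r: "\<And>k. Ck k r" and r_nonneg: "\<And>x. 0 \<le> r x"
    and r_support: "\<And>x. e < norm x \<Longrightarrow> r x = 0"
    and r_int: "integrable lborel r" and r_1: "integral\<^sup>L lborel r = 1"
begin

lemma r_cont: "continuous_on UNIV r"
  using Ck_r[of 0] by simp

lemma r_measurable [measurable]: "r \<in> borel_measurable borel"
  using r_int by auto

lemma nn_r: "(\<integral>\<^sup>+ z. ennreal (r z) \<partial>lborel) = 1"
  using nn_integral_eq_integral[OF r_int] r_nonneg r_1 by simp

lemma conv_int:
  assumes v: "integrable lborel v"
  shows "integrable lborel (\<lambda>y. r (x - y) * v y)" "integrable lborel (\<lambda>z. r z * v (x - z))"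
proof -
  show "integrable lborel (\<lambda>y. r (x - y) * v y)"
    by (rule integrable_conv[OF r_cont r_support v])
  then show "integrable lborel (\<lambda>z. r z * v (x - z))"
    using v by (subst (asm) integrable_conv_alt) auto
qed

lemma conv_measurable: "integrable lborel v \<Longrightarrow> conv r v \<in> borel_measurable borel"
  using Ck_conv[of v 0 r e] Ck_r[of 0] r_support by (auto intro: borel_measurable_continuous_onI)

lemma conv_L1:
  assumes v: "integrable lborel v"
  shows "(\<integral>\<^sup>+ x. ennreal \<bar>conv r v x\<bar> \<partial>lborel) \<le> (\<integral>\<^sup>+ x. ennreal \<bar>v x\<bar> \<partial>lborel)"
proof -
  have [measurable]: "v \<in> borel_measurable borel" using v by auto
  have "(\<integral>\<^sup>+ x. ennreal \<bar>conv r v x\<bar> \<partial>lborel) \<le> (\<integral>\<^sup>+ x. \<integral>\<^sup>+ y. ennreal (r (x - y) * \<bar>v y\<bar>) \<partial>lborel \<partial>lborel)"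
  proof (rule nn_integral_mono)
    fix x
    have "\<bar>conv r v x\<bar> \<le> (\<integral>y. r (x - y) * \<bar>v y\<bar> \<partial>lborel)"
      unfolding conv_def using integral_abs_bound[of lborel "\<lambda>y. r (x - y) * v y"]
      by (simp add: abs_mult r_nonneg)
    moreover have "integrable lborel (\<lambda>y. r (x - y) * \<bar>v y\<bar>)"
      using integrable_abs[OF conv_int(1)[OF v, of x]] by (simp add: abs_mult r_nonneg)
    ultimately show "ennreal \<bar>conv r v x\<bar> \<le> (\<integral>\<^sup>+ y. ennreal (r (x - y) * \<bar>v y\<bar>) \<partial>lborel)"
      using r_nonneg by (subst nn_integral_eq_integral) (auto intro: ennreal_leI)
  qed
  also have "\<dots> = (\<integral>\<^sup>+ y. \<integral>\<^sup>+ x. ennreal (r (x - y) * \<bar>v y\<bar>) \<partial>lborel \<partial>lborel)"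
    by (rule lborel_pair.Fubini') measurable
  also have "\<dots> = (\<integral>\<^sup>+ y. ennreal \<bar>v y\<bar> \<partial>lborel)"
    by (intro nn_integral_cong) (simp add: ennreal_mult'' nn_integral_multc nn_integral_lborel_shift[of "\<lambda>z. ennreal (r z)"] nn_r)
  finally show ?thesis .
qed

lemma conv_integrable: "integrable lborel v \<Longrightarrow> integrable lborel (conv r v)"
  using conv_L1[of v] conv_measurable[of v]
  by (auto simp: integrable_iff_bounded intro: le_less_trans)

lemma conv_L1': "integrable lborel v \<Longrightarrow> (\<integral>x. \<bar>conv r v x\<bar> \<partial>lborel) \<le> (\<integral>x. \<bar>v x\<bar> \<partial>lborel)"
  using conv_L1[of v] conv_integrable[of v]
  by (simp add: nn_integral_eq_integral)

end

text \<open>Three errors of size \<open>d / 3\<close>: the distance from \<open>v\<close> to a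
  continuous \<open>c\<close>, the same distance after convolution, which is a contraction of
  \<open>L^1\<close>, and the error for \<open>c\<close>, which is uniformly small on a fixed ball
  by uniform continuity.\<close>

lemma conv_tendsto_L1:
  fixes v :: "'a::euclidean_space \<Rightarrow> real"
  assumes r: "\<And>m. mollifier (r m) (e m)" and e: "e \<longlonglongrightarrow> 0" and e1: "\<And>m. e m \<le> 1"
    and v: "integrable lborel v" and R: "\<And>x. R < norm x \<Longrightarrow> v x = 0"
  shows "(\<lambda>m. \<integral>x. \<bar>conv (r m) v x - v x\<bar> \<partial>lborel) \<longlonglongrightarrow> 0"
proof (rule LIMSEQ_I)
  fix d :: real assume d: "0 < d"
  obtain c where c: "continuous_on UNIV c" "\<And>x. R + 1 < norm x \<Longrightarrow> c x = 0" "integrable lborel c"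
    and vc: "(\<integral>x. \<bar>v x - c x\<bar> \<partial>lborel) < d / 3"
    using continuous_L1_approximation[where R=R and e="d / 3", OF v R] d by auto
  define I where "I = measure lborel (cball (0::'a) (R + 2)) + 1"
  have I: "0 < I" by (simp add: I_def add_nonneg_pos)
  have "uniformly_continuous_on UNIV c" using c(1,2) by (rule uniformly_continuous_bounded_support)
  then obtain b where b: "0 < b" "\<And>x y. dist y x < b \<Longrightarrow> dist (c y) (c x) < d / 3 / I"
    unfolding uniformly_continuous_on_def using d I by (metis UNIV_I divide_pos_pos zero_less_numeral)
  from order_tendstoD(2)[OF e b(1)] obtain M where M: "\<And>m. M \<le> m \<Longrightarrow> e m < b"
    by (auto simp: eventually_sequentially)
  have "(\<integral>x. \<bar>conv (r m) v x - v x\<bar> \<partial>lborel) < d" if m: "M \<le> m" for m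
  proof -
    interpret mollifier "r m" "e m" by (rule r)
    have [measurable]: "c \<in> borel_measurable borel" using c(3) by auto
    \<comment> \<open>Since \<open>c\<close> vanishes beyond \<open>R + 1\<close> and
      \<open>e m \<le> 1\<close>, both terms vanish beyond \<open>R + 2\<close>; this turns the
      uniform estimate into one with finite integral.\<close>
    have cc: "\<bar>conv (r m) c x - c x\<bar> \<le> d / 3 / I * indicator (cball 0 (R + 2)) x" for x
    proof -
      have "conv (r m) c x - c x = (\<integral>z. r m z * (c (x - z) - c x) \<partial>lborel)"
        using conv_int(2)[OF c(3), of x] r_int r_1 by (simp add: conv_alt right_diff_distrib)
      also have "\<bar>\<dots>\<bar> \<le> (\<integral>z. r m z * (d / 3 / I * indicator (cball 0 (R + 2)) x) \<partial>lborel)"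
      proof (rule integral_abs_bound[THEN order_trans], rule integral_mono)
        show "integrable lborel (\<lambda>z. \<bar>r m z * (c (x - z) - c x)\<bar>)"
          using conv_int(2)[OF c(3), of x] r_int by (simp add: right_diff_distrib)
        show "integrable lborel (\<lambda>z. r m z * (d / 3 / I * indicator (cball 0 (R + 2)) x))"
          using r_int by (intro integrable_mult_left)
        fix z
        show "\<bar>r m z * (c (x - z) - c x)\<bar> \<le> r m z * (d / 3 / I * indicator (cball 0 (R + 2)) x)"
        proof (cases "norm z \<le> e m")
          case True
          have "\<bar>c (x - z) - c x\<bar> \<le> d / 3 / I * indicator (cball 0 (R + 2)) x"
          proof (cases "norm x \<le> R + 2")
            case True
            then show ?thesis using b(2)[of "x - z" x] M[OF m] \<open>norm z \<le> e m\<close>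
              by (auto simp: dist_real_def dist_norm)
          next
            case False
            have "norm x - norm z \<le> norm (x - z)" by (rule norm_triangle_ineq2)
            then have "R + 1 < norm (x - z)" using False True e1[of m] by linarith
            then show ?thesis using c(2) False by simp
          qed
          then show ?thesis unfolding abs_mult using r_nonneg[of z] by (intro mult_mono) auto
        qed (simp add: r_support)
      qed
      also have "\<dots> = d / 3 / I * indicator (cball 0 (R + 2)) x" using r_1 by simp
      finally show ?thesis .
    qed
    have "(\<integral>x. \<bar>conv (r m) c x - c x\<bar> \<partial>lborel) \<le> (\<integral>x. d / 3 / I * indicator (cball 0 (R + 2)) x \<partial>(lborel::'a measure))"
      using conv_integrable[OF c(3)] c(3) cc
      by (intro integral_mono integrable_indicator_cball) auto
    also have "\<dots> = d / 3 * ((I - 1) / I)" by (simp add: I_def)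
    also have "\<dots> \<le> d / 3 * 1" using d I by (intro mult_left_mono) (auto simp: field_simps)
    finally have 1: "(\<integral>x. \<bar>conv (r m) c x - c x\<bar> \<partial>lborel) \<le> d / 3" by simp
    have vci: "integrable lborel (\<lambda>x. v x - c x)" using v c(3) by simp
    have 2: "(\<integral>x. \<bar>conv (r m) (\<lambda>x. v x - c x) x\<bar> \<partial>lborel) < d / 3"
      using conv_L1'[OF vci] vc by simp
    have "conv (r m) (\<lambda>x. v x - c x) x = conv (r m) v x - conv (r m) c x" for x
      using conv_int(1)[OF v] conv_int(1)[OF c(3)] by (simp add: conv_def right_diff_distrib)
    then have "\<bar>conv (r m) v x - v x\<bar> \<le> \<bar>conv (r m) (\<lambda>x. v x - c x) x\<bar> + \<bar>conv (r m) c x - c x\<bar> + \<bar>v x - c x\<bar>" for x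
      by simp
    then have "(\<integral>x. \<bar>conv (r m) v x - v x\<bar> \<partial>lborel)
      \<le> (\<integral>x. \<bar>conv (r m) (\<lambda>x. v x - c x) x\<bar> + \<bar>conv (r m) c x - c x\<bar> + \<bar>v x - c x\<bar> \<partial>lborel)"
      using conv_integrable[OF v] conv_integrable[OF vci] conv_integrable[OF c(3)] v c(3)
      by (intro integral_mono) auto
    also have "\<dots> = (\<integral>x. \<bar>conv (r m) (\<lambda>x. v x - c x) x\<bar> \<partial>lborel) + (\<integral>x. \<bar>conv (r m) c x - c x\<bar> \<partial>lborel)
        + (\<integral>x. \<bar>v x - c x\<bar> \<partial>lborel)"
      using conv_integrable[OF v] conv_integrable[OF vci] conv_integrable[OF c(3)] v c(3) by simp
    finally show ?thesis using 1 2 vc by simp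
  qed
  then show "\<exists>no. \<forall>m\<ge>no. norm ((\<integral>x. \<bar>conv (r m) v x - v x\<bar> \<partial>lborel) - 0) < d"
    by auto
qed

section \<open>The product of two Lebesgue measures\<close>

abbreviation leb2 :: "('a::euclidean_space \<times> 'a) measure" where
  "leb2 \<equiv> lebesgue \<Otimes>\<^sub>M lebesgue"

interpretation lebesgue: sigma_finite_measure "lebesgue :: 'a::euclidean_space measure"
proof
  obtain A :: "'a set set" where "countable A" "A \<subseteq> sets lborel" "\<Union> A = space lborel"
      "\<forall>a\<in>A. emeasure lborel a \<noteq> \<infinity>"
    using lborel.sigma_finite_countable by blast
  then show "\<exists>A::'a set set. countable A \<and> A \<subseteq> sets lebesgue \<and> \<Union> A = space lebesgue \<and>
      (\<forall>a\<in>A. emeasure lebesgue a \<noteq> \<infinity>)"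
    by (intro exI[of _ A]) (auto intro: sets_completionI_sets)
qed

interpretation lebesgue_pair: pair_sigma_finite "lebesgue :: 'a::euclidean_space measure" "lebesgue :: 'a measure" ..

lemma AE_leb2_fst: "AE x in lebesgue. P x \<Longrightarrow> AE z in leb2. P (fst z)"
proof -
  assume "AE x in lebesgue. P x"
  then obtain N where N: "N \<in> null_sets lebesgue" "{x. \<not> P x} \<subseteq> N" by (auto simp: eventually_ae_filter)
  have "N \<times> UNIV \<in> null_sets leb2"
    using N(1) by (intro lebesgue.times_in_null_sets1) auto
  then show ?thesis by (rule AE_I') (use N(2) in auto)
qed

lemma AE_leb2_snd: "AE x in lebesgue. P x \<Longrightarrow> AE z in leb2. P (snd z)"
proof -
  assume "AE x in lebesgue. P x"
  then obtain N where N: "N \<in> null_sets lebesgue" "{x. \<not> P x} \<subseteq> N" by (auto simp: eventually_ae_filter)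
  have "UNIV \<times> N \<in> null_sets leb2"
    using N(1) by (intro lebesgue.times_in_null_sets2) auto
  then show ?thesis by (rule AE_I') (use N(2) in auto)
qed

lemma fst_leb2 [measurable]: "fst \<in> borel_measurable leb2"
  and snd_leb2 [measurable]: "snd \<in> borel_measurable leb2"
  using measurable_compose[OF measurable_fst[of lebesgue lebesgue] measurable_completion[of "\<lambda>x. x" lborel borel]]
    measurable_compose[OF measurable_snd[of lebesgue lebesgue] measurable_completion[of "\<lambda>x. x" lborel borel]]
  by auto

lemma borel_leb2: "f \<in> borel_measurable (lborel \<Otimes>\<^sub>M lborel) \<Longrightarrow> f \<in> borel_measurable leb2"
proof -
  assume f: "f \<in> borel_measurable (lborel \<Otimes>\<^sub>M lborel)"
  have "(\<lambda>z. (fst z, snd z)) \<in> measurable leb2 (lborel \<Otimes>\<^sub>M lborel)"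
    using fst_leb2 snd_leb2 by (intro measurable_Pair) auto
  from measurable_compose[OF this f] show ?thesis by simp
qed

lemma nn_integral_leb2_borel:
  assumes f: "f \<in> borel_measurable (lborel \<Otimes>\<^sub>M lborel)"
  shows "integral\<^sup>N leb2 f = (\<integral>\<^sup>+ x. \<integral>\<^sup>+ y. f (x, y) \<partial>lborel \<partial>lborel)"
  using lebesgue.nn_integral_fst[OF borel_leb2[OF f]] by (simp add: nn_integral_completion)

subsection \<open>Growth functions\<close>

locale growth =
  fixes G g :: "real \<Rightarrow> real" and p q :: real
  assumes young: "young_growth G g p q"
    and noninc: "antimono_on {0<..} (\<lambda>t. g t / t powr (q - 1))"
begin

lemma p_gt_1: "1 < p" and p_le_q: "p \<le> q" and q_gt_1: "1 < q"
  and g_0 [simp]: "g 0 = 0" and G_1: "G 1 = 1"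
  using young by (auto simp: young_growth_def)

lemma g_strict_mono: "0 \<le> a \<Longrightarrow> a < b \<Longrightarrow> g a < g b"
  using young by (auto simp: young_growth_def strict_mono_on_def)

lemma g_mono: "0 \<le> a \<Longrightarrow> a \<le> b \<Longrightarrow> g a \<le> g b"
  using g_strict_mono[of a b] by (cases "a = b") auto

lemma g_nonneg: "0 \<le> a \<Longrightarrow> 0 \<le> g a"
  using g_mono[of 0 a] by simp

lemma g_pos: "0 < a \<Longrightarrow> 0 < g a"
  using g_strict_mono[of 0 a] by simp

lemma pG_le: "0 \<le> t \<Longrightarrow> p * G t \<le> t * g t"
  and le_qG: "0 \<le> t \<Longrightarrow> t * g t \<le> q * G t"
  and G_deriv: "0 \<le> t \<Longrightarrow> (G has_real_derivative g t) (at t within {0..})"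
  using young by (auto simp: young_growth_def)

lemma G_nonneg: "0 \<le> t \<Longrightarrow> 0 \<le> G t"
  using le_qG[of t] g_nonneg[of t] q_gt_1
  by (smt (verit, best) mult_nonneg_nonneg mult_pos_neg)

lemma G_0 [simp]: "G 0 = 0"
  using pG_le[of 0] G_nonneg[of 0] p_gt_1 by (simp add: mult_le_0_iff)

lemma G_le_tg: "0 \<le> t \<Longrightarrow> G t \<le> t * g t"
  using pG_le[of t] p_gt_1 G_nonneg[of t] mult_right_mono[of 1 p "G t"] by linarith

lemma G_convex: "convex_on {0..} G"
  using young by (simp add: young_growth_def)

lemma G_scale_le: "0 \<le> l \<Longrightarrow> l \<le> 1 \<Longrightarrow> 0 \<le> t \<Longrightarrow> G (l * t) \<le> l * G t"
  using convex_onD[OF G_convex, of l 0 t] by simp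

lemma g_1: "1 \<le> g 1"
  using G_le_tg[of 1] G_1 by simp

lemma G_deriv_pos: "0 < t \<Longrightarrow> (G has_real_derivative g t) (at t)"
  using G_deriv[of t] by (simp add: at_within_interior[of t "{0..}"])

lemma G_mono:
  assumes "0 \<le> a" "a \<le> b" shows "G a \<le> G b"
proof (cases "b = 0")
  case False
  then have "0 < b" using assms by auto
  have "G (a / b * b) \<le> a / b * G b"
    using assms \<open>0 < b\<close> by (intro G_scale_le) auto
  also have "\<dots> \<le> G b"
    using assms \<open>0 < b\<close> G_nonneg[of b] by (intro mult_left_le_one_le) auto
  finally show ?thesis using False by simp
qed (use assms in auto)

text \<open>The monotone quotient enters the development through this inequality. It carries no
  constant in front of the power, unlike the corresponding bound for \<open>G\<close>.\<close>

lemma g_scale: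
  assumes "1 \<le> l" "0 \<le> t" shows "g (l * t) \<le> l powr (q - 1) * g t"
proof (cases "t = 0")
  case False
  then have t: "0 < t" using assms by auto
  have "g (l * t) / (l * t) powr (q - 1) \<le> g t / t powr (q - 1)"
    using t assms by (intro monotone_onD[OF noninc, of t "l * t"]) (auto simp: mult_le_cancel_right1)
  then show ?thesis using t assms
    by (simp add: powr_mult field_simps)
qed simp

lemma g_shrink:
  assumes "0 < m" "m \<le> 1" "0 \<le> t" shows "m powr (q - 1) * g t \<le> g (m * t)"
  using g_scale[of "1 / m" "m * t"] assms by (simp add: powr_divide field_simps)

text \<open>\<open>G\<close> is replaced by \<open>t * g t\<close>, scaled there, and replaced back;
  the way back costs the factor \<open>q\<close>.\<close>

lemma G_scale:
  assumes "1 \<le> l" "0 \<le> t" shows "G (l * t) \<le> q * l powr q * G t"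
proof -
  have "G (l * t) \<le> l * t * g (l * t)" using assms by (intro G_le_tg) auto
  also have "\<dots> \<le> l * t * (l powr (q - 1) * g t)"
    using assms by (intro mult_left_mono g_scale) auto
  also have "\<dots> = l powr q * (t * g t)"
    using assms by (simp add: powr_diff)
  also have "\<dots> \<le> l powr q * (q * G t)"
    using assms by (intro mult_left_mono le_qG) auto
  finally show ?thesis by (simp add: ac_simps)
qed

lemma G_scale_ex: "0 \<le> l \<Longrightarrow> \<exists>C>0. \<forall>t\<ge>0. G (l * t) \<le> C * G t"
proof (intro exI conjI allI impI)
  fix t :: real assume "0 \<le> l" "0 \<le> t"
  have "G (l * t) \<le> G (max 1 l * t)"
    using \<open>0 \<le> l\<close> \<open>0 \<le> t\<close> by (intro G_mono mult_right_mono) auto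
  also have "\<dots> \<le> q * max 1 l powr q * G t" using \<open>0 \<le> t\<close> by (intro G_scale) auto
  finally show "G (l * t) \<le> q * max 1 l powr q * G t" .
qed (use q_gt_1 in auto)

lemma G_add: "0 \<le> a \<Longrightarrow> 0 \<le> b \<Longrightarrow> G (a + b) \<le> q * 2 powr q * (G a + G b)"
proof -
  assume ab: "0 \<le> a" "0 \<le> b"
  have "G (a + b) \<le> G (2 * max a b)" using ab by (intro G_mono) auto
  also have "\<dots> \<le> q * 2 powr q * G (max a b)" using ab by (intro G_scale) auto
  also have "\<dots> \<le> q * 2 powr q * (G a + G b)"
    using ab q_gt_1 G_nonneg[of a] G_nonneg[of b] by (intro mult_left_mono) (auto simp: max_def)
  finally show ?thesis .
qed

lemma g_add: "0 \<le> a \<Longrightarrow> 0 \<le> b \<Longrightarrow> g (a + b) \<le> 2 powr (q - 1) * (g a + g b)"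
proof -
  assume ab: "0 \<le> a" "0 \<le> b"
  have "g (a + b) \<le> g (2 * max a b)" using ab by (intro g_mono) auto
  also have "\<dots> \<le> 2 powr (q - 1) * g (max a b)" using ab by (intro g_scale) auto
  also have "\<dots> \<le> 2 powr (q - 1) * (g a + g b)"
    using ab g_nonneg[of a] g_nonneg[of b] by (intro mult_left_mono) (auto simp: max_def)
  finally show ?thesis .
qed

text \<open>The derivative of \<open>G x / x powr p\<close> has the sign of
  \<open>x * g x - p * G x\<close>.\<close>

lemma G_powr_mono:
  assumes "0 < a" "a \<le> b" shows "G a / a powr p \<le> G b / b powr p"
proof (rule DERIV_nonneg_imp_nondecreasing[OF assms(2)])
  fix x assume "a \<le> x" "x \<le> b"
  then have x: "0 < x" using assms by auto
  have "((\<lambda>x. G x / x powr p) has_real_derivative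
      (g x * x powr p - G x * (p * x powr (p - 1))) / (x powr p * x powr p)) (at x)"
    using x by (auto intro!: derivative_eq_intros G_deriv_pos simp: powr_diff)
  moreover have "0 \<le> (g x * x powr p - G x * (p * x powr (p - 1))) / (x powr p * x powr p)"
    using pG_le[of x] x mult_right_mono[of "p * G x" "x * g x" "x powr (p - 1)"]
    by (auto simp: powr_diff field_simps)
  ultimately show "\<exists>y. ((\<lambda>x. G x / x powr p) has_real_derivative y) (at x) \<and> 0 \<le> y" by blast
qed

lemma G_shrink:
  assumes "0 \<le> l" "l \<le> 1" "0 \<le> t" shows "G (l * t) \<le> l powr p * G t"
proof (cases "l = 0 \<or> t = 0")
  case False
  then show ?thesis
    using G_powr_mono[of "l * t" t] assms by (auto simp: powr_mult field_simps mult_le_cancel_right1)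
qed (use assms in auto)

text \<open>The nonlinearity of the form, the odd extension of \<open>g\<close>. As a single
  continuous function of the difference quotient it gives measurability and pointwise convergence of
  the integrand.\<close>

definition sg :: "real \<Rightarrow> real" where "sg t = g \<bar>t\<bar> * sgn t"

lemma g_small:
  assumes "0 < t" "t \<le> 1" shows "g t \<le> q * t powr (p - 1)"
proof -
  have "t * g t \<le> q * (t powr p * G 1)"
    using G_shrink[of t 1] assms q_gt_1 by (intro order_trans[OF le_qG mult_left_mono]) auto
  then show ?thesis using assms by (simp add: G_1 powr_diff field_simps)
qed

text \<open>Continuity of \<open>g\<close> is a consequence of its growth: near \<open>t\<close>,
  monotonicity and scaling squeeze \<open>g x\<close> between two powers of \<open>x / t\<close>
  times \<open>g t\<close>, clamped at 1, and both tend to \<open>g t\<close>.\<close>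

lemma isCont_g: assumes "0 < t" shows "isCont g t"
proof -
  let ?l = "\<lambda>x. min 1 (x / t) powr (q - 1) * g t" and ?u = "\<lambda>x. max 1 (x / t) powr (q - 1) * g t"
  have bnd: "?l x \<le> g x \<and> g x \<le> ?u x" if "0 < x" for x
  proof (cases "x \<le> t")
    case True
    have "(x / t) powr (q - 1) * g t \<le> g (x / t * t)"
      using True that assms by (intro g_shrink) auto
    moreover have "g x \<le> g t" using True that by (intro g_mono) auto
    ultimately show ?thesis using True that assms by (auto simp: min_def max_def)
  next
    case False
    have "g (x / t * t) \<le> (x / t) powr (q - 1) * g t"
      using False that assms by (intro g_scale) auto
    moreover have "g t \<le> g x" using False that assms by (intro g_mono) auto
    ultimately show ?thesis using False that assms by (auto simp: min_def max_def)
  qed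
  have ev: "\<forall>\<^sub>F x in at t. 0 < x"
    using assms by (intro order_tendstoD(1)[of "\<lambda>x. x" t]) auto
  have "(?l \<longlongrightarrow> min 1 (t / t) powr (q - 1) * g t) (at t)" "(?u \<longlongrightarrow> max 1 (t / t) powr (q - 1) * g t) (at t)"
    using assms by (intro tendsto_mult tendsto_powr tendsto_min tendsto_max tendsto_divide tendsto_const tendsto_ident_at; simp)+
  then have "(?l \<longlongrightarrow> g t) (at t)" "(?u \<longlongrightarrow> g t) (at t)" using assms by auto
  then have "(g \<longlongrightarrow> g t) (at t)"
    by (rule tendsto_sandwich[rotated 2]) (use ev bnd in \<open>auto elim: eventually_mono\<close>)
  then show ?thesis by (simp add: isCont_def)
qed

lemma continuous_sg: "continuous_on UNIV sg"
proof -
  have pos: "isCont sg t" if "0 < t" for t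
  proof -
    have ev: "\<forall>\<^sub>F x in nhds t. sg x = g x"
      using that by (intro eventually_nhds_in_open[of "{0<..}", THEN eventually_mono]) (auto simp: sg_def)
    show ?thesis using isCont_g[OF that] isCont_cong[OF ev] by simp
  qed
  have neg: "isCont sg t" if "t < 0" for t
  proof -
    have "isCont (\<lambda>x. - g (- x)) t"
      using that isCont_o2[of t uminus g] isCont_g[of "- t"] by (intro continuous_minus) auto
    moreover have ev: "\<forall>\<^sub>F x in nhds t. sg x = - g (- x)"
      using that by (intro eventually_nhds_in_open[of "{..<0}", THEN eventually_mono]) (auto simp: sg_def)
    ultimately show ?thesis using isCont_cong[OF ev] by simp
  qed
  have zero: "isCont sg 0"
  proof -
    \<comment> \<open>At zero the scaling argument says nothing; there
      \<open>g t \<le> q * t powr (p - 1)\<close> with \<open>p > 1\<close> is used.\<close>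
    have "((\<lambda>t. q * \<bar>t\<bar> powr (p - 1)) \<longlongrightarrow> q * \<bar>0\<bar> powr (p - 1)) (at (0::real))"
      using p_gt_1 by (intro tendsto_mult tendsto_powr' tendsto_const tendsto_rabs tendsto_ident_at) auto
    then have "((\<lambda>t. q * \<bar>t\<bar> powr (p - 1)) \<longlongrightarrow> 0) (at (0::real))" using p_gt_1 by simp
    then have "(sg \<longlongrightarrow> 0) (at 0)"
    proof (rule Lim_null_comparison[rotated])
      have "\<forall>\<^sub>F t::real in at 0. t \<in> {-1<..<1} \<and> t \<noteq> 0"
        unfolding eventually_at by (intro exI[of _ 1]) (auto simp: dist_real_def)
      then show "\<forall>\<^sub>F t in at 0. norm (sg t) \<le> q * \<bar>t\<bar> powr (p - 1)"
        by eventually_elim (use g_small g_nonneg in \<open>auto simp: sg_def abs_mult sgn_if\<close>)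
    qed
    then show ?thesis by (simp add: isCont_def sg_def)
  qed
  show ?thesis
    using pos neg zero by (metis continuous_at_imp_continuous_on linorder_neqE_linordered_idom)
qed

lemma abs_sg: "\<bar>sg t\<bar> = g \<bar>t\<bar>"
  using g_nonneg[of "\<bar>t\<bar>"] by (simp add: sg_def abs_mult sgn_if)

lemma sg_uminus: "sg (- t) = - sg t"
  by (simp add: sg_def sgn_if)

lemma continuous_g_abs: "continuous_on UNIV (\<lambda>t. g \<bar>t\<bar>)"
  using continuous_on_rabs[OF continuous_sg] by (simp add: abs_sg)

lemma continuous_G_abs: "continuous_on UNIV (\<lambda>t. G \<bar>t\<bar>)"
proof -
  have "continuous_on {0..} G"
    using G_deriv by (intro DERIV_continuous_on[of _ _ g]) auto
  then show ?thesis
    by (intro continuous_on_compose2[of "{0..}" G UNIV abs] continuous_intros) auto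
qed

lemma borel_measurable_sg [measurable]: "sg \<in> borel_measurable borel"
  by (intro borel_measurable_continuous_onI continuous_sg)

lemma borel_measurable_g_abs [measurable]: "(\<lambda>t. g \<bar>t\<bar>) \<in> borel_measurable borel"
  by (intro borel_measurable_continuous_onI continuous_g_abs)

lemma borel_measurable_G_abs [measurable]: "(\<lambda>t. G \<bar>t\<bar>) \<in> borel_measurable borel"
  by (intro borel_measurable_continuous_onI continuous_G_abs)

text \<open>The small factor is on \<open>G a\<close>. If \<open>b \<le> e * a\<close>, then
  \<open>g a * b \<le> e * (a * g a) \<le> e * q * G a\<close>, whence \<open>e = d / q\<close>;
  otherwise \<open>a\<close> is dominated by \<open>b / e\<close> and everything is bounded by a
  multiple of \<open>G b\<close>.\<close>

lemma young_left:
  assumes "0 < d"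
  shows "\<exists>C>0. \<forall>a\<ge>0. \<forall>b\<ge>0. g a * b \<le> d * G a + C * G b"
proof -
  define e where "e = d / q"
  have e: "0 < e" using assms q_gt_1 by (simp add: e_def)
  obtain C where C: "0 < C" "\<And>t. 0 \<le> t \<Longrightarrow> G (1 / e * t) \<le> C * G t"
    using G_scale_ex[of "1 / e"] e by auto
  have "g a * b \<le> d * G a + q * e * C * G b" if "0 \<le> a" "0 \<le> b" for a b
  proof (cases "b \<le> e * a")
    case True
    have "g a * b \<le> e * (a * g a)" using True that g_nonneg[of a] mult_left_mono[of b "e * a" "g a"] by (simp add: ac_simps)
    also have "\<dots> \<le> e * (q * G a)" using e that by (intro mult_left_mono le_qG) auto
    also have "\<dots> = d * G a" using q_gt_1 by (simp add: e_def)
    finally show ?thesis using C(1) e that q_gt_1 G_nonneg[of b] by (simp add: add_increasing2)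
  next
    case False
    have "g a * b \<le> g (b / e) * b"
      using False that e by (intro mult_right_mono g_mono) (auto simp: field_simps)
    also have "\<dots> = e * (1 / e * b * g (1 / e * b))" using e by simp
    also have "\<dots> \<le> e * (q * (C * G b))"
      using e q_gt_1 that le_qG[of "1 / e * b"] C(2)[of b]
      by (intro mult_left_mono) (auto intro: order_trans[OF _ mult_left_mono])
    finally show ?thesis using assms G_nonneg[of a] that by (simp add: ac_simps add_increasing)
  qed
  then show ?thesis using e C(1) q_gt_1 by (intro exI[of _ "q * e * C"]) auto
qed

text \<open>The small factor is on \<open>G b\<close>. If \<open>a \<le> e * b\<close>, then
  \<open>g a * b\<close> is at most \<open>q * e powr (p - 1) * G b\<close>; since
  \<open>p > 1\<close> the coefficient can be made at most \<open>d\<close>, which dictates the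
  choice of \<open>e\<close>.\<close>

lemma young_right:
  assumes "0 < d"
  shows "\<exists>C>0. \<forall>a\<ge>0. \<forall>b\<ge>0. g a * b \<le> C * G a + d * G b"
proof -
  define e where "e = min 1 ((d / q) powr (1 / (p - 1)))"
  have e: "0 < e" "e \<le> 1" using assms q_gt_1 by (auto simp: e_def)
  have "e powr (p - 1) \<le> ((d / q) powr (1 / (p - 1))) powr (p - 1)"
    using e p_gt_1 by (intro powr_mono2) (auto simp: e_def)
  also have "\<dots> = d / q" using assms p_gt_1 q_gt_1 by (simp add: powr_powr)
  finally have ed: "q * e powr (p - 1) \<le> d" using q_gt_1 by (simp add: field_simps)
  have "g a * b \<le> (q / e) * G a + d * G b" if "0 \<le> a" "0 \<le> b" for a b
  proof (cases "a \<le> e * b")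
    case True
    have "g a * b \<le> g (e * b) * b" using True that by (intro mult_right_mono g_mono) auto
    also have "\<dots> = (e * b * g (e * b)) / e" using e by simp
    also have "\<dots> \<le> q * (e powr p * G b) / e"
      using e that q_gt_1 G_shrink[of e b] le_qG[of "e * b"]
      by (intro divide_right_mono) (auto intro: order_trans[OF _ mult_left_mono])
    also have "\<dots> = q * e powr (p - 1) * G b" using e by (simp add: powr_diff)
    also have "\<dots> \<le> d * G b" using ed that G_nonneg[of b] by (intro mult_right_mono) auto
    finally show ?thesis using e that q_gt_1 G_nonneg[of a] by (simp add: add_increasing)
  next
    case False
    have "g a * b \<le> g a * (a / e)"
      using False that e g_nonneg[of a] by (intro mult_left_mono) (auto simp: field_simps)
    also have "\<dots> \<le> q / e * G a"
      using le_qG[of a] that e by (simp add: field_simps)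
    finally show ?thesis using assms G_nonneg[of b] that by (simp add: add_increasing2)
  qed
  then show ?thesis using e q_gt_1 by (intro exI[of _ "q / e"]) auto
qed

end

lemma comp_leb2 [measurable (raw)]:
  assumes "u \<in> borel_measurable lebesgue"
  shows "(\<lambda>z. u (fst z)) \<in> borel_measurable leb2" "(\<lambda>z. u (snd z)) \<in> borel_measurable leb2"
  using measurable_compose[OF measurable_fst assms] measurable_compose[OF measurable_snd assms] by auto

lemma norm_leb2 [measurable]: "(\<lambda>z. norm (fst z - snd z)) \<in> borel_measurable leb2"
  by (rule measurable_compose[OF borel_measurable_diff[OF fst_leb2 snd_leb2] borel_measurable_norm])

context growth
begin

lemma measurable_G_abs [measurable (raw)]: "f \<in> borel_measurable M \<Longrightarrow> (\<lambda>x. G \<bar>f x\<bar>) \<in> borel_measurable M"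
  using measurable_compose[OF _ borel_measurable_G_abs] .

lemma measurable_g_abs [measurable (raw)]: "f \<in> borel_measurable M \<Longrightarrow> (\<lambda>x. g \<bar>f x\<bar>) \<in> borel_measurable M"
  using measurable_compose[OF _ borel_measurable_g_abs] .

text \<open>Integration of the tangent inequality of \<open>G\<close> at the mean \<open>t\<close>
  against the probability density \<open>r\<close>. The right side is a nonnegative integral, so
  nothing has to be assumed about its finiteness.\<close>

lemma jensen:
  assumes r: "\<And>z. 0 \<le> r z" "integrable M r" "integral\<^sup>L M r = 1"
    and h: "\<And>z. 0 \<le> h z" "h \<in> borel_measurable M" "integrable M (\<lambda>z. r z * h z)"
  shows "ennreal (G (\<integral>z. r z * h z \<partial>M)) \<le> (\<integral>\<^sup>+ z. ennreal (r z * G \<bar>h z\<bar>) \<partial>M)"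
proof (cases "(\<integral>\<^sup>+ z. ennreal (r z * G \<bar>h z\<bar>) \<partial>M) = \<infinity>")
  case False
  have [measurable]: "r \<in> borel_measurable M" "h \<in> borel_measurable M" using r h by auto
  have nn: "0 \<le> r z * G \<bar>h z\<bar>" for z using r G_nonneg by simp
  have int: "integrable M (\<lambda>z. r z * G \<bar>h z\<bar>)"
    using False nn by (intro integrableI_nonneg) (auto simp: less_top)
  define t where "t = (\<integral>z. r z * h z \<partial>M)"
  have t: "0 \<le> t" unfolding t_def using r h by (intro integral_nonneg_AE) auto
  have "G t \<le> (\<integral>z. r z * G \<bar>h z\<bar> \<partial>M)"
  \<comment> \<open>The tangent argument needs \<open>t\<close> in the interior of the half-line; at
    zero the left side is \<open>G 0 = 0\<close>.\<close>
  proof (cases "t = 0")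
    case True
    then show ?thesis using nn by (auto intro: integral_nonneg_AE)
  next
    case False
    then have "0 < t" using t by simp
    have tan: "g t * (y - t) \<le> G y - G t" if "0 \<le> y" for y
      using \<open>0 < t\<close> that
      by (intro convex_on_imp_above_tangent[OF G_convex _ _ _ G_deriv]) auto
    have "(\<integral>z. r z * G t + g t * (r z * h z) - g t * t * r z \<partial>M) \<le> (\<integral>z. r z * G \<bar>h z\<bar> \<partial>M)"
    proof (rule integral_mono[OF _ int])
      fix z
      show "r z * G t + g t * (r z * h z) - g t * t * r z \<le> r z * G \<bar>h z\<bar>"
        using mult_left_mono[OF tan[OF h(1)[of z]] r(1)[of z]] h(1)[of z] by (simp add: algebra_simps)
    qed (use r h in auto)
    also have "(\<integral>z. r z * G t + g t * (r z * h z) - g t * t * r z \<partial>M) = G t"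
      using r h by (simp add: t_def)
    finally show ?thesis .
  qed
  then show ?thesis
    unfolding t_def using nn int by (subst nn_integral_eq_integral) (auto intro: ennreal_leI)
qed simp

section \<open>Energies and their behaviour under mollification\<close>

definition energy :: "real \<Rightarrow> 'a::euclidean_space set \<Rightarrow> ('a \<Rightarrow> real) \<Rightarrow> ennreal" where
  "energy s D u = (\<integral>\<^sup>+ z. indicator (D \<times> D) z *
      ennreal (G \<bar>Ds s u (fst z) (snd z)\<bar> / norm (fst z - snd z) ^ DIM('a)) \<partial>leb2)"

lemma Ds_measurable [measurable (raw)]:
  "u \<in> borel_measurable lebesgue \<Longrightarrow> (\<lambda>z. Ds s u (fst z) (snd z)) \<in> borel_measurable leb2"
  using powr_real_measurable[OF norm_leb2 borel_measurable_const]
  unfolding Ds_def by (intro borel_measurable_divide borel_measurable_diff comp_leb2)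

lemma energy_cong_AE:
  assumes "AE x in lebesgue. u x = v x" shows "energy s D u = energy s D v"
  unfolding energy_def
  by (intro nn_integral_cong_AE, use AE_leb2_fst[OF assms] AE_leb2_snd[OF assms] in eventually_elim)
    (simp add: Ds_def)

lemma energy_mono: "D \<subseteq> D' \<Longrightarrow> energy s D u \<le> energy s D' u"
  unfolding energy_def
  by (intro nn_integral_mono mult_right_mono) (auto simp: indicator_def)

lemma energy_borel:
  fixes u :: "'a::euclidean_space \<Rightarrow> real"
  assumes [measurable]: "u \<in> borel_measurable borel" "D \<in> sets borel"
  shows "energy s D u = (\<integral>\<^sup>+ x. \<integral>\<^sup>+ y. indicator D x * indicator D y *
      ennreal (G \<bar>Ds s u x y\<bar> / norm (x - y) ^ DIM('a)) \<partial>lborel \<partial>lborel)"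
proof -
  have "(\<lambda>z. indicator (D \<times> D) z *
      ennreal (G \<bar>Ds s u (fst z) (snd z)\<bar> / norm (fst z - snd z) ^ DIM('a))) \<in> borel_measurable (lborel \<Otimes>\<^sub>M lborel)"
    unfolding Ds_def by measurable
  from nn_integral_leb2_borel[OF this] show ?thesis
    unfolding energy_def by (simp add: indicator_times)
qed

text \<open>The difference quotient commutes with translations, because \<open>x - z\<close> and
  \<open>y - z\<close> have the same distance as \<open>x\<close> and \<open>y\<close>. Hence the
  quotient of the convolution is an average of translated quotients, and Jensen's inequality
  applies.\<close>

lemma Ds_conv_le:
  assumes "mollifier r e" and v: "integrable lborel v"
  shows "ennreal (G \<bar>Ds s (conv r v) x y\<bar>) \<le> (\<integral>\<^sup>+ z. ennreal (r z * G \<bar>Ds s v (x - z) (y - z)\<bar>) \<partial>lborel)"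
proof -
  interpret mollifier r e by fact
  have [measurable]: "v \<in> borel_measurable borel" using v by auto
  let ?h = "\<lambda>z. \<bar>Ds s v (x - z) (y - z)\<bar>"
  have int: "integrable lborel (\<lambda>z. r z * Ds s v (x - z) (y - z))"
  proof -
    have "integrable lborel (\<lambda>z. (r z * v (x - z) - r z * v (y - z)) / norm (x - y) powr s)"
      using conv_int(2)[OF v] by auto
    then show ?thesis by (simp add: Ds_def right_diff_distrib)
  qed
  then have int': "integrable lborel (\<lambda>z. r z * ?h z)"
    using integrable_abs[OF int] by (simp add: abs_mult r_nonneg)
  have "Ds s (conv r v) x y = (\<integral>z. r z * v (x - z) - r z * v (y - z) \<partial>lborel) / norm (x - y) powr s"
    using conv_int(2)[OF v] by (simp add: Ds_def conv_alt)
  also have "\<dots> = (\<integral>z. r z * Ds s v (x - z) (y - z) \<partial>lborel)"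
    by (simp add: Ds_def right_diff_distrib flip: integral_divide_zero)
  finally have "\<bar>Ds s (conv r v) x y\<bar> \<le> (\<integral>z. r z * ?h z \<partial>lborel)"
    using integral_abs_bound[of lborel "\<lambda>z. r z * Ds s v (x - z) (y - z)"] by (simp add: abs_mult r_nonneg)
  then have "ennreal (G \<bar>Ds s (conv r v) x y\<bar>) \<le> ennreal (G (\<integral>z. r z * ?h z \<partial>lborel))"
    by (intro ennreal_leI G_mono) auto
  also have "\<dots> \<le> (\<integral>\<^sup>+ z. ennreal (r z * G \<bar>?h z\<bar>) \<partial>lborel)"
  proof (rule jensen[OF r_nonneg r_int r_1 _ _ int'])
    show "?h \<in> borel_measurable lborel" unfolding Ds_def by measurable
  qed simp
  finally show ?thesis by simp
qed

lemma nn_integral_G_conv_le: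
  assumes "mollifier r e" and v: "integrable lborel v"
  shows "(\<integral>\<^sup>+ x. ennreal (G \<bar>conv r v x\<bar>) \<partial>lborel) \<le> (\<integral>\<^sup>+ x. ennreal (G \<bar>v x\<bar>) \<partial>lborel)"
proof -
  interpret mollifier r e by fact
  have [measurable]: "v \<in> borel_measurable borel" using v by auto
  have "(\<integral>\<^sup>+ x. ennreal (G \<bar>conv r v x\<bar>) \<partial>lborel)
    \<le> (\<integral>\<^sup>+ x. \<integral>\<^sup>+ z. ennreal (r z * G \<bar>v (x - z)\<bar>) \<partial>lborel \<partial>lborel)"
  proof (rule nn_integral_mono)
    fix x
    have int: "integrable lborel (\<lambda>z. r z * \<bar>v (x - z)\<bar>)"
      using integrable_abs[OF conv_int(2)[OF v]] by (simp add: abs_mult r_nonneg)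
    have "\<bar>conv r v x\<bar> \<le> (\<integral>z. r z * \<bar>v (x - z)\<bar> \<partial>lborel)"
      using integral_abs_bound[of lborel "\<lambda>z. r z * v (x - z)"] by (simp add: abs_mult r_nonneg conv_alt)
    then have "ennreal (G \<bar>conv r v x\<bar>) \<le> ennreal (G (\<integral>z. r z * \<bar>v (x - z)\<bar> \<partial>lborel))"
      by (intro ennreal_leI G_mono) auto
    also have "\<dots> \<le> (\<integral>\<^sup>+ z. ennreal (r z * G \<bar>\<bar>v (x - z)\<bar>\<bar>) \<partial>lborel)"
      by (rule jensen[OF r_nonneg r_int r_1 _ _ int]) auto
    finally show "ennreal (G \<bar>conv r v x\<bar>) \<le> (\<integral>\<^sup>+ z. ennreal (r z * G \<bar>v (x - z)\<bar>) \<partial>lborel)" by simp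
  qed
  also have "\<dots> = (\<integral>\<^sup>+ z. \<integral>\<^sup>+ x. ennreal (r z * G \<bar>v (x - z)\<bar>) \<partial>lborel \<partial>lborel)"
    by (rule lborel_pair.Fubini') measurable
  also have "\<dots> = (\<integral>\<^sup>+ z. ennreal (r z) * (\<integral>\<^sup>+ x. ennreal (G \<bar>v x\<bar>) \<partial>lborel) \<partial>lborel)"
    by (intro nn_integral_cong)
      (simp add: ennreal_mult' r_nonneg nn_integral_cmult nn_integral_lborel_shift[of "\<lambda>x. ennreal (G \<bar>v x\<bar>)"])
  also have "\<dots> = (\<integral>\<^sup>+ x. ennreal (G \<bar>v x\<bar>) \<partial>lborel)"
    by (simp add: nn_integral_multc nn_r)
  finally show ?thesis .
qed

text \<open>After Jensen's inequality the shift \<open>z\<close> is moved outermost by Tonelli and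
  removed by translation invariance in both variables. \<open>D'\<close> must contain all shifts of
  \<open>D\<close> by at most \<open>e\<close>; apart from this enlargement of the set there is no
  loss.\<close>

lemma energy_conv_le:
  fixes D D' :: "'a::euclidean_space set"
  assumes "mollifier r e" and v: "integrable lborel v"
    and [measurable]: "D \<in> sets borel" "D' \<in> sets borel"
    and DD: "\<And>x z. x \<in> D \<Longrightarrow> norm z \<le> e \<Longrightarrow> x - z \<in> D'"
  shows "energy s D (conv r v) \<le> energy s D' v"
proof -
  interpret mollifier r e by fact
  have [measurable]: "v \<in> borel_measurable borel" "conv r v \<in> borel_measurable borel"
    using v conv_measurable by auto
  define n where "n = DIM('a)"
  define F where "F x y = indicator D' x * indicator D' y * ennreal (G \<bar>Ds s v x y\<bar> / norm (x - y) ^ n)" for x y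
  have [measurable]: "(\<lambda>z. F (fst z) (snd z)) \<in> borel_measurable (borel \<Otimes>\<^sub>M borel)"
    unfolding F_def Ds_def by measurable
  have F2 [measurable (raw)]: "(\<lambda>w. F (a w) (b w)) \<in> borel_measurable M"
    if [measurable]: "a \<in> borel_measurable M" "b \<in> borel_measurable M" for a b and M :: "'b measure"
    unfolding F_def Ds_def by measurable
  have "energy s D (conv r v) = (\<integral>\<^sup>+ x. \<integral>\<^sup>+ y. indicator D x * indicator D y *
      ennreal (G \<bar>Ds s (conv r v) x y\<bar> / norm (x - y) ^ n) \<partial>lborel \<partial>lborel)"
    by (simp add: energy_borel n_def)
  also have "\<dots> \<le> (\<integral>\<^sup>+ x. \<integral>\<^sup>+ y. \<integral>\<^sup>+ z. ennreal (r z) * F (x - z) (y - z) \<partial>lborel \<partial>lborel \<partial>lborel)"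
  proof (intro nn_integral_mono)
    fix x y
    show "indicator D x * indicator D y * ennreal (G \<bar>Ds s (conv r v) x y\<bar> / norm (x - y) ^ n)
        \<le> (\<integral>\<^sup>+ z. ennreal (r z) * F (x - z) (y - z) \<partial>lborel)"
    proof (cases "x \<in> D \<and> y \<in> D")
      case True
      have "indicator D x * indicator D y * ennreal (G \<bar>Ds s (conv r v) x y\<bar> / norm (x - y) ^ n)
        = ennreal (1 / norm (x - y) ^ n) * ennreal (G \<bar>Ds s (conv r v) x y\<bar>)"
        using True G_nonneg by (simp add: ennreal_mult[symmetric])
      also have "\<dots> \<le> ennreal (1 / norm (x - y) ^ n) * (\<integral>\<^sup>+ z. ennreal (r z * G \<bar>Ds s v (x - z) (y - z)\<bar>) \<partial>lborel)"
        by (intro mult_left_mono Ds_conv_le[OF assms(1) v]) auto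
      also have "\<dots> = (\<integral>\<^sup>+ z. ennreal (1 / norm (x - y) ^ n) * ennreal (r z * G \<bar>Ds s v (x - z) (y - z)\<bar>) \<partial>lborel)"
        unfolding Ds_def by (rule nn_integral_cmult[symmetric]) measurable
      also have "\<dots> \<le> (\<integral>\<^sup>+ z. ennreal (r z) * F (x - z) (y - z) \<partial>lborel)"
      proof (rule nn_integral_mono)
        fix z
        show "ennreal (1 / norm (x - y) ^ n) * ennreal (r z * G \<bar>Ds s v (x - z) (y - z)\<bar>) \<le> ennreal (r z) * F (x - z) (y - z)"
        proof (cases "norm z \<le> e")
          case zn: True
          then have "x - z \<in> D'" "y - z \<in> D'" using DD True by auto
          then show ?thesis using r_nonneg[of z] G_nonneg[of "\<bar>Ds s v (x - z) (y - z)\<bar>"]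
            by (simp add: F_def ennreal_mult[symmetric])
        qed (simp add: r_support)
      qed
      finally show ?thesis .
    qed (auto simp: indicator_def)
  qed
  also have "\<dots> = (\<integral>\<^sup>+ x. \<integral>\<^sup>+ z. \<integral>\<^sup>+ y. ennreal (r z) * F (x - z) (y - z) \<partial>lborel \<partial>lborel \<partial>lborel)"
    by (intro nn_integral_cong lborel_pair.Fubini') measurable
  also have "\<dots> = (\<integral>\<^sup>+ z. \<integral>\<^sup>+ x. \<integral>\<^sup>+ y. ennreal (r z) * F (x - z) (y - z) \<partial>lborel \<partial>lborel \<partial>lborel)"
    by (rule lborel_pair.Fubini') measurable
  also have "\<dots> = (\<integral>\<^sup>+ z. ennreal (r z) * energy s D' v \<partial>lborel)"
  proof (rule nn_integral_cong)
    fix z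
    have "(\<integral>\<^sup>+ x. \<integral>\<^sup>+ y. ennreal (r z) * F (x - z) (y - z) \<partial>lborel \<partial>lborel)
      = ennreal (r z) * (\<integral>\<^sup>+ x. \<integral>\<^sup>+ y. F (x - z) (y - z) \<partial>lborel \<partial>lborel)"
      by (simp add: nn_integral_cmult)
    also have "(\<integral>\<^sup>+ x. \<integral>\<^sup>+ y. F (x - z) (y - z) \<partial>lborel \<partial>lborel) = (\<integral>\<^sup>+ x. \<integral>\<^sup>+ y. F (x - z) y \<partial>lborel \<partial>lborel)"
      by (intro nn_integral_cong nn_integral_lborel_shift) measurable
    also have "\<dots> = (\<integral>\<^sup>+ x. \<integral>\<^sup>+ y. F x y \<partial>lborel \<partial>lborel)"
      by (rule nn_integral_lborel_shift) measurable
    also have "\<dots> = energy s D' v"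
      by (simp add: energy_borel n_def F_def)
    finally show "(\<integral>\<^sup>+ x. \<integral>\<^sup>+ y. ennreal (r z) * F (x - z) (y - z) \<partial>lborel \<partial>lborel) = ennreal (r z) * energy s D' v" .
  qed
  also have "\<dots> = energy s D' v"
    by (simp add: nn_integral_multc nn_r)
  finally show ?thesis .
qed

text \<open>Collects what makes a nonsmooth \<open>v\<close> admissible: smooth nonnegative
  approximations with almost everywhere convergence, supports within distance \<open>e\<close> of
  that of \<open>v\<close>, and bounds for the \<open>G\<close>-integral and the energy that do not
  depend on \<open>m\<close>.\<close>

lemma mollification:
  fixes v :: "'a::euclidean_space \<Rightarrow> real"
  assumes v: "integrable lebesgue v" and v0: "AE x in lebesgue. 0 \<le> v x"
    and R: "\<And>x. R < norm x \<Longrightarrow> v x = 0"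
    and e: "0 < e" and [measurable]: "D \<in> sets borel" "D' \<in> sets borel"
    and DD: "\<And>x z. x \<in> D \<Longrightarrow> norm z \<le> e \<Longrightarrow> x - z \<in> D'"
  shows "\<exists>V. (\<forall>m k. Ck k (V m)) \<and> (\<forall>m x. 0 \<le> V m x) \<and>
    (\<forall>m x. V m x \<noteq> 0 \<longrightarrow> (\<exists>y. v y \<noteq> 0 \<and> norm (x - y) \<le> e)) \<and>
    (AE x in lebesgue. (\<lambda>m. V m x) \<longlonglongrightarrow> v x) \<and>
    (\<forall>m. (\<integral>\<^sup>+ x. ennreal (G \<bar>V m x\<bar>) \<partial>lebesgue) \<le> (\<integral>\<^sup>+ x. ennreal (G \<bar>v x\<bar>) \<partial>lebesgue)) \<and>
    (\<forall>m. energy s D (V m) \<le> energy s D' v)"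
proof -
  have [measurable]: "v \<in> borel_measurable lebesgue" using v by auto
  obtain w' where w' [measurable]: "w' \<in> borel_measurable lborel" and vw': "AE x in lborel. v x = w' x"
    using completion_ex_borel_measurable_real[of v lborel] by auto
  \<comment> \<open>A Borel representative of \<open>v\<close>; the indicator makes its support
    bounded everywhere, and almost everywhere it changes nothing.\<close>
  define w where "w x = indicator (cball 0 R) x * w' x" for x
  have w_m [measurable]: "w \<in> borel_measurable borel"
    unfolding w_def using w' by (intro borel_measurable_times borel_measurable_indicator) auto
  have vw: "AE x in lborel. v x = w x"
    using vw' by eventually_elim (use R in \<open>force simp: w_def indicator_def\<close>)
  have vwl: "AE x in lebesgue. v x = w x" using vw by (simp add: AE_completion_iff)
  have wi: "integrable lborel w"
  proof -
    have "integrable lebesgue w"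
      using v vwl by (subst integrable_cong_AE[where g=v]) (auto intro: measurable_completion)
    then show ?thesis by (simp add: integrable_completion)
  qed
  have w0: "AE x in lborel. 0 \<le> w x"
    using v0 vwl unfolding AE_completion_iff by eventually_elim simp
  define em where "em m = min 1 e / real (Suc m)" for m
  have em: "0 < em m" "em m \<le> e" "em m \<le> 1" for m
  proof -
    have "em m \<le> min 1 e / 1" unfolding em_def using e by (intro divide_left_mono) auto
    then show "em m \<le> e" "em m \<le> 1" by auto
  qed (use e in \<open>simp add: em_def\<close>)
  have em0: "em \<longlonglongrightarrow> 0"
    unfolding em_def by (rule LIMSEQ_Suc[OF lim_const_over_n])
  have "\<exists>r :: 'a \<Rightarrow> real. mollifier r (em m)" for m
    using mollifier_exists[OF em(1)[of m], where 'a='a] unfolding mollifier_def by metis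
  then obtain r :: "nat \<Rightarrow> 'a \<Rightarrow> real" where r: "\<And>m. mollifier (r m) (em m)" by metis
  \<comment> \<open>The shrinking radii give convergence, while the uniform bounds are stated with
    the fixed radius \<open>e\<close>.\<close>
  have re: "mollifier (r m) e" for m
    using r[of m] em(2)[of m] unfolding mollifier_def by (meson le_less_trans)
  have "(\<lambda>m. \<integral>x. \<bar>conv (r m) w x - w x\<bar> \<partial>lborel) \<longlonglongrightarrow> 0"
    by (rule conv_tendsto_L1[where R=R, OF r em0 em(3) wi]) (auto simp: w_def)
  then have "(\<lambda>m. \<integral>x. norm (conv (r m) w x - w x) \<partial>lborel) \<longlonglongrightarrow> 0" by simp
  \<comment> \<open>Convergence in \<open>L^1\<close> gives almost everywhere convergence along a
    subsequence, which is all that the approximation has to provide.\<close>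
  from tendsto_L1_AE_subseq[OF _ this] obtain sub where sub: "strict_mono sub"
    and lim: "AE x in lborel. (\<lambda>m. conv (r (sub m)) w x - w x) \<longlonglongrightarrow> 0"
    using mollifier.conv_integrable[OF r wi] wi by auto
  define V where "V m = conv (r (sub m)) w" for m
  show ?thesis
  proof (intro exI[of _ V] conjI allI)
    fix m k x
    interpret mollifier "r (sub m)" e by (rule re)
    show "Ck k (V m)" unfolding V_def by (rule Ck_conv[OF wi Ck_r r_support])
    show "0 \<le> V m x" unfolding V_def conv_def
      by (intro integral_nonneg_AE, use w0 in eventually_elim) (simp add: r_nonneg)
    \<comment> \<open>The support is measured by \<open>v\<close> itself although \<open>V m\<close>
      is built from \<open>w\<close>: if \<open>v\<close> vanishes on the ball of radius
      \<open>e\<close> about \<open>x\<close>, the integrand of the convolution is zero almost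
      everywhere.\<close>
    show "V m x \<noteq> 0 \<longrightarrow> (\<exists>y. v y \<noteq> 0 \<and> norm (x - y) \<le> e)"
    proof (rule impI, rule ccontr)
      assume V: "V m x \<noteq> 0" and no: "\<not> (\<exists>y. v y \<noteq> 0 \<and> norm (x - y) \<le> e)"
      have "AE y in lborel. r (sub m) (x - y) * w y = 0"
        using vw
      proof eventually_elim
        fix y assume "v y = w y"
        then show "r (sub m) (x - y) * w y = 0"
          using no r_support[of "x - y"] by (metis mult_eq_0_iff not_le)
      qed
      then have "V m x = 0" unfolding V_def conv_def by (rule integral_eq_zero_AE)
      then show False using V by simp
    qed
    have "(\<integral>\<^sup>+ x. ennreal (G \<bar>v x\<bar>) \<partial>lebesgue) = (\<integral>\<^sup>+ x. ennreal (G \<bar>w x\<bar>) \<partial>lebesgue)"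
      by (intro nn_integral_cong_AE, use vwl in eventually_elim) simp
    then show "(\<integral>\<^sup>+ x. ennreal (G \<bar>V m x\<bar>) \<partial>lebesgue) \<le> (\<integral>\<^sup>+ x. ennreal (G \<bar>v x\<bar>) \<partial>lebesgue)"
      using nn_integral_G_conv_le[OF re wi] by (simp add: V_def nn_integral_completion)
    show "energy s D (V m) \<le> energy s D' v"
      using energy_conv_le[OF re wi _ _ DD] energy_cong_AE[OF vwl] by (simp add: V_def)
  next
    show "AE x in lebesgue. (\<lambda>m. V m x) \<longlonglongrightarrow> v x"
      unfolding AE_completion_iff using lim vw
    proof eventually_elim
      fix x assume "(\<lambda>m. conv (r (sub m)) w x - w x) \<longlonglongrightarrow> 0" "v x = w x"
      then show "(\<lambda>m. V m x) \<longlonglongrightarrow> v x"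
        unfolding V_def by (simp add: LIM_zero_iff)
    qed
  qed
qed

end

subsection \<open>The nonlocal form\<close>

text \<open>The level for a given error is \<open>C * H\<close>, with \<open>C\<close> belonging to
  a small \<open>d\<close>; the excess over it is at most \<open>d * p m\<close>, whose integral is
  at most \<open>d * A\<close>. The functions \<open>p m\<close> need not converge.\<close>

lemma relatively_uniformly_integrable_limit:
  fixes f :: "nat \<Rightarrow> 'a \<Rightarrow> real" and f' :: "'a \<Rightarrow> real"
  assumes f [measurable]: "\<And>m. f m \<in> borel_measurable M" "f' \<in> borel_measurable M"
    and lim: "AE x in M. (\<lambda>m. f m x) \<longlonglongrightarrow> f' x"
    and p [measurable]: "\<And>m. p m \<in> borel_measurable M"
    and p_le: "\<And>m. (\<integral>\<^sup>+ x. ennreal (p m x) \<partial>M) \<le> A" "A < \<infinity>"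
    and H: "integrable M H" "\<And>x. 0 \<le> H x"
    and bound: "\<And>d. 0 < d \<Longrightarrow> \<exists>C>0. \<forall>m. AE x in M. \<bar>f m x\<bar> \<le> d * p m x + C * H x"
  shows "integrable M f'" and "(\<lambda>m. integral\<^sup>L M (f m)) \<longlonglongrightarrow> integral\<^sup>L M f'"
proof -
  have "\<exists>H. integrable M H \<and> (\<forall>x. 0 \<le> H x) \<and> (\<forall>m. (\<integral>\<^sup>+ x. ennreal (\<bar>f m x\<bar> - H x) \<partial>M) \<le> ennreal e)"
    if e: "0 < e" for e
  proof -
    obtain a where a: "A = ennreal a" "0 \<le> a"
      using p_le(2) by (cases A) auto
    \<comment> \<open>The summand 1 avoids a division by zero when the bound \<open>a\<close>
      vanishes.\<close>
    define d where "d = e / (a + 1)"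
    have d: "0 < d" using e a by (simp add: d_def)
    from bound[OF d] obtain C where C: "0 < C" "\<And>m. AE x in M. \<bar>f m x\<bar> \<le> d * p m x + C * H x" by auto
    have "(\<integral>\<^sup>+ x. ennreal (\<bar>f m x\<bar> - C * H x) \<partial>M) \<le> ennreal e" for m
    proof -
      have "(\<integral>\<^sup>+ x. ennreal (\<bar>f m x\<bar> - C * H x) \<partial>M) \<le> (\<integral>\<^sup>+ x. ennreal d * ennreal (p m x) \<partial>M)"
        using C(2)[of m] d by (intro nn_integral_mono_AE) (auto elim!: eventually_mono intro!: ennreal_leI simp: ennreal_mult'[symmetric])
      also have "\<dots> = ennreal d * (\<integral>\<^sup>+ x. ennreal (p m x) \<partial>M)" by (rule nn_integral_cmult) measurable
      also have "\<dots> \<le> ennreal d * ennreal a" using p_le(1)[of m] a by (intro mult_left_mono) auto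
      also have "\<dots> = ennreal (d * a)" using d a by (simp add: ennreal_mult)
      also have "\<dots> \<le> ennreal e"
        using e a by (intro ennreal_leI) (simp add: d_def field_simps)
      finally show ?thesis .
    qed
    then show ?thesis using H C(1) by (intro exI[of _ "\<lambda>x. C * H x"]) auto
  qed
  note ui = this
  show "integrable M f'" by (rule uniformly_integrable_limit(1)[OF f lim ui])
  show "(\<lambda>m. integral\<^sup>L M (f m)) \<longlonglongrightarrow> integral\<^sup>L M f'" by (rule uniformly_integrable_limit(2)[OF f lim ui])
qed

text \<open>\<open>S\<close> carries the test functions, \<open>D\<close> is the region where
  energies are finite, and \<open>h\<close> dominates the first argument of the form everywhere. By
  \<open>sep\<close> the distance from a point of \<open>S\<close> to a point \<open>y\<close>
  outside \<open>D\<close> is at least a multiple of \<open>1 + |y|\<close>, so \<open>y\<close> can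
  be both close to \<open>D\<close> and far away. The normalisation \<open>1 \<le> h\<close> gives
  \<open>1 \<le> g (h x)\<close>, which lets sums be bounded by products.\<close>

locale form_setting = growth G g p q for G g :: "real \<Rightarrow> real" and p q :: real +
  fixes s L c :: real and k :: "'a::euclidean_space \<Rightarrow> 'a \<Rightarrow> real" and S D :: "'a set" and h :: "'a \<Rightarrow> real"
  assumes s_pos: "0 < s" and kernel: "kernel_ok L k"
    and SD: "S \<subseteq> D" and S_meas [measurable]: "S \<in> sets lebesgue" and D_meas [measurable]: "D \<in> sets lebesgue"
    and c: "0 < c" "c \<le> 1"
    and sep: "\<And>x y. x \<in> S \<Longrightarrow> y \<notin> D \<Longrightarrow> c * (1 + norm y) \<le> norm (x - y)"
    and h_ge: "\<And>x. 1 \<le> h x" and h_meas [measurable]: "h \<in> borel_measurable lebesgue"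
    and h_G: "(\<integral>\<^sup>+ x. indicator D x * ennreal (G \<bar>h x\<bar>) \<partial>lebesgue) < \<infinity>"
    and h_tail: "(\<integral>\<^sup>+ x. indicator (- D) x * ennreal ((1 + g \<bar>h x / (1 + norm x) powr s\<bar>)
        * (1 + norm x) powr (- real DIM('a) - s)) \<partial>lebesgue) < \<infinity>"
begin

definition form :: "('a \<Rightarrow> real) \<Rightarrow> ('a \<Rightarrow> real) \<Rightarrow> 'a \<times> 'a \<Rightarrow> real" where
  "form U V z = g \<bar>Ds s U (fst z) (snd z)\<bar> * sgn (Ds s U (fst z) (snd z)) *
     Ds s V (fst z) (snd z) * k (fst z) (snd z) / norm (fst z - snd z) ^ DIM('a)"

text \<open>What a point \<open>y\<close> outside \<open>D\<close> contributes once its partner in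
  \<open>S\<close> has been factored out; the summand 1 belongs to the partner's own value, the
  other one to the size of \<open>h\<close> at \<open>y\<close>.\<close>

definition weight :: "'a \<Rightarrow> real" where
  "weight y = indicator (- D) y * ((1 + g \<bar>h y / (1 + norm y) powr s\<bar>) * (1 + norm y) powr (- real DIM('a) - s))"

text \<open>The pairs with one point in \<open>S\<close> and the other outside \<open>D\<close>, in
  both orders: \<open>weight\<close> vanishes on \<open>D\<close>. Each summand is a product in the
  two variables, so its integral factors.\<close>

definition cross :: "('a \<Rightarrow> real) \<Rightarrow> 'a \<times> 'a \<Rightarrow> real" where
  "cross f z = indicator S (fst z) * f (fst z) * weight (snd z) + indicator S (snd z) * f (snd z) * weight (fst z)"

definition loc :: "('a \<Rightarrow> real) \<Rightarrow> 'a \<times> 'a \<Rightarrow> real" where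
  "loc U z = indicator (D \<times> D) z * (G \<bar>Ds s U (fst z) (snd z)\<bar> / norm (fst z - snd z) ^ DIM('a))"

lemma h_nonneg: "0 \<le> h x" using h_ge[of x] by simp

lemma weight_nonneg: "0 \<le> weight y"
  using g_nonneg[of "\<bar>h y / (1 + norm y) powr s\<bar>"] by (auto simp: weight_def)

lemma loc_nonneg: "0 \<le> loc U z"
  using G_nonneg by (auto simp: loc_def)

lemma cross_nonneg: "(\<And>x. 0 \<le> f x) \<Longrightarrow> 0 \<le> cross f z"
  using weight_nonneg by (auto simp: cross_def)

lemma weight_meas [measurable]: "weight \<in> borel_measurable lebesgue"
proof -
  have [measurable]: "(\<lambda>y::'a. norm y) \<in> borel_measurable lebesgue"
    by (intro measurable_completion) simp
  have D': "- D \<in> sets lebesgue"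
    using sets.compl_sets[OF D_meas] by (simp add: Compl_eq_Diff_UNIV)
  have n: "(\<lambda>y::'a. 1 + norm y) \<in> borel_measurable lebesgue" by measurable
  have "(\<lambda>y. h y / (1 + norm y) powr s) \<in> borel_measurable lebesgue"
    by (intro borel_measurable_divide h_meas powr_real_measurable n borel_measurable_const)
  then show ?thesis unfolding weight_def
    by (intro borel_measurable_times borel_measurable_indicator borel_measurable_add[of "\<lambda>_. 1"] measurable_g_abs
      powr_real_measurable n borel_measurable_const D')
qed

lemma nn_integral_weight: "(\<integral>\<^sup>+ y. ennreal (weight y) \<partial>lebesgue) < \<infinity>"
proof -
  have "(\<integral>\<^sup>+ y. ennreal (weight y) \<partial>lebesgue) = (\<integral>\<^sup>+ x. indicator (- D) x * ennreal ((1 + g \<bar>h x / (1 + norm x) powr s\<bar>)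
        * (1 + norm x) powr (- real DIM('a) - s)) \<partial>lebesgue)"
    by (intro nn_integral_cong) (auto simp: weight_def indicator_def)
  then show ?thesis using h_tail by simp
qed

lemma norm_pow_meas: "(\<lambda>z::'a \<times> 'a. norm (fst z - snd z) ^ n) \<in> borel_measurable leb2"
  using norm_leb2 by (rule borel_measurable_power)

lemma D2_meas [measurable]: "D \<times> D \<in> sets leb2"
  by (intro pair_measureI) measurable

lemma loc_meas [measurable]: "U \<in> borel_measurable lebesgue \<Longrightarrow> loc U \<in> borel_measurable leb2"
  unfolding loc_def
  by (intro borel_measurable_times borel_measurable_indicator D2_meas borel_measurable_divide measurable_G_abs
    Ds_measurable norm_pow_meas)

lemma cross_meas [measurable]: "f \<in> borel_measurable lebesgue \<Longrightarrow> cross f \<in> borel_measurable leb2"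
proof -
  assume [measurable]: "f \<in> borel_measurable lebesgue"
  have "(\<lambda>x. indicator S x * f x) \<in> borel_measurable lebesgue" by measurable
  from comp_leb2[OF this] comp_leb2[OF weight_meas] show ?thesis
    unfolding cross_def by (intro borel_measurable_add borel_measurable_times[of "\<lambda>z. _ z * _ z"])
qed

lemma form_meas [measurable]:
  assumes "U \<in> borel_measurable lebesgue" "V \<in> borel_measurable lebesgue"
  shows "form U V \<in> borel_measurable leb2"
proof -
  have "form U V = (\<lambda>z. sg (Ds s U (fst z) (snd z)) * Ds s V (fst z) (snd z) * k (fst z) (snd z) / norm (fst z - snd z) ^ DIM('a))"
    by (auto simp: form_def sg_def)
  moreover have "(\<lambda>z. k (fst z) (snd z)) \<in> borel_measurable leb2" using kernel by (simp add: kernel_ok_def)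
  ultimately show ?thesis
    using assms by (auto intro!: borel_measurable_times borel_measurable_divide norm_pow_meas Ds_measurable
      measurable_compose[OF Ds_measurable borel_measurable_sg])
qed

lemma nn_integral_loc: "(\<integral>\<^sup>+ z. ennreal (loc U z) \<partial>leb2) = energy s D U"
  unfolding energy_def loc_def by (intro nn_integral_cong) (auto simp: indicator_def)

lemma nn_integral_cross:
  assumes [measurable]: "f \<in> borel_measurable lebesgue" and f: "\<And>x. 0 \<le> f x"
  shows "(\<integral>\<^sup>+ z. ennreal (cross f z) \<partial>leb2)
    = 2 * ((\<integral>\<^sup>+ x. indicator S x * ennreal (f x) \<partial>lebesgue) * (\<integral>\<^sup>+ y. ennreal (weight y) \<partial>lebesgue))"
proof -
  let ?a = "\<lambda>x. indicator S x * ennreal (f x)" and ?w = "\<lambda>y. ennreal (weight y)"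
  have a: "?a \<in> borel_measurable lebesgue" by measurable
  have w: "?w \<in> borel_measurable lebesgue" by measurable
  have "(\<integral>\<^sup>+ z. ennreal (cross f z) \<partial>leb2) = (\<integral>\<^sup>+ z. ?a (fst z) * ?w (snd z) + ?a (snd z) * ?w (fst z) \<partial>leb2)"
    using f weight_nonneg by (intro nn_integral_cong) (auto simp: cross_def indicator_def ennreal_mult)
  also have "\<dots> = (\<integral>\<^sup>+ x. \<integral>\<^sup>+ y. ?a x * ?w y + ?a y * ?w x \<partial>lebesgue \<partial>lebesgue)"
    by (subst lebesgue.nn_integral_fst[symmetric])
      (auto intro!: borel_measurable_add borel_measurable_times_ennreal comp_leb2[THEN measurable_compose] a w
         measurable_compose[OF measurable_fst] measurable_compose[OF measurable_snd])
  also have "\<dots> = (\<integral>\<^sup>+ x. ?a x * integral\<^sup>N lebesgue ?w + integral\<^sup>N lebesgue ?a * ?w x \<partial>lebesgue)"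
    using a w by (intro nn_integral_cong) (simp add: nn_integral_add nn_integral_cmult nn_integral_multc)
  also have "\<dots> = 2 * (integral\<^sup>N lebesgue ?a * integral\<^sup>N lebesgue ?w)"
    using a w by (simp add: nn_integral_add nn_integral_cmult nn_integral_multc mult_2)
  finally show ?thesis .
qed

lemma AE_kernel: "AE z in leb2. 1 / L \<le> k (fst z) (snd z) \<and> k (fst z) (snd z) \<le> L"
  using kernel by (auto simp: kernel_ok_def)

lemma L_ge_1: "1 \<le> L" using kernel by (simp add: kernel_ok_def)

text \<open>The first bracket comes from pulling \<open>1 / c powr s\<close> out of \<open>g\<close>
  and from splitting a sum inside \<open>g\<close>, the last factor from replacing
  \<open>|x - y|\<close> by \<open>c * (1 + |y|)\<close> in the kernel.\<close>

definition cross_factor :: real where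
  "cross_factor = ((1 / c powr s) powr (q - 1) * 2 powr (q - 1)) * c powr (- real DIM('a) - s)"

lemma cross_factor_nonneg: "0 \<le> cross_factor" by (simp add: cross_factor_def)

text \<open>The distance is at least \<open>c * (1 + |y|)\<close>, so the difference quotient of
  \<open>U\<close> is at most a multiple of \<open>h x + h y / (1 + |y|) powr s\<close>, the second
  part being the quantity in the tail condition. As \<open>V y = 0\<close>, the other quotient
  involves only \<open>V x\<close>.\<close>

lemma cross_bound:
  assumes x: "x \<in> S" and y: "y \<notin> D" and U: "\<bar>U x\<bar> \<le> h x" "\<bar>U y\<bar> \<le> h y" and V: "V y = 0"
  shows "g \<bar>Ds s U x y\<bar> * \<bar>Ds s V x y\<bar> / norm (x - y) ^ DIM('a) \<le> cross_factor * (g (h x) * \<bar>V x\<bar> * weight y)"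
proof -
  define r where "r = norm (x - y)"
  define t where "t = 1 + norm y"
  define n where "n = DIM('a)"
  have t: "1 \<le> t" "0 < t" unfolding t_def using norm_ge_zero[of y] by linarith+
  have ct: "c * t \<le> r" "0 < c * t" using sep[OF x y] c t by (simp_all add: r_def t_def)
  then have r: "0 < r" by linarith
  have tau: "0 \<le> h y / t powr s" using h_ge[of y] t by simp
  have rs: "c powr s * t powr s \<le> r powr s"
    using ct s_pos c t by (subst powr_mult[symmetric]) (auto intro: powr_mono2)
  have "\<bar>Ds s U x y\<bar> = \<bar>U x - U y\<bar> / r powr s" by (simp add: Ds_def r_def)
  also have "\<dots> \<le> (h x + h y) / (c powr s * t powr s)"
    using U h_ge[of x] h_ge[of y] rs c t by (intro frac_le) auto
  also have "\<dots> = 1 / c powr s * (h x / t powr s + h y / t powr s)"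
    by (simp add: add_divide_distrib mult.commute)
  also have "\<dots> \<le> 1 / c powr s * (h x + h y / t powr s)"
  proof -
    have "h x / t powr s \<le> h x / 1"
      using h_ge[of x] t s_pos by (intro divide_left_mono) (auto intro: ge_one_powr_ge_zero)
    then show ?thesis by (intro mult_left_mono) auto
  qed
  finally have "g \<bar>Ds s U x y\<bar> \<le> g (1 / c powr s * (h x + h y / t powr s))"
    by (intro g_mono) auto
  also have "\<dots> \<le> (1 / c powr s) powr (q - 1) * g (h x + h y / t powr s)"
  proof (rule g_scale)
    have "c powr s \<le> 1" using c s_pos by (intro powr_le1) auto
    then show "1 \<le> 1 / c powr s" using c by simp
    show "0 \<le> h x + h y / t powr s" using tau h_ge[of x] by linarith
  qed
  also have "\<dots> \<le> (1 / c powr s) powr (q - 1) * (2 powr (q - 1) * (g (h x) + g (h y / t powr s)))"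
    using tau h_ge[of x] by (intro mult_left_mono g_add) auto
  \<comment> \<open>From a sum to a product: \<open>g (h x) \<ge> 1\<close> allows both terms to be
    multiplied by it, which separates the variables.\<close>
  also have "\<dots> \<le> (1 / c powr s) powr (q - 1) * (2 powr (q - 1) * (g (h x) * (1 + g (h y / t powr s))))"
  proof -
    have "1 \<le> g (h x)" using g_1 g_mono[of 1 "h x"] h_ge[of x] by linarith
    then have "g (h y / t powr s) \<le> g (h x) * g (h y / t powr s)"
      using g_nonneg[OF tau] by (simp add: mult_le_cancel_right1)
    then show ?thesis by (intro mult_left_mono) (auto simp: distrib_left)
  qed
  finally have gU: "g \<bar>Ds s U x y\<bar> \<le> ((1 / c powr s) powr (q - 1) * 2 powr (q - 1)) * (g (h x) * (1 + g (h y / t powr s)))"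
    by (simp add: ac_simps)
  have "1 / r powr s / r ^ n = r powr (- real n - s)"
    using r by (simp add: powr_diff powr_minus powr_realpow divide_simps)
  also have "\<dots> \<le> (c * t) powr (- real n - s)"
    using ct s_pos by (intro powr_mono2') auto
  also have "\<dots> = c powr (- real n - s) * t powr (- real n - s)"
    using c t by (simp add: powr_mult)
  finally have rn: "1 / r powr s / r ^ n \<le> c powr (- real n - s) * t powr (- real n - s)" .
  have "g \<bar>Ds s U x y\<bar> * \<bar>Ds s V x y\<bar> / norm (x - y) ^ DIM('a) = g \<bar>Ds s U x y\<bar> * (\<bar>V x\<bar> * (1 / r powr s / r ^ n))"
    by (simp add: Ds_def V r_def n_def abs_mult)
  also have "\<dots> \<le> (((1 / c powr s) powr (q - 1) * 2 powr (q - 1)) * (g (h x) * (1 + g (h y / t powr s)))) *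
      (\<bar>V x\<bar> * (c powr (- real n - s) * t powr (- real n - s)))"
    using g_nonneg[OF tau] g_nonneg[of "h x"] h_ge[of x] g_nonneg[of "\<bar>Ds s U x y\<bar>"] r
    by (intro mult_mono gU mult_left_mono rn) auto
  also have "\<dots> = cross_factor * (g (h x) * \<bar>V x\<bar> * weight y)"
    using y h_nonneg[of y] by (simp add: cross_factor_def weight_def t_def n_def)
  finally show ?thesis .
qed

text \<open>A pair not contained in \<open>D \<times> D\<close> either has one point in
  \<open>S\<close> and the other outside \<open>D\<close>, where \<open>cross_bound\<close> applies
  in one of the two orders, or has no point in \<open>S\<close>, where \<open>V\<close> vanishes at
  both points.\<close>

lemma form_pointwise:
  assumes k: "1 / L \<le> k x y" "k x y \<le> L"
    and U: "\<bar>U x\<bar> \<le> h x" "\<bar>U y\<bar> \<le> h y" and V: "\<And>x. x \<notin> S \<Longrightarrow> V x = 0"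
  shows "\<bar>form U V (x, y)\<bar> \<le> L * (indicator (D \<times> D) (x, y) * (g \<bar>Ds s U x y\<bar> * \<bar>Ds s V x y\<bar> / norm (x - y) ^ DIM('a))
      + cross_factor * cross (\<lambda>x. g (h x) * \<bar>V x\<bar>) (x, y))"
proof -
  let ?f = "g \<bar>Ds s U x y\<bar> * \<bar>Ds s V x y\<bar> / norm (x - y) ^ DIM('a)"
  have cr: "0 \<le> cross (\<lambda>x. g (h x) * \<bar>V x\<bar>) z" for z
    by (intro cross_nonneg mult_nonneg_nonneg g_nonneg h_nonneg abs_ge_zero)
  have f: "?f \<le> indicator (D \<times> D) (x, y) * ?f + cross_factor * cross (\<lambda>x. g (h x) * \<bar>V x\<bar>) (x, y)"
  proof (cases "x \<in> D \<and> y \<in> D")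
    case True
    then show ?thesis using cr cross_factor_nonneg by simp
  next
    case False
    consider "x \<in> S" "y \<notin> D" | "y \<in> S" "x \<notin> D" | "x \<notin> S" "y \<notin> S" using False SD by blast
    then show ?thesis
    proof cases
      case 1
      then have "?f \<le> cross_factor * (g (h x) * \<bar>V x\<bar> * weight y)"
        using SD by (intro cross_bound U V) auto
      moreover have "weight x = 0" using 1 SD by (auto simp: weight_def)
      ultimately show ?thesis using 1 by (simp add: cross_def)
    next
      case 2
      have "Ds s W x y = - Ds s W y x" for W
        by (simp add: Ds_def norm_minus_commute minus_divide_left)
      then have "?f = g \<bar>Ds s U y x\<bar> * \<bar>Ds s V y x\<bar> / norm (y - x) ^ DIM('a)"
        by (simp add: norm_minus_commute)
      also have "\<dots> \<le> cross_factor * (g (h y) * \<bar>V y\<bar> * weight x)"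
        using SD 2 by (intro cross_bound U V) auto
      finally have "?f \<le> cross_factor * (g (h y) * \<bar>V y\<bar> * weight x)" .
      moreover have "weight y = 0" using 2 SD by (auto simp: weight_def)
      ultimately show ?thesis using 2 by (simp add: cross_def)
    next
      case 3
      then have "Ds s V x y = 0" using V by (simp add: Ds_def)
      then show ?thesis using cr cross_factor_nonneg by simp
    qed
  qed
  have "0 \<le> k x y" using k(1) L_ge_1 by (rule_tac order_trans[of 0 "1 / L"]) auto
  then have "\<bar>k x y\<bar> \<le> L" using k(2) by simp
  have "\<bar>form U V (x, y)\<bar> = ?f * \<bar>k x y\<bar> * \<bar>sgn (Ds s U x y)\<bar>"
    using g_nonneg[of "\<bar>Ds s U x y\<bar>"] by (simp add: form_def abs_mult)
  also have "\<dots> \<le> ?f * L * 1"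
    using \<open>\<bar>k x y\<bar> \<le> L\<close> g_nonneg[of "\<bar>Ds s U x y\<bar>"] L_ge_1
    by (intro mult_mono mult_nonneg_nonneg) (auto simp: sgn_if)
  also have "\<dots> = L * ?f" by simp
  also have "\<dots> \<le> L * (indicator (D \<times> D) (x, y) * ?f + cross_factor * cross (\<lambda>x. g (h x) * \<bar>V x\<bar>) (x, y))"
    using L_ge_1 f by (intro mult_left_mono) auto
  finally show ?thesis .
qed

text \<open>\<open>P U\<close> and \<open>Q V\<close> are the two sides of Young's inequality for
  the form. The cross part of \<open>P U\<close> uses \<open>h\<close> instead of \<open>U\<close>,
  so it is the same for every function dominated by \<open>h\<close>.\<close>

definition P :: "('a \<Rightarrow> real) \<Rightarrow> 'a \<times> 'a \<Rightarrow> real" where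
  "P U z = loc U z + cross (\<lambda>x. G (h x)) z"

definition Q :: "('a \<Rightarrow> real) \<Rightarrow> 'a \<times> 'a \<Rightarrow> real" where
  "Q V z = loc V z + cross (\<lambda>x. G \<bar>V x\<bar>) z"

lemma G_h_nonneg: "0 \<le> G (h x)" using h_nonneg by (rule G_nonneg)

lemma G_h_meas [measurable]: "(\<lambda>x. G (h x)) \<in> borel_measurable lebesgue"
  using measurable_G_abs[OF h_meas] by (simp add: h_nonneg)

lemma P_nonneg: "0 \<le> P U z"
  unfolding P_def by (intro add_nonneg_nonneg loc_nonneg cross_nonneg G_h_nonneg)

lemma Q_nonneg: "0 \<le> Q V z"
  unfolding Q_def by (intro add_nonneg_nonneg loc_nonneg cross_nonneg G_nonneg) auto

lemma P_meas [measurable]: "U \<in> borel_measurable lebesgue \<Longrightarrow> P U \<in> borel_measurable leb2"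
  unfolding P_def by (intro borel_measurable_add loc_meas cross_meas G_h_meas)

lemma Q_meas [measurable]: "V \<in> borel_measurable lebesgue \<Longrightarrow> Q V \<in> borel_measurable leb2"
  unfolding Q_def by (intro borel_measurable_add loc_meas cross_meas measurable_G_abs)

lemma nn_integral_P:
  assumes [measurable]: "U \<in> borel_measurable lebesgue"
  shows "(\<integral>\<^sup>+ z. ennreal (P U z) \<partial>leb2) = energy s D U +
    2 * ((\<integral>\<^sup>+ x. indicator S x * ennreal (G (h x)) \<partial>lebesgue) * (\<integral>\<^sup>+ y. ennreal (weight y) \<partial>lebesgue))"
proof -
  have "(\<integral>\<^sup>+ z. ennreal (P U z) \<partial>leb2) = (\<integral>\<^sup>+ z. ennreal (loc U z) + ennreal (cross (\<lambda>x. G (h x)) z) \<partial>leb2)"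
    unfolding P_def by (intro nn_integral_cong ennreal_plus loc_nonneg cross_nonneg G_h_nonneg)
  also have "\<dots> = (\<integral>\<^sup>+ z. ennreal (loc U z) \<partial>leb2) + (\<integral>\<^sup>+ z. ennreal (cross (\<lambda>x. G (h x)) z) \<partial>leb2)"
    by (rule nn_integral_add) measurable
  finally show ?thesis by (simp add: nn_integral_loc nn_integral_cross G_h_nonneg)
qed

lemma nn_integral_Q:
  assumes [measurable]: "V \<in> borel_measurable lebesgue"
  shows "(\<integral>\<^sup>+ z. ennreal (Q V z) \<partial>leb2) = energy s D V +
    2 * ((\<integral>\<^sup>+ x. indicator S x * ennreal (G \<bar>V x\<bar>) \<partial>lebesgue) * (\<integral>\<^sup>+ y. ennreal (weight y) \<partial>lebesgue))"
proof -
  have "(\<integral>\<^sup>+ z. ennreal (Q V z) \<partial>leb2) = (\<integral>\<^sup>+ z. ennreal (loc V z) + ennreal (cross (\<lambda>x. G \<bar>V x\<bar>) z) \<partial>leb2)"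
    unfolding Q_def by (intro nn_integral_cong ennreal_plus loc_nonneg cross_nonneg G_nonneg) auto
  also have "\<dots> = (\<integral>\<^sup>+ z. ennreal (loc V z) \<partial>leb2) + (\<integral>\<^sup>+ z. ennreal (cross (\<lambda>x. G \<bar>V x\<bar>) z) \<partial>leb2)"
    by (rule nn_integral_add) measurable
  finally show ?thesis by (simp add: nn_integral_loc nn_integral_cross G_nonneg)
qed

lemma S_G_h: "(\<integral>\<^sup>+ x. indicator S x * ennreal (G (h x)) \<partial>lebesgue) < \<infinity>"
proof -
  have "(\<integral>\<^sup>+ x. indicator S x * ennreal (G (h x)) \<partial>lebesgue) \<le> (\<integral>\<^sup>+ x. indicator D x * ennreal (G \<bar>h x\<bar>) \<partial>lebesgue)"
    using SD h_nonneg by (intro nn_integral_mono) (auto simp: indicator_def)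
  then show ?thesis using h_G by (rule le_less_trans)
qed

text \<open>Stated for arbitrary coefficients \<open>a\<close> and \<open>b\<close>, so that both
  versions of Young's inequality can be inserted, with the small coefficient on either side.\<close>

lemma form_young:
  assumes ab: "0 \<le> a" "0 \<le> b" and y: "\<And>x y. 0 \<le> x \<Longrightarrow> 0 \<le> y \<Longrightarrow> g x * y \<le> a * G x + b * G y"
    and U: "AE x in lebesgue. \<bar>U x\<bar> \<le> h x" and V: "\<And>x. x \<notin> S \<Longrightarrow> V x = 0"
  shows "AE z in leb2. \<bar>form U V z\<bar> \<le> L * (1 + cross_factor) * (a * P U z + b * Q V z)"
  using AE_leb2_fst[OF U] AE_leb2_snd[OF U] AE_kernel
proof eventually_elim
  fix z :: "'a \<times> 'a"
  assume z: "\<bar>U (fst z)\<bar> \<le> h (fst z)" "\<bar>U (snd z)\<bar> \<le> h (snd z)" "1 / L \<le> k (fst z) (snd z) \<and> k (fst z) (snd z) \<le> L"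
  obtain x y where xy: "z = (x, y)" by force
  let ?cr = "cross (\<lambda>x. g (h x) * \<bar>V x\<bar>) z"
  let ?I = "indicator (D \<times> D) z :: real"
  let ?n = "norm (x - y) ^ DIM('a)"
  have 1: "\<bar>form U V z\<bar> \<le> L * (?I * (g \<bar>Ds s U x y\<bar> * \<bar>Ds s V x y\<bar> / ?n) + cross_factor * ?cr)"
    using form_pointwise[of x y U V] z V by (simp add: xy)
  have "?I * (g \<bar>Ds s U x y\<bar> * \<bar>Ds s V x y\<bar> / ?n) \<le> ?I * ((a * G \<bar>Ds s U x y\<bar> + b * G \<bar>Ds s V x y\<bar>) / ?n)"
    by (intro mult_left_mono divide_right_mono assms(3)) auto
  also have "\<dots> = a * loc U z + b * loc V z"
    by (simp add: loc_def xy add_divide_distrib distrib_left ac_simps)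
  finally have 2: "?I * (g \<bar>Ds s U x y\<bar> * \<bar>Ds s V x y\<bar> / ?n) \<le> a * loc U z + b * loc V z" .
  have i: "indicator S x * (g (h x) * \<bar>V x\<bar>) * weight y \<le> indicator S x * (a * G (h x) + b * G \<bar>V x\<bar>) * weight y" for x y
    by (intro mult_right_mono mult_left_mono assms(3) weight_nonneg h_nonneg) auto
  have 3: "?cr \<le> a * cross (\<lambda>x. G (h x)) z + b * cross (\<lambda>x. G \<bar>V x\<bar>) z"
    using i[of x y] i[of y x] by (simp add: cross_def xy algebra_simps)
  have "?I * (g \<bar>Ds s U x y\<bar> * \<bar>Ds s V x y\<bar> / ?n) + cross_factor * ?cr
    \<le> (a * loc U z + b * loc V z) + cross_factor * (a * cross (\<lambda>x. G (h x)) z + b * cross (\<lambda>x. G \<bar>V x\<bar>) z)"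
    by (intro add_mono mult_left_mono 2 3 cross_factor_nonneg)
  also have "\<dots> \<le> (1 + cross_factor) * (a * loc U z + b * loc V z) + (1 + cross_factor) * (a * cross (\<lambda>x. G (h x)) z + b * cross (\<lambda>x. G \<bar>V x\<bar>) z)"
  proof (intro add_mono)
    show "a * loc U z + b * loc V z \<le> (1 + cross_factor) * (a * loc U z + b * loc V z)"
      using cross_factor_nonneg ab loc_nonneg[of U z] loc_nonneg[of V z] mult_nonneg_nonneg[OF cross_factor_nonneg, of "a * loc U z + b * loc V z"]
      by (simp add: distrib_right)
    have "0 \<le> a * cross (\<lambda>x. G (h x)) z + b * cross (\<lambda>x. G \<bar>V x\<bar>) z"
      using ab by (intro add_nonneg_nonneg mult_nonneg_nonneg cross_nonneg G_h_nonneg G_nonneg) auto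
    then show "cross_factor * (a * cross (\<lambda>x. G (h x)) z + b * cross (\<lambda>x. G \<bar>V x\<bar>) z)
        \<le> (1 + cross_factor) * (a * cross (\<lambda>x. G (h x)) z + b * cross (\<lambda>x. G \<bar>V x\<bar>) z)"
      by (intro mult_right_mono) auto
  qed
  also have "\<dots> = (1 + cross_factor) * (a * P U z + b * Q V z)" by (simp add: P_def Q_def algebra_simps)
  finally have "L * (?I * (g \<bar>Ds s U x y\<bar> * \<bar>Ds s V x y\<bar> / ?n) + cross_factor * ?cr) \<le> L * ((1 + cross_factor) * (a * P U z + b * Q V z))"
    using L_ge_1 by (intro mult_left_mono) auto
  with 1 show "\<bar>form U V z\<bar> \<le> L * (1 + cross_factor) * (a * P U z + b * Q V z)" by simp
qed

lemma form_tendsto_AE: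
  assumes "AE x in lebesgue. (\<lambda>m. U m x) \<longlonglongrightarrow> U' x" "AE x in lebesgue. (\<lambda>m. V m x) \<longlonglongrightarrow> V' x"
  shows "AE z in leb2. (\<lambda>m. form (U m) (V m) z) \<longlonglongrightarrow> form U' V' z"
  using AE_leb2_fst[OF assms(1)] AE_leb2_snd[OF assms(1)] AE_leb2_fst[OF assms(2)] AE_leb2_snd[OF assms(2)]
proof eventually_elim
  fix z :: "'a \<times> 'a"
  let ?x = "fst z" and ?y = "snd z"
  assume l: "(\<lambda>m. U m ?x) \<longlonglongrightarrow> U' ?x" "(\<lambda>m. U m ?y) \<longlonglongrightarrow> U' ?y"
    "(\<lambda>m. V m ?x) \<longlonglongrightarrow> V' ?x" "(\<lambda>m. V m ?y) \<longlonglongrightarrow> V' ?y"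
  \<comment> \<open>Written with \<open>inverse\<close>, division is multiplication by a constant,
    so the diagonal, where the denominator is zero, needs no separate case.\<close>
  have D: "(\<lambda>m. Ds s (W m) ?x ?y) \<longlonglongrightarrow> Ds s W' ?x ?y"
    if "(\<lambda>m. W m ?x) \<longlonglongrightarrow> W' ?x" "(\<lambda>m. W m ?y) \<longlonglongrightarrow> W' ?y" for W W'
    unfolding Ds_def divide_inverse by (intro tendsto_intros that)
  have "(\<lambda>m. sg (Ds s (U m) ?x ?y)) \<longlonglongrightarrow> sg (Ds s U' ?x ?y)"
    using continuous_sg by (intro isCont_tendsto_compose[OF _ D[OF l(1,2)]]) (simp add: continuous_on_eq_continuous_at)
  then have "(\<lambda>m. sg (Ds s (U m) ?x ?y) * Ds s (V m) ?x ?y * k ?x ?y * inverse (norm (?x - ?y) ^ DIM('a)))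
    \<longlonglongrightarrow> sg (Ds s U' ?x ?y) * Ds s V' ?x ?y * k ?x ?y * inverse (norm (?x - ?y) ^ DIM('a))"
    by (intro tendsto_intros D l)
  then show "(\<lambda>m. form (U m) (V m) z) \<longlonglongrightarrow> form U' V' z"
    by (simp add: form_def sg_def divide_inverse)
qed

lemma form_tendsto:
  assumes [measurable]: "\<And>m. U m \<in> borel_measurable lebesgue" "\<And>m. V m \<in> borel_measurable lebesgue"
      "U' \<in> borel_measurable lebesgue" "V' \<in> borel_measurable lebesgue"
    and lim: "AE x in lebesgue. (\<lambda>m. U m x) \<longlonglongrightarrow> U' x" "AE x in lebesgue. (\<lambda>m. V m x) \<longlonglongrightarrow> V' x"
    and h: "\<And>m. AE x in lebesgue. \<bar>U m x\<bar> \<le> h x"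
    and V: "\<And>m x. x \<notin> S \<Longrightarrow> V m x = 0"
    and B: "B < \<infinity>" "\<And>m. energy s D (U m) \<le> B" "\<And>m. energy s D (V m) \<le> B"
      "\<And>m. (\<integral>\<^sup>+ x. indicator S x * ennreal (G \<bar>V m x\<bar>) \<partial>lebesgue) \<le> B"
    and eq: "(\<forall>m. V m = V') \<or> (\<forall>m. U m = U')"
  shows "integrable leb2 (form U' V')" "(\<lambda>m. integral\<^sup>L leb2 (form (U m) (V m))) \<longlonglongrightarrow> integral\<^sup>L leb2 (form U' V')"
proof -
  let ?W = "\<integral>\<^sup>+ y. ennreal (weight y) \<partial>lebesgue" and ?H = "\<integral>\<^sup>+ x. indicator S x * ennreal (G (h x)) \<partial>lebesgue"
  define B' where "B' = B + 2 * (max B ?H * ?W)"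
  have B': "B' < \<infinity>"
    using B(1) S_G_h nn_integral_weight by (auto simp: B'_def ennreal_mult_less_top max_def)
  have P_le: "(\<integral>\<^sup>+ z. ennreal (P (U m) z) \<partial>leb2) \<le> B'" for m
    unfolding nn_integral_P[OF assms(1)] B'_def by (intro add_mono mult_mono B) auto
  have Q_le: "(\<integral>\<^sup>+ z. ennreal (Q (V m) z) \<partial>leb2) \<le> B'" for m
    unfolding nn_integral_Q[OF assms(2)] B'_def by (intro add_mono mult_mono order_trans[OF B(4)] B(3)) auto
  have L0: "0 < L * (1 + cross_factor)" using L_ge_1 cross_factor_nonneg by simp
  have "integrable leb2 (form U' V') \<and> (\<lambda>m. integral\<^sup>L leb2 (form (U m) (V m))) \<longlonglongrightarrow> integral\<^sup>L leb2 (form U' V')"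
  proof (cases "\<forall>m. V m = V'")
    case True
    have H: "integrable leb2 (Q V')"
      using Q_le[of 0] B' True Q_nonneg by (intro integrableI_nonneg) (auto intro: le_less_trans)
    have "\<exists>C>0. \<forall>m. AE z in leb2. \<bar>form (U m) (V m) z\<bar> \<le> d * P (U m) z + C * Q V' z" if "0 < d" for d
    proof -
      obtain C where C: "0 < C" "\<And>a b. 0 \<le> a \<Longrightarrow> 0 \<le> b \<Longrightarrow> g a * b \<le> d / (L * (1 + cross_factor)) * G a + C * G b"
        using young_left[OF divide_pos_pos[OF \<open>0 < d\<close> L0]] by blast
      have "AE z in leb2. \<bar>form (U m) (V m) z\<bar> \<le> d * P (U m) z + L * (1 + cross_factor) * C * Q V' z" for m
        using form_young[OF _ _ C(2) h[of m] V[of _ m]] C(1) that L0 True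
        by (auto simp: distrib_left simp flip: mult.assoc)
      then show ?thesis using C(1) L0 by (intro exI[of _ "L * (1 + cross_factor) * C"]) auto
    qed
    from relatively_uniformly_integrable_limit[OF _ _ form_tendsto_AE[OF lim] _ P_le B' H Q_nonneg this]
    show ?thesis by simp
  next
    case False
    then have U: "U m = U'" for m using eq by auto
    have H: "integrable leb2 (P U')"
      using P_le[of 0] B' U P_nonneg by (intro integrableI_nonneg) (auto intro: le_less_trans)
    have "\<exists>C>0. \<forall>m. AE z in leb2. \<bar>form (U m) (V m) z\<bar> \<le> d * Q (V m) z + C * P U' z" if "0 < d" for d
    proof -
      obtain C where C: "0 < C" "\<And>a b. 0 \<le> a \<Longrightarrow> 0 \<le> b \<Longrightarrow> g a * b \<le> C * G a + d / (L * (1 + cross_factor)) * G b"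
        using young_right[OF divide_pos_pos[OF \<open>0 < d\<close> L0]] by blast
      have "AE z in leb2. \<bar>form (U m) (V m) z\<bar> \<le> d * Q (V m) z + L * (1 + cross_factor) * C * P U' z" for m
        using form_young[OF _ _ C(2) h[of m] V[of _ m]] C(1) that L0 U
        by (auto simp: distrib_left add.commute simp flip: mult.assoc)
      then show ?thesis using C(1) L0 by (intro exI[of _ "L * (1 + cross_factor) * C"]) auto
    qed
    from relatively_uniformly_integrable_limit[OF _ _ form_tendsto_AE[OF lim] _ Q_le B' H P_nonneg this]
    show ?thesis by simp
  qed
  then show "integrable leb2 (form U' V')" "(\<lambda>m. integral\<^sup>L leb2 (form (U m) (V m))) \<longlonglongrightarrow> integral\<^sup>L leb2 (form U' V')"
    by auto
qed

end

subsection \<open>The Caccioppoli inequality\<close>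

lemma borel_diff_leb2:
  fixes f :: "'a::euclidean_space \<Rightarrow> ennreal"
  assumes "f \<in> borel_measurable borel"
  shows "(\<lambda>z. f (fst z - snd z)) \<in> borel_measurable leb2"
  using measurable_compose[OF borel_measurable_diff[OF fst_leb2 snd_leb2] assms] .

context growth
begin

text \<open>Convexity draws the power out of \<open>G\<close>: with \<open>d \<ge> 1\<close>
  bounding the distances in \<open>D\<close>, \<open>G (B * b * f * (r / d) powr (1 - s))\<close> is
  at most \<open>(r / d) powr (1 - s) * G (B * b * f)\<close>. What remains is a function of one
  variable times the integrable kernel \<open>r powr (1 - s) / r ^ n\<close>. The two conclusions
  differ in the variable at which \<open>f\<close> is evaluated.\<close>

lemma lipschitz_energy:
  fixes D :: "'a::euclidean_space set" and f :: "'a \<Rightarrow> real" and s B R :: real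
  assumes s: "0 < s" "s < 1" and D: "D \<in> sets lebesgue" "D \<subseteq> cball 0 R"
    and f: "f \<in> borel_measurable lebesgue" "\<And>x. 0 \<le> f x" and B: "0 \<le> B"
    and fG: "(\<integral>\<^sup>+ x. indicator D x * ennreal (G (f x)) \<partial>lebesgue) < \<infinity>"
  shows "(\<integral>\<^sup>+ z. indicator (D \<times> D) z * ennreal (G \<bar>B * f (fst z) * norm (fst z - snd z) powr (1 - s)\<bar>
      / norm (fst z - snd z) ^ DIM('a)) \<partial>leb2) < \<infinity>" (is "?I1 < \<infinity>")
    and "(\<integral>\<^sup>+ z. indicator (D \<times> D) z * ennreal (G \<bar>B * f (snd z) * norm (fst z - snd z) powr (1 - s)\<bar>
      / norm (fst z - snd z) ^ DIM('a)) \<partial>leb2) < \<infinity>" (is "?I2 < \<infinity>")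
proof -
  define n where "n = DIM('a)"
  define d where "d = max 1 (2 * R)"
  have d: "1 \<le> d" "2 * R \<le> d" by (auto simp: d_def)
  define b where "b = d powr (1 - s)"
  have b: "1 \<le> b" using d s by (auto simp: b_def intro: ge_one_powr_ge_zero)
  obtain C where C: "0 < C" "\<And>t. 0 \<le> t \<Longrightarrow> G (B * b * t) \<le> C * G t"
    using G_scale_ex[of "B * b"] B b by auto
  define kap where "kap w = indicator (cball 0 d) w * ennreal (norm w powr (1 - s) / norm w ^ n)" for w :: 'a
  have [measurable]: "(\<lambda>w::'a. norm w powr (1 - s) / norm w ^ n) \<in> borel_measurable borel"
    by (intro borel_measurable_divide powr_real_measurable borel_measurable_power) auto
  have kap [measurable]: "kap \<in> borel_measurable borel"
    unfolding kap_def by (intro borel_measurable_times_ennreal borel_measurable_indicator) (auto, measurable)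
  define J where "J = (\<integral>\<^sup>+ w. kap w \<partial>lborel)"
  have J: "J < \<infinity>" unfolding J_def kap_def n_def
    using s by (intro nn_integral_radial_powr_ball) auto
  define a where "a x = ennreal C * (indicator D x * ennreal (G (f x)))" for x
  have Gf: "(\<lambda>x. G (f x)) \<in> borel_measurable lebesgue"
    using measurable_G_abs[OF f(1)] f(2) by simp
  have a [measurable]: "a \<in> borel_measurable lebesgue"
    unfolding a_def using D(1) Gf by measurable
  have a_int: "integral\<^sup>N lebesgue a < \<infinity>"
    unfolding a_def using fG D(1) Gf by (subst nn_integral_cmult) (auto simp: ennreal_mult_less_top)
  have am: "(\<lambda>z. a (fst z)) \<in> borel_measurable leb2" "(\<lambda>z. a (snd z)) \<in> borel_measurable leb2"
    by (auto intro: measurable_compose[OF measurable_fst a] measurable_compose[OF measurable_snd a])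
  have km: "(\<lambda>z. kap (fst z - snd z)) \<in> borel_measurable leb2"
    by (rule borel_diff_leb2) measurable
  have key: "indicator (D \<times> D) (x, y) * ennreal (G \<bar>B * f t * norm (x - y) powr (1 - s)\<bar> / norm (x - y) ^ n)
      \<le> a t * kap (x - y)" if t: "t = x \<or> t = y" for x y t
  proof (cases "x \<in> D \<and> y \<in> D")
    case True
    define r where "r = norm (x - y)"
    have "norm x \<le> R" "norm y \<le> R" using True D(2) by auto
    then have r: "0 \<le> r" "r \<le> d" using norm_triangle_ineq4[of x y] d by (auto simp: r_def)
    have "G \<bar>B * f t * r powr (1 - s)\<bar> = G ((r / d) powr (1 - s) * (B * b * f t))"
      using B f(2)[of t] d r by (simp add: b_def powr_divide ac_simps)
    also have "\<dots> \<le> (r / d) powr (1 - s) * G (B * b * f t)"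
      using r d s B b f(2)[of t] by (intro G_scale_le powr_le1) auto
    also have "\<dots> \<le> r powr (1 - s) * (C * G (f t))"
      using r d s f(2)[of t] B b by (intro mult_mono powr_mono2 C G_nonneg) (auto simp: divide_le_eq mult_le_cancel_left1)
    finally have "G \<bar>B * f t * r powr (1 - s)\<bar> / r ^ n \<le> r powr (1 - s) * (C * G (f t)) / r ^ n"
      using r by (intro divide_right_mono) auto
    also have "\<dots> = C * G (f t) * (r powr (1 - s) / r ^ n)" by simp
    finally have "ennreal (G \<bar>B * f t * r powr (1 - s)\<bar> / r ^ n) \<le> ennreal (C * G (f t) * (r powr (1 - s) / r ^ n))"
      by (rule ennreal_leI)
    also have "\<dots> = ennreal C * ennreal (G (f t)) * ennreal (r powr (1 - s) / r ^ n)"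
    proof -
      have "0 \<le> r powr (1 - s) / r ^ n" "0 \<le> C" "0 \<le> G (f t)" using r C(1) f(2)[of t] by (auto intro: G_nonneg)
      then show ?thesis by (simp only: ennreal_mult mult_nonneg_nonneg)
    qed
    finally show ?thesis using True t r by (auto simp: a_def kap_def r_def)
  qed (auto simp: indicator_def)
  have "?I1 \<le> (\<integral>\<^sup>+ z. a (fst z) * kap (fst z - snd z) \<partial>leb2)"
    using key by (intro nn_integral_mono) (auto simp: n_def)
  also have "\<dots> = (\<integral>\<^sup>+ x. \<integral>\<^sup>+ y. a x * kap (x - y) \<partial>lebesgue \<partial>lebesgue)"
    by (subst lebesgue.nn_integral_fst[symmetric]) (auto intro: borel_measurable_times_ennreal am km)
  also have "\<dots> = (\<integral>\<^sup>+ x. a x * J \<partial>lebesgue)"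
  proof (rule nn_integral_cong)
    fix x
    have "(\<integral>\<^sup>+ y. a x * kap (x - y) \<partial>lebesgue) = (\<integral>\<^sup>+ y. a x * kap (x - y) \<partial>lborel)"
      by (rule nn_integral_completion)
    also have "\<dots> = a x * J"
      by (simp add: nn_integral_cmult nn_integral_lborel_reflect[OF kap] J_def)
    finally show "(\<integral>\<^sup>+ y. a x * kap (x - y) \<partial>lebesgue) = a x * J" .
  qed
  also have "\<dots> < \<infinity>" using a_int J by (simp add: nn_integral_multc ennreal_mult_less_top)
  finally show "?I1 < \<infinity>" .
  have "?I2 \<le> (\<integral>\<^sup>+ z. a (snd z) * kap (fst z - snd z) \<partial>leb2)"
    using key by (intro nn_integral_mono) (auto simp: n_def)
  also have "\<dots> = (\<integral>\<^sup>+ y. \<integral>\<^sup>+ x. a y * kap (x - y) \<partial>lebesgue \<partial>lebesgue)"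
  proof -
    have "(\<lambda>z. a (snd z) * kap (fst z - snd z)) \<in> borel_measurable leb2"
      by (intro borel_measurable_times_ennreal am km)
    from lebesgue_pair.nn_integral_snd[OF this] show ?thesis by simp
  qed
  also have "\<dots> = (\<integral>\<^sup>+ y. a y * J \<partial>lebesgue)"
  proof (rule nn_integral_cong)
    fix y
    have "(\<integral>\<^sup>+ x. a y * kap (x - y) \<partial>lebesgue) = (\<integral>\<^sup>+ x. a y * kap (x - y) \<partial>lborel)"
      by (rule nn_integral_completion)
    also have "\<dots> = a y * J"
      by (simp add: nn_integral_cmult nn_integral_lborel_shift[OF kap] J_def)
    finally show "(\<integral>\<^sup>+ x. a y * kap (x - y) \<partial>lebesgue) = a y * J" .
  qed
  also have "\<dots> < \<infinity>" using a_int J by (simp add: nn_integral_multc ennreal_mult_less_top)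
  finally show "?I2 < \<infinity>" .
qed

end

lemma power_diff_le:
  fixes x y :: real
  assumes "0 \<le> x" "x \<le> y"
  shows "y ^ n - x ^ n \<le> real n * y ^ (n - 1) * (y - x)"
proof (induction n)
  case (Suc n)
  have "y ^ Suc n - x ^ Suc n = y * (y ^ n - x ^ n) + x ^ n * (y - x)" by (simp add: algebra_simps)
  also have "\<dots> \<le> y * (real n * y ^ (n - 1) * (y - x)) + y ^ n * (y - x)"
    using assms by (intro add_mono mult_left_mono Suc mult_right_mono power_mono) auto
  also have "\<dots> = real (Suc n) * y ^ (Suc n - 1) * (y - x)"
    by (cases n) (auto simp: algebra_simps)
  finally show ?case .
qed simp

text \<open>If the cutoff is larger at the point of the larger value \<open>a\<close>, the
  difference of cutoffs has the favourable sign and is dropped. Otherwise it is attached to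
  \<open>a\<close> and costs the error term.\<close>

lemma cutoff_product_diff:
  fixes a b x y :: real
  assumes ab: "0 \<le> b" "b \<le> a" and x: "0 \<le> x" and y: "0 \<le> y"
  shows "(a - b) * max x y ^ n - real n * max x y ^ (n - 1) * (a * \<bar>x - y\<bar>) \<le> a * x ^ n - b * y ^ n"
proof (cases "y \<le> x")
  case True
  have "a * x ^ n - b * y ^ n = (a - b) * x ^ n + b * (x ^ n - y ^ n)" by (simp add: algebra_simps)
  moreover have "0 \<le> b * (x ^ n - y ^ n)" using True ab y by (intro mult_nonneg_nonneg) (auto intro: power_mono)
  moreover have "0 \<le> real n * x ^ (n - 1) * (a * \<bar>x - y\<bar>)" using ab x by simp
  ultimately show ?thesis using True by (simp add: max_def)
next
  case False
  have "a * x ^ n - b * y ^ n = (a - b) * y ^ n - a * (y ^ n - x ^ n)" by (simp add: algebra_simps)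
  moreover have "a * (y ^ n - x ^ n) \<le> a * (real n * y ^ (n - 1) * (y - x))"
    using False ab x by (intro mult_left_mono power_diff_le) auto
  ultimately show ?thesis using False by (simp add: max_def algebra_simps)
qed

context growth
begin

text \<open>If \<open>2 * N * b \<le> m * a\<close>, the term is at most half of
  \<open>m ^ N * (a * g a)\<close>, which fixes the factor \<open>2 * N\<close>. Otherwise \<open>m
  ^ (N - 1) * g a \<le> m powr (q - 1) * g a \<le> g (m * a) \<le> g (2 * N * b)\<close>, by
  \<open>m \<le> 1\<close> and \<open>N \<ge> q\<close>, and only \<open>b\<close> remains.\<close>

lemma absorb:
  assumes N: "q \<le> real N"
  shows "\<exists>C>0. \<forall>a b m. 0 \<le> a \<longrightarrow> 0 \<le> b \<longrightarrow> 0 \<le> m \<longrightarrow> m \<le> 1 \<longrightarrow>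
    real N * m ^ (N - 1) * g a * b \<le> 1 / 2 * m ^ N * (a * g a) + C * G b"
proof -
  have N2: "2 \<le> N" using N q_gt_1 by linarith
  obtain C where C: "0 < C" "\<And>t. 0 \<le> t \<Longrightarrow> G (2 * real N * t) \<le> C * G t"
    using G_scale_ex[of "2 * real N"] by auto
  have "real N * m ^ (N - 1) * g a * b \<le> 1 / 2 * m ^ N * (a * g a) + q * C * G b"
    if a: "0 \<le> a" and b: "0 \<le> b" and m: "0 \<le> m" "m \<le> 1" for a b m
  proof (cases "2 * real N * b \<le> m * a")
    case True
    have "real N * m ^ (N - 1) * g a * b = 1 / 2 * m ^ (N - 1) * g a * (2 * real N * b)" by simp
    also have "\<dots> \<le> 1 / 2 * m ^ (N - 1) * g a * (m * a)"
      using True m g_nonneg[OF a] by (intro mult_left_mono) auto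
    also have "\<dots> = 1 / 2 * (m * m ^ (N - 1)) * (a * g a)" by simp
    also have "m * m ^ (N - 1) = m ^ N" using N2 by (simp add: power_eq_if)
    finally show ?thesis using C(1) q_gt_1 G_nonneg[OF b] by (simp add: add_increasing2)
  next
    case False
    have "m ^ (N - 1) * g a \<le> g (2 * real N * b)"
    proof (cases "m = 0")
      case True
      then show ?thesis using N2 b g_nonneg[of "2 * real N * b"] by (simp add: power_0_left)
    next
      case False
      then have "m ^ (N - 1) = m powr (real (N - 1))" using m by (simp add: powr_realpow)
      also have "\<dots> \<le> m powr (q - 1)" using m False N N2 by (intro powr_mono') auto
      finally have "m ^ (N - 1) * g a \<le> m powr (q - 1) * g a" using g_nonneg[OF a] by (intro mult_right_mono) auto
      also have "\<dots> \<le> g (m * a)" using False m a by (intro g_shrink) auto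
      also have "\<dots> \<le> g (2 * real N * b)" using \<open>\<not> 2 * real N * b \<le> m * a\<close> m a by (intro g_mono) auto
      finally show ?thesis .
    qed
    then have "real N * m ^ (N - 1) * g a * b \<le> real N * g (2 * real N * b) * b"
      using b by (intro mult_right_mono) (auto simp: mult.assoc intro!: mult_left_mono)
    also have "\<dots> = 1 / 2 * (2 * real N * b * g (2 * real N * b))" by simp
    also have "\<dots> \<le> 1 * (q * G (2 * real N * b))"
      using b g_nonneg[of "2 * real N * b"] by (intro mult_mono le_qG) auto
    also have "\<dots> \<le> q * (C * G b)" using C(2)[OF b] q_gt_1 by simp
    finally have "real N * m ^ (N - 1) * g a * b \<le> q * C * G b" by simp
    moreover have "0 \<le> 1 / 2 * m ^ N * (a * g a)" using m a g_nonneg[OF a] by simp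
    ultimately show ?thesis by linarith
  qed
  then show ?thesis using C(1) q_gt_1 by (intro exI[of _ "q * C"]) auto
qed

text \<open>Here \<open>a\<close>, \<open>b\<close> are the values of \<open>M - u\<close> at two points, \<open>x\<close>, \<open>y\<close> those of the cutoff function,
  and \<open>T\<close> is the \<open>s\<close>-th power of their distance.\<close>
lemma caccioppoli_pointwise:
  assumes N: "q \<le> real N"
  shows "\<exists>C>0. \<forall>a b x y T. 0 \<le> a \<longrightarrow> 0 \<le> b \<longrightarrow> 0 \<le> x \<longrightarrow> x \<le> 1 \<longrightarrow> 0 \<le> y \<longrightarrow> y \<le> 1 \<longrightarrow> 0 < T \<longrightarrow>
    1 / 2 * max x y ^ N * G \<bar>(a - b) / T\<bar> - C * G ((a + b) * \<bar>x - y\<bar> / T)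
      \<le> sg ((a - b) / T) * ((a * x ^ N - b * y ^ N) / T)"
proof -
  obtain C where C: "0 < C" "\<And>a b m. 0 \<le> a \<Longrightarrow> 0 \<le> b \<Longrightarrow> 0 \<le> m \<Longrightarrow> m \<le> 1 \<Longrightarrow>
    real N * m ^ (N - 1) * g a * b \<le> 1 / 2 * m ^ N * (a * g a) + C * G b"
    using absorb[OF N] by auto
  \<comment> \<open>The inequality is invariant under exchanging the two points, because
    \<open>sg\<close> is odd, so \<open>b \<le> a\<close> may be assumed.\<close>
  have ordered: "1 / 2 * max x y ^ N * G \<bar>(a - b) / T\<bar> - C * G ((a + b) * \<bar>x - y\<bar> / T)
      \<le> sg ((a - b) / T) * ((a * x ^ N - b * y ^ N) / T)"
    if ab: "0 \<le> b" "b \<le> a" and x: "0 \<le> x" "x \<le> 1" and y: "0 \<le> y" "y \<le> 1" and T: "0 < T" for a b x y T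
  proof -
    define m where "m = max x y"
    have m: "0 \<le> m" "m \<le> 1" using x y by (auto simp: m_def)
    define t where "t = (a - b) / T"
    have t: "0 \<le> t" using ab T by (simp add: t_def)
    define e where "e = a * \<bar>x - y\<bar> / T"
    have e: "0 \<le> e" using ab T by (simp add: e_def)
    have sgt: "sg t = g t" using t by (cases "t = 0") (auto simp: sg_def)
    have "t * m ^ N - real N * m ^ (N - 1) * e = ((a - b) * m ^ N - real N * m ^ (N - 1) * (a * \<bar>x - y\<bar>)) / T"
      by (simp add: t_def e_def diff_divide_distrib left_diff_distrib)
    also have "\<dots> \<le> (a * x ^ N - b * y ^ N) / T"
      unfolding m_def using ab x y T by (intro divide_right_mono cutoff_product_diff) auto
    finally have "g t * (t * m ^ N - real N * m ^ (N - 1) * e) \<le> g t * ((a * x ^ N - b * y ^ N) / T)"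
      using g_nonneg[OF t] by (rule mult_left_mono)
    then have "m ^ N * (t * g t) - real N * m ^ (N - 1) * g t * e \<le> g t * ((a * x ^ N - b * y ^ N) / T)"
      by (simp add: algebra_simps)
    with C(2)[OF t e m] have "1 / 2 * m ^ N * (t * g t) - C * G e \<le> g t * ((a * x ^ N - b * y ^ N) / T)"
      by linarith
    moreover have "1 / 2 * m ^ N * G t \<le> 1 / 2 * m ^ N * (t * g t)"
      using m by (intro mult_left_mono G_le_tg t) auto
    moreover have "C * G e \<le> C * G ((a + b) * \<bar>x - y\<bar> / T)"
      using C(1) ab T e by (intro mult_left_mono G_mono) (auto simp: e_def intro!: divide_right_mono mult_right_mono)
    ultimately have "1 / 2 * m ^ N * G t - C * G ((a + b) * \<bar>x - y\<bar> / T) \<le> sg t * ((a * x ^ N - b * y ^ N) / T)"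
      unfolding sgt by linarith
    then show ?thesis using t unfolding m_def t_def by (simp only: abs_of_nonneg)
  qed
  show ?thesis
  proof (intro exI[of _ C] conjI allI impI C(1))
    fix a b x y T :: real
    assume *: "0 \<le> a" "0 \<le> b" "0 \<le> x" "x \<le> 1" "0 \<le> y" "y \<le> 1" "0 < T"
    show "1 / 2 * max x y ^ N * G \<bar>(a - b) / T\<bar> - C * G ((a + b) * \<bar>x - y\<bar> / T)
      \<le> sg ((a - b) / T) * ((a * x ^ N - b * y ^ N) / T)"
    proof (cases "b \<le> a")
      case False
      have eq: "\<bar>(b - a) / T\<bar> = \<bar>(a - b) / T\<bar>" by (simp add: abs_minus_commute)
      have "sg ((b - a) / T) * ((b * y ^ N - a * x ^ N) / T) = sg ((a - b) / T) * ((a * x ^ N - b * y ^ N) / T)"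
      proof -
        have 1: "(b - a) / T = - ((a - b) / T)" by (simp add: minus_divide_left)
        have 2: "(b * y ^ N - a * x ^ N) / T = - ((a * x ^ N - b * y ^ N) / T)" by (simp add: minus_divide_left)
        show ?thesis unfolding 1 2 sg_uminus by (rule minus_mult_minus)
      qed
      then show ?thesis
        using ordered[of a b y x T] * False eq by (simp add: max.commute add.commute abs_minus_commute)
    qed (use ordered * in auto)
  qed
qed

end

context form_setting
begin

text \<open>The order of quantifiers is the point: \<open>Z\<close> is fixed before \<open>u\<close>
  and \<open>M\<close> and depends on them only through \<open>h\<close>, so it serves the whole
  sequence.\<close>

lemma caccioppoli:
  fixes eta :: "'a \<Rightarrow> real" and l R :: real
  assumes s1: "s < 1" and N: "q \<le> real N"
    and D_bdd: "D \<subseteq> cball 0 R"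
    and eta: "\<And>x. 0 \<le> eta x" "\<And>x. eta x \<le> 1" "\<And>x. x \<notin> S \<Longrightarrow> eta x = 0"
    and lip: "\<And>x y. \<bar>eta x - eta y\<bar> \<le> l * norm (x - y)" and l: "0 \<le> l"
  shows "\<exists>Z<\<infinity>. \<forall>u M. u \<in> borel_measurable lebesgue \<longrightarrow> (AE x in lebesgue. \<bar>u x\<bar> \<le> h x) \<longrightarrow>
    (AE x in lebesgue. x \<in> D \<longrightarrow> u x \<le> M) \<longrightarrow> (\<forall>x. \<bar>M\<bar> \<le> h x) \<longrightarrow>
    integrable leb2 (form u (\<lambda>x. (M - u x) * eta x ^ N)) \<longrightarrow>
    0 \<le> integral\<^sup>L leb2 (form u (\<lambda>x. (M - u x) * eta x ^ N)) \<longrightarrow>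
    energy s {x. eta x = 1} u \<le> Z"
proof -
  obtain C where C: "0 < C" and cacc: "\<And>a b x y T. 0 \<le> a \<Longrightarrow> 0 \<le> b \<Longrightarrow> 0 \<le> x \<Longrightarrow> x \<le> 1 \<Longrightarrow> 0 \<le> y \<Longrightarrow> y \<le> 1 \<Longrightarrow> 0 < T \<Longrightarrow>
    1 / 2 * max x y ^ N * G \<bar>(a - b) / T\<bar> - C * G ((a + b) * \<bar>x - y\<bar> / T)
      \<le> sg ((a - b) / T) * ((a * x ^ N - b * y ^ N) / T)"
    using caccioppoli_pointwise[OF N] by blast
  \<comment> \<open>The error from the cutoff. Both \<open>M - u x\<close> and
    \<open>M - u y\<close> are at most twice the larger value of \<open>h\<close>, hence the factor
    4; evaluating at \<open>fst\<close> and at \<open>snd\<close> and adding dominates that larger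
    value.\<close>
  define lp where "lp t z = indicator (D \<times> D) z * (G \<bar>4 * l * h (t z) * norm (fst z - snd z) powr (1 - s)\<bar>
      / norm (fst z - snd z) ^ DIM('a))" for t and z :: "'a \<times> 'a"
  have lp_nonneg: "0 \<le> lp t z" for t z using G_nonneg by (simp add: lp_def)
  have hG': "(\<integral>\<^sup>+ x. indicator D x * ennreal (G (h x)) \<partial>lebesgue) < \<infinity>"
    using h_G h_nonneg by simp
  have lp_int: "integrable leb2 (lp fst)" "integrable leb2 (lp snd)"
  proof -
    have "lp t \<in> borel_measurable leb2" if "(\<lambda>z. h (t z)) \<in> borel_measurable leb2" for t
      unfolding lp_def
      by (intro borel_measurable_times borel_measurable_indicator D2_meas borel_measurable_divide norm_pow_meas
        measurable_G_abs powr_real_measurable norm_leb2 borel_measurable_const that)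
    then have m: "lp fst \<in> borel_measurable leb2" "lp snd \<in> borel_measurable leb2"
      by (auto intro: comp_leb2 h_meas)
    have "(\<integral>\<^sup>+ z. ennreal (lp fst z) \<partial>leb2) < \<infinity>" "(\<integral>\<^sup>+ z. ennreal (lp snd z) \<partial>leb2) < \<infinity>"
      using lipschitz_energy[OF s_pos s1 D_meas D_bdd h_meas h_nonneg _ hG', of "4 * l"] l
      by (simp_all add: lp_def indicator_mult_ennreal)
    then show "integrable leb2 (lp fst)" "integrable leb2 (lp snd)"
      using m lp_nonneg by (auto intro!: integrableI_nonneg)
  qed
  have cr_int: "integrable leb2 (cross (\<lambda>x. G (h x)))"
  proof -
    have "(\<integral>\<^sup>+ z. ennreal (cross (\<lambda>x. G (h x)) z) \<partial>leb2) < \<infinity>"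
      using S_G_h nn_integral_weight by (subst nn_integral_cross) (auto simp: G_h_nonneg ennreal_mult_less_top)
    then show ?thesis by (intro integrableI_nonneg) (auto intro!: cross_nonneg G_h_nonneg)
  qed
  \<comment> \<open>All error terms: those of the cutoff inside \<open>D \<times> D\<close>, and the
    cross term, where \<open>|v| \<le> 2 * h\<close> and \<open>t * g t \<le> q * G t\<close>
    produce \<open>2 * q\<close>.\<close>
  define B where "B z = L * C * (lp fst z + lp snd z) + L * cross_factor * 2 * q * cross (\<lambda>x. G (h x)) z" for z
  have B_int: "integrable leb2 B" unfolding B_def using lp_int cr_int by auto
  have key: "energy s {x. eta x = 1} u \<le> ennreal (2 * L) * ennreal (integral\<^sup>L leb2 B)"
    if u: "u \<in> borel_measurable lebesgue" and uh: "AE x in lebesgue. \<bar>u x\<bar> \<le> h x"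
      and uM: "AE x in lebesgue. x \<in> D \<longrightarrow> u x \<le> M" and Mh: "\<And>x. \<bar>M\<bar> \<le> h x"
      and int: "integrable leb2 (form u (\<lambda>x. (M - u x) * eta x ^ N))"
      and pos: "0 \<le> integral\<^sup>L leb2 (form u (\<lambda>x. (M - u x) * eta x ^ N))" for u M
  proof -
    define v where "v = (\<lambda>x. (M - u x) * eta x ^ N)"
    define K where "K = {x. eta x = 1}"
    have N0: "N \<noteq> 0" using N q_gt_1 by auto
    have v0: "v x = 0" if "x \<notin> S" for x using eta(3)[OF that] N0 by (simp add: v_def)
    have KD: "K \<subseteq> D" using eta(3) SD by (force simp: K_def)
    let ?e = "\<lambda>z. indicator (K \<times> K) z * (G \<bar>Ds s u (fst z) (snd z)\<bar> / norm (fst z - snd z) ^ DIM('a))"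
    \<comment> \<open>Outside \<open>D \<times> D\<close> the left side vanishes, because
      \<open>K \<subseteq> D\<close>, and the upper bound of the form suffices. Inside, the
      pointwise inequality is multiplied by the kernel; its lower bound \<open>1 / L\<close> and the
      factor \<open>1 / 2\<close> explain \<open>2 * L\<close>.\<close>
    have E: "AE z in leb2. ?e z \<le> 2 * L * (B z - form u v z)"
      using AE_leb2_fst[OF uh] AE_leb2_snd[OF uh] AE_leb2_fst[OF uM] AE_leb2_snd[OF uM] AE_kernel
    proof eventually_elim
      fix z :: "'a \<times> 'a"
      assume z: "\<bar>u (fst z)\<bar> \<le> h (fst z)" "\<bar>u (snd z)\<bar> \<le> h (snd z)"
        "fst z \<in> D \<longrightarrow> u (fst z) \<le> M" "snd z \<in> D \<longrightarrow> u (snd z) \<le> M"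
        "1 / L \<le> k (fst z) (snd z) \<and> k (fst z) (snd z) \<le> L"
      obtain x y where xy: "z = (x, y)" by force
      have crn: "0 \<le> cross (\<lambda>x. G (h x)) z" by (intro cross_nonneg G_h_nonneg)
      show "?e z \<le> 2 * L * (B z - form u v z)"
      proof (cases "x \<in> D \<and> y \<in> D")
        case False
        have "\<bar>form u v z\<bar> \<le> L * (cross_factor * cross (\<lambda>x. g (h x) * \<bar>v x\<bar>) z)"
          using form_pointwise[of x y u v] z v0 False by (auto simp: xy)
        also have "cross (\<lambda>x. g (h x) * \<bar>v x\<bar>) z \<le> cross (\<lambda>x. 2 * q * G (h x)) z"
        proof -
          have i: "g (h x) * \<bar>v x\<bar> \<le> 2 * q * G (h x)" if "\<bar>u x\<bar> \<le> h x" for x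
          proof -
            have "\<bar>v x\<bar> \<le> (2 * h x) * 1"
              unfolding v_def abs_mult using that Mh[of x] eta(1,2)[of x]
              by (intro mult_mono) (auto simp: power_le_one)
            then have "g (h x) * \<bar>v x\<bar> \<le> g (h x) * (2 * h x)"
              using g_nonneg[OF h_nonneg] by (intro mult_left_mono) auto
            also have "\<dots> = 2 * (h x * g (h x))" by simp
            also have "\<dots> \<le> 2 * (q * G (h x))" using le_qG[OF h_nonneg[of x]] by simp
            finally show ?thesis by simp
          qed
          show ?thesis unfolding cross_def xy using z(1,2)
            by (intro add_mono mult_right_mono mult_left_mono weight_nonneg i) (auto simp: xy)
        qed
        also have "cross (\<lambda>x. 2 * q * G (h x)) z = 2 * q * cross (\<lambda>x. G (h x)) z"
          by (simp add: cross_def algebra_simps)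
        finally have "\<bar>form u v z\<bar> \<le> L * (cross_factor * (2 * q * cross (\<lambda>x. G (h x)) z))"
          using L_ge_1 cross_factor_nonneg by (simp add: mult_left_mono)
        moreover have "?e z = 0" using False KD by (auto simp: xy indicator_def)
        moreover have "lp fst z = 0" "lp snd z = 0" using False by (auto simp: lp_def xy)
        ultimately have "0 \<le> B z - form u v z" "?e z = 0" by (auto simp: B_def)
        then show ?thesis using L_ge_1 by (metis mult_nonneg_nonneg order_trans zero_le_one zero_le_numeral)
      next
        case True
        show ?thesis
        proof (cases "x = y")
          case True
          then have "Ds s u x y = 0" "Ds s v x y = 0" by (auto simp: Ds_def)
          then have 0: "?e z = 0" "form u v z = 0" by (simp_all add: xy form_def)
          have "0 \<le> B z" using L_ge_1 cross_factor_nonneg C lp_nonneg crn q_gt_1 by (simp add: B_def)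
          then show ?thesis unfolding 0 using L_ge_1 by simp
        next
          case False
          define r where "r = norm (x - y)"
          define T where "T = r powr s"
          have r: "0 < r" and T: "0 < T" using False by (auto simp: r_def T_def)
          define n where "n = DIM('a)"
          let ?a = "M - u x" and ?b = "M - u y" and ?m = "max (eta x) (eta y)"
          have ab: "0 \<le> ?a" "0 \<le> ?b" using z True by (auto simp: xy)
          \<comment> \<open>The minus sign is decisive: the form of \<open>u\<close> tested with a
            multiple of \<open>M - u\<close> is the negative of a coercive expression, so its
            nonnegativity bounds the energy from above.\<close>
          have Dsu: "Ds s u x y = - ((?a - ?b) / T)"
            by (simp add: Ds_def T_def r_def minus_divide_left)
          have Dsv: "Ds s v x y = (?a * eta x ^ N - ?b * eta y ^ N) / T"
            by (simp add: Ds_def T_def r_def v_def)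
          define X where "X = sg ((?a - ?b) / T) * ((?a * eta x ^ N - ?b * eta y ^ N) / T)"
          have form: "form u v z = - (k x y * X / r ^ n)"
          proof -
            have "form u v z = sg (Ds s u x y) * Ds s v x y * k x y / r ^ n"
              by (simp add: form_def sg_def xy r_def n_def)
            then show ?thesis unfolding Dsu Dsv sg_uminus X_def by simp
          qed
          let ?G = "G \<bar>4 * l * h x * r powr (1 - s)\<bar> + G \<bar>4 * l * h y * r powr (1 - s)\<bar>"
          have G_le: "G ((?a + ?b) * \<bar>eta x - eta y\<bar> / T) \<le> ?G"
          proof -
            define H where "H = max (h x) (h y)"
            have H: "0 \<le> H" using h_nonneg[of x] by (simp add: H_def)
            have "?a + ?b \<le> 4 * H"
              using z Mh[of x] Mh[of y] by (auto simp: xy H_def)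
            then have "(?a + ?b) * \<bar>eta x - eta y\<bar> / T \<le> (4 * H) * (l * r) / T"
              using ab lip[of x y] T H l by (intro divide_right_mono mult_mono) (auto simp: r_def)
            also have "\<dots> = 4 * l * H * r powr (1 - s)"
              using r by (simp add: T_def powr_diff)
            finally have "G ((?a + ?b) * \<bar>eta x - eta y\<bar> / T) \<le> G (4 * l * H * r powr (1 - s))"
              using ab T by (intro G_mono) auto
            also have "\<dots> \<le> ?G"
              using l h_nonneg[of x] h_nonneg[of y] G_nonneg by (auto simp: H_def max_def)
            finally show ?thesis .
          qed
          have X: "1 / 2 * ?m ^ N * G \<bar>Ds s u x y\<bar> - C * ?G \<le> X"
          proof -
            have "1 / 2 * ?m ^ N * G \<bar>(?a - ?b) / T\<bar> - C * G ((?a + ?b) * \<bar>eta x - eta y\<bar> / T) \<le> X"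
              unfolding X_def by (intro cacc ab eta T)
            moreover have "C * G ((?a + ?b) * \<bar>eta x - eta y\<bar> / T) \<le> C * ?G"
              using G_le C by (intro mult_left_mono) auto
            ultimately show ?thesis unfolding Dsu abs_minus_cancel by linarith
          qed
          have m1: "indicator (K \<times> K) z \<le> ?m ^ N"
            using eta(1,2)[of x] eta(1,2)[of y] by (auto simp: indicator_def xy K_def le_max_iff_disj)
          have kb: "1 / L \<le> k x y" "k x y \<le> L" using z by (auto simp: xy)
          have k0: "0 \<le> k x y" using kb(1) L_ge_1 by (rule_tac order_trans[of 0 "1 / L"]) auto
          have Gp: "0 \<le> G \<bar>Ds s u x y\<bar>" "0 \<le> ?G" by (auto intro!: G_nonneg add_nonneg_nonneg)
          have "1 / (2 * L) * (indicator (K \<times> K) z * G \<bar>Ds s u x y\<bar>) = 1 / L * (1 / 2 * indicator (K \<times> K) z * G \<bar>Ds s u x y\<bar>)"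
            by simp
          also have "\<dots> \<le> k x y * (1 / 2 * ?m ^ N * G \<bar>Ds s u x y\<bar>)"
            using kb L_ge_1 m1 Gp k0 eta(1)[of x] by (intro mult_mono mult_nonneg_nonneg zero_le_power) auto
          also have "\<dots> \<le> k x y * (X + C * ?G)" using X k0 by (intro mult_left_mono) auto
          also have "\<dots> \<le> k x y * X + L * (C * ?G)"
            unfolding distrib_left[of "k x y"]
            using kb(2) C Gp by (intro add_left_mono mult_right_mono mult_nonneg_nonneg) auto
          finally have "1 / (2 * L) * (indicator (K \<times> K) z * G \<bar>Ds s u x y\<bar>) / r ^ n \<le> (k x y * X + L * (C * ?G)) / r ^ n"
            using r by (intro divide_right_mono) auto
          also have "\<dots> = L * C * (lp fst z + lp snd z) - form u v z"
            unfolding form using True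
            by (simp add: lp_def xy r_def n_def add_divide_distrib distrib_left mult.assoc)
          also have "\<dots> \<le> B z - form u v z"
            using L_ge_1 cross_factor_nonneg q_gt_1 crn by (simp add: B_def)
          finally have "2 * L * (1 / (2 * L) * (indicator (K \<times> K) z * G \<bar>Ds s u x y\<bar>) / r ^ n) \<le> 2 * L * (B z - form u v z)"
            using L_ge_1 by (intro mult_left_mono) auto
          then show ?thesis using L_ge_1 by (simp add: xy r_def n_def)
        qed
      qed
    qed
    have nn: "0 \<le> ?e z" for z using G_nonneg by auto
    have AE: "AE z in leb2. ennreal (?e z) \<le> ennreal (2 * L * (B z - form u v z))"
      using E by eventually_elim (rule ennreal_leI)
    have AE0: "AE z in leb2. 0 \<le> 2 * L * (B z - form u v z)"
      using E by eventually_elim (rule order_trans[OF nn])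
    have int': "integrable leb2 (\<lambda>z. 2 * L * (B z - form u v z))"
      using B_int int by (simp add: v_def)
    have "energy s K u = (\<integral>\<^sup>+ z. ennreal (?e z) \<partial>leb2)"
      unfolding energy_def by (intro nn_integral_cong) (auto simp: indicator_def)
    also have "\<dots> \<le> (\<integral>\<^sup>+ z. ennreal (2 * L * (B z - form u v z)) \<partial>leb2)" by (rule nn_integral_mono_AE[OF AE])
    also have "\<dots> = ennreal (\<integral>z. 2 * L * (B z - form u v z) \<partial>leb2)"
      by (rule nn_integral_eq_integral[OF int' AE0])
    also have "\<dots> = ennreal (2 * L * (integral\<^sup>L leb2 B - integral\<^sup>L leb2 (form u v)))"
      using B_int int by (simp add: v_def)
    also have "\<dots> \<le> ennreal (2 * L * integral\<^sup>L leb2 B)"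
      using pos L_ge_1 by (intro ennreal_leI mult_left_mono) (auto simp: v_def)
    also have "\<dots> = ennreal (2 * L) * ennreal (integral\<^sup>L leb2 B)"
      using L_ge_1 by (simp add: ennreal_mult')
    finally show ?thesis by (simp add: K_def)
  qed
  show ?thesis
    by (rule exI[of _ "ennreal (2 * L) * ennreal (integral\<^sup>L leb2 B)"]) (auto simp: ennreal_mult_less_top intro!: key)
qed

end

section \<open>Separation, neighbourhoods and admissible test functions\<close>

lemma borel_measurable_lebesgue_AE:
  fixes u w :: "'a::euclidean_space \<Rightarrow> real"
  assumes w: "w \<in> borel_measurable lebesgue" and eq: "AE x in lebesgue. u x = w x"
  shows "u \<in> borel_measurable lebesgue"
proof (rule borel_measurableI)
  fix A :: "real set" assume "open A"
  obtain N where N: "N \<in> null_sets lebesgue" "{x. u x \<noteq> w x} \<subseteq> N"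
    using eq by (auto simp: eventually_ae_filter)
  have "u -` A \<inter> N \<in> null_sets lebesgue"
    using N(1) negligible_subset[of N "u -` A \<inter> N"] by (auto simp: negligible_iff_null_sets)
  then have 1: "u -` A \<inter> N \<in> sets lebesgue" by blast
  have "w -` A \<in> sets lebesgue"
    using measurable_sets[OF w, of A] \<open>open A\<close> by auto
  then have 2: "w -` A - N \<in> sets lebesgue" using N(1) by blast
  have "u -` A = (w -` A - N) \<union> (u -` A \<inter> N)" using N(2) by auto
  then show "u -` A \<inter> space lebesgue \<in> sets lebesgue" using 1 2
    by (metis sets.Un inf_top_right space_completion space_lborel space_borel)
qed

text \<open>With \<open>S\<close> in the ball of radius \<open>R\<close>,
  \<open>1 + |y| \<le> |x - y| + (R + 1)\<close>, and
  \<open>R + 1 \<le> (R + 1) / r * |x - y|\<close> because the distance is at least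
  \<open>r\<close>. The constant is the reciprocal of \<open>1 + (R + 1) / r\<close>.\<close>

lemma uniform_separation:
  fixes S D :: "'a::euclidean_space set"
  assumes "bounded S" and r: "0 < r" "\<forall>x\<in>S. \<forall>y. y \<notin> D \<longrightarrow> r \<le> norm (x - y)"
  shows "\<exists>c>0. c \<le> 1 \<and> (\<forall>x y. x \<in> S \<longrightarrow> y \<notin> D \<longrightarrow> c * (1 + norm y) \<le> norm (x - y))"
proof -
  obtain R where R: "0 < R" "\<And>x. x \<in> S \<Longrightarrow> norm x \<le> R"
    using assms(1) by (auto simp: bounded_pos)
  define C where "C = 1 + (R + 1) / r"
  have C: "1 \<le> C" using R r by (simp add: C_def)
  have "1 + norm y \<le> C * norm (x - y)" if "x \<in> S" "y \<notin> D" for x y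
  proof -
    have "norm y \<le> norm x + norm (x - y)" using norm_triangle_sub[of y x] by (simp add: norm_minus_commute)
    then have "1 + norm y \<le> norm (x - y) + (R + 1)" using R(2)[OF that(1)] by linarith
    also have "R + 1 \<le> (R + 1) / r * norm (x - y)"
    proof -
      have "(R + 1) / r * r \<le> (R + 1) / r * norm (x - y)"
        using r(1) r(2) that R(1) by (intro mult_left_mono) auto
      then show ?thesis using r(1) by simp
    qed
    finally show ?thesis by (simp add: C_def algebra_simps)
  qed
  then show ?thesis using C by (intro exI[of _ "1 / C"]) (auto simp: divide_le_eq mult.commute)
qed

lemma Ck_lipschitz_bounded_support:
  fixes f :: "'a::euclidean_space \<Rightarrow> real"
  assumes f: "Ck (Suc 0) f" and R: "\<And>x. R < norm x \<Longrightarrow> f x = 0"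
  shows "\<exists>l\<ge>0. \<forall>x y. \<bar>f x - f y\<bar> \<le> l * norm (x - y)"
proof -
  let ?D = "\<lambda>x. frechet_derivative f (at x)"
  have "\<exists>B>0. \<forall>x. \<bar>?D x b\<bar> \<le> B" for b
    using bounded_bounded_support[of "\<lambda>x. ?D x b" R] f frechet_derivative_bounded_support[of R f, OF R]
    by (metis Ck.simps(1) Ck_Suc_deriv)
  then obtain B where B: "\<And>b. 0 < B b" "\<And>b x. \<bar>?D x b\<bar> \<le> B b" by metis
  define l where "l = sum B Basis"
  have l: "0 \<le> l" unfolding l_def using B(1) by (intro sum_nonneg less_imp_le)
  have lin: "linear (?D x)" for x
    using Ck_Suc_has_derivative[OF f] has_derivative_linear by blast
  have on: "onorm (?D x) \<le> l" for x
  proof (rule onorm_le)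
    fix h :: 'a
    have "?D x h = ?D x (\<Sum>b\<in>Basis. (h \<bullet> b) *\<^sub>R b)" by (simp add: euclidean_representation)
    also have "\<dots> = (\<Sum>b\<in>Basis. (h \<bullet> b) * ?D x b)"
      using lin[of x] by (simp add: linear_sum linear_scale)
    finally have "\<bar>?D x h\<bar> \<le> (\<Sum>b\<in>Basis. \<bar>(h \<bullet> b) * ?D x b\<bar>)" using sum_abs by metis
    also have "\<dots> \<le> (\<Sum>b\<in>Basis. B b * norm h)"
    proof (rule sum_mono)
      fix b :: 'a assume "b \<in> Basis"
      then have "\<bar>h \<bullet> b\<bar> * \<bar>?D x b\<bar> \<le> norm h * B b" by (intro mult_mono Basis_le_norm B(2)) auto
      then show "\<bar>(h \<bullet> b) * ?D x b\<bar> \<le> B b * norm h" by (simp add: abs_mult mult.commute)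
    qed
    finally show "norm (?D x h) \<le> l * norm h" by (simp add: l_def sum_distrib_right)
  qed
  have "norm (f x - f y) \<le> l * norm (x - y)" for x y
    by (rule differentiable_bound[OF convex_UNIV _ on])
      (auto intro: Ck_Suc_has_derivative[OF f])
  then show ?thesis using l by auto
qed

text \<open>The factor 4 leaves room for a chain of nested neighbourhoods whose radii are multiples
  of the same \<open>r\<close>.\<close>

lemma compact_neighbourhood:
  fixes K Om :: "'a::euclidean_space set"
  assumes K: "compact K" "K \<noteq> {}" and Om: "open Om" "K \<subseteq> Om"
  shows "\<exists>r>0. \<forall>t. 0 < t \<longrightarrow> t \<le> 4 * r \<longrightarrow> compact {x. infdist x K \<le> t} \<and> {x. infdist x K \<le> t} \<subseteq> Om"
proof -
  obtain e where e: "0 < e" "(\<Union>x\<in>K. cball x e) \<subseteq> Om"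
    using compact_subset_open_imp_cball_epsilon_subset[OF K(1) Om] by metis
  have "{x. infdist x K \<le> t} \<subseteq> Om" if "t \<le> e" for t
  proof
    fix x assume x: "x \<in> {x. infdist x K \<le> t}"
    obtain y where "y \<in> K" "infdist x K = dist x y"
      using infdist_attains_inf[OF compact_imp_closed[OF K(1)] K(2)] by metis
    then show "x \<in> Om" using x e(2) that by (force simp: dist_commute)
  qed
  then show ?thesis
    using e(1) compact_infdist_le[OF K(2,1)] by (intro exI[of _ "e / 4"]) auto
qed

lemma infdist_sublevel:
  fixes K Om :: "'a::euclidean_space set"
  assumes "compact {x. infdist x K \<le> t}" "{x. infdist x K \<le> t} \<subseteq> Om"
  shows "open {x. infdist x K < t}" "compactly_contained {x. infdist x K < t} Om"
proof -
  show "open {x. infdist x K < t}" by (intro open_Collect_less continuous_intros)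
  have "closure {x. infdist x K < t} \<subseteq> {x. infdist x K \<le> t}"
    using assms(1) by (intro closure_minimal compact_imp_closed) auto
  then show "compactly_contained {x. infdist x K < t} Om"
    unfolding compactly_contained_def using assms compact_Int_closed[OF assms(1) closed_closure]
    by (metis Int_absorb1 subset_trans)
qed

lemma compactly_contained_bounded: "compactly_contained D Om \<Longrightarrow> \<exists>R. D \<subseteq> cball 0 R"
  unfolding compactly_contained_def
proof -
  assume "compact (closure D) \<and> closure D \<subseteq> Om"
  then have "bounded D" by (meson bounded_subset closure_subset compact_imp_bounded)
  then show ?thesis by (auto simp: bounded_iff subset_iff)
qed

lemma nn_integral_bounded_const:
  fixes D :: "'a::euclidean_space set"
  assumes "D \<in> sets lebesgue" "D \<subseteq> cball 0 R"
  shows "(\<integral>\<^sup>+ x. indicator D x * ennreal b \<partial>lebesgue) < \<infinity>"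
proof -
  have "emeasure lebesgue D \<le> emeasure lebesgue (cball (0::'a) R)"
    using assms by (intro emeasure_mono) auto
  also have "\<dots> < \<infinity>" by (simp add: emeasure_bounded_finite[simplified])
  finally show ?thesis
    using assms by (simp add: nn_integral_multc ennreal_mult_less_top)
qed

context growth
begin

text \<open>Convexity and \<open>G 1 = 1\<close> give \<open>t \<le> G t\<close> beyond 1. On sets
  of finite measure a finite \<open>G\<close>-integral thus implies integrability, which
  mollification requires.\<close>

lemma le_one_plus_G: "0 \<le> t \<Longrightarrow> t \<le> 1 + G t"
proof (cases "t \<le> 1")
  case False
  then have "G (1 / t * t) \<le> 1 / t * G t" by (intro G_scale_le) auto
  then show ?thesis using False by (simp add: G_1 field_simps)
qed (simp add: G_nonneg add_increasing2)

text \<open>A product rule for difference quotients, with \<open>M - u\<close> taken at the second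
  point. The bound may depend on \<open>u\<close>: finiteness only makes the cut-off function
  admissible in the supersolution inequality.\<close>

lemma energy_finite_cutoff:
  fixes u eta :: "'a::euclidean_space \<Rightarrow> real"
  assumes s: "0 < s" "s < 1" and D: "D \<in> sets lebesgue" "D \<subseteq> cball 0 R"
    and u: "u \<in> borel_measurable lebesgue" "energy s D u < \<infinity>"
      "(\<integral>\<^sup>+ x. indicator D x * ennreal (G \<bar>M - u x\<bar>) \<partial>lebesgue) < \<infinity>"
    and eta: "\<And>x. 0 \<le> eta x" "\<And>x. eta x \<le> 1"
    and lip: "\<And>x y. \<bar>eta x - eta y\<bar> \<le> l * norm (x - y)" and l: "0 \<le> l"
  shows "energy s D (\<lambda>x. (M - u x) * eta x ^ N) < \<infinity>"
proof -
  define n where "n = DIM('a)"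
  define C where "C = q * 2 powr q"
  have C: "0 \<le> C" using q_gt_1 by (simp add: C_def)
  let ?r = "\<lambda>z::'a \<times> 'a. norm (fst z - snd z)"
  let ?F = "\<lambda>z. indicator (D \<times> D) z * ennreal (G \<bar>Ds s u (fst z) (snd z)\<bar> / ?r z ^ n)"
  let ?H = "\<lambda>z. indicator (D \<times> D) z * ennreal (G \<bar>(real N * l) * \<bar>M - u (snd z)\<bar> * ?r z powr (1 - s)\<bar> / ?r z ^ n)"
  have H: "integral\<^sup>N leb2 ?H < \<infinity>"
    unfolding n_def using u(1,3) l by (intro lipschitz_energy(2)[OF s D]) auto
  have D2: "D \<times> D \<in> sets leb2" using D(1) by (intro pair_measureI)
  have rm: "(\<lambda>z. ?r z ^ n) \<in> borel_measurable leb2" using norm_leb2 by (rule borel_measurable_power)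
  have Fm: "?F \<in> borel_measurable leb2"
    using D2 u(1) rm by (intro borel_measurable_times_ennreal borel_measurable_indicator
      measurable_compose[OF _ measurable_ennreal] borel_measurable_divide measurable_G_abs Ds_measurable)
  have Hm: "?H \<in> borel_measurable leb2"
  proof -
    have "(\<lambda>x. \<bar>M - u x\<bar>) \<in> borel_measurable lebesgue" using u(1) by measurable
    from comp_leb2(2)[OF this] show ?thesis
      using D2 rm norm_leb2 by (intro borel_measurable_times_ennreal borel_measurable_indicator
        measurable_compose[OF _ measurable_ennreal] borel_measurable_divide measurable_G_abs borel_measurable_times
        powr_real_measurable borel_measurable_const)
  qed
  have "energy s D (\<lambda>x. (M - u x) * eta x ^ N) \<le> (\<integral>\<^sup>+ z. ennreal C * (?F z + ?H z) \<partial>leb2)"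
    unfolding energy_def
  proof (rule nn_integral_mono)
    fix z :: "'a \<times> 'a"
    obtain x y where xy: "z = (x, y)" by force
    define r where "r = norm (x - y)"
    let ?v = "\<lambda>x. (M - u x) * eta x ^ N"
    have "G \<bar>Ds s ?v x y\<bar> \<le> C * (G \<bar>Ds s u x y\<bar> + G \<bar>(real N * l) * \<bar>M - u y\<bar> * r powr (1 - s)\<bar>)"
    proof (cases "x = y")
      case True
      then show ?thesis using C G_nonneg by (simp add: Ds_def)
    next
      case False
      then have r: "0 < r" by (simp add: r_def)
      have eN: "\<bar>eta x ^ N - eta y ^ N\<bar> \<le> real N * (l * r)"
      proof -
        have aux: "b ^ N - a ^ N \<le> real N * (l * r)" if "0 \<le> a" "a \<le> b" "b \<le> 1" "b - a \<le> l * r" for a b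
        proof -
          have "b ^ N - a ^ N \<le> real N * b ^ (N - 1) * (b - a)" using that by (intro power_diff_le)
          also have "\<dots> \<le> real N * 1 * (l * r)"
            using that by (intro mult_mono) (auto simp: power_le_one)
          finally show ?thesis by simp
        qed
        show ?thesis
        proof (cases "eta x \<le> eta y")
          case True
          then have "eta x ^ N \<le> eta y ^ N" using eta by (intro power_mono)
          then show ?thesis using aux[of "eta x" "eta y"] True eta lip[of x y] by (simp add: r_def)
        next
          case False
          then have "eta y ^ N \<le> eta x ^ N" using eta by (intro power_mono) auto
          then show ?thesis using aux[of "eta y" "eta x"] False eta lip[of x y] by (simp add: r_def)
        qed
      qed
      have "?v x - ?v y = (u y - u x) * eta x ^ N + (M - u y) * (eta x ^ N - eta y ^ N)"
        by (simp add: algebra_simps)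
      also have "\<bar>\<dots>\<bar> \<le> \<bar>u y - u x\<bar> * eta x ^ N + \<bar>M - u y\<bar> * \<bar>eta x ^ N - eta y ^ N\<bar>"
        using eta by (intro order_trans[OF abs_triangle_ineq]) (simp add: abs_mult)
      also have "\<dots> \<le> \<bar>u x - u y\<bar> * 1 + \<bar>M - u y\<bar> * (real N * (l * r))"
        using eta eN by (intro add_mono mult_mono) (auto simp: power_le_one)
      finally have "\<bar>?v x - ?v y\<bar> / r powr s \<le> (\<bar>u x - u y\<bar> * 1 + \<bar>M - u y\<bar> * (real N * (l * r))) / r powr s"
        by (intro divide_right_mono) auto
      also have "\<dots> = \<bar>Ds s u x y\<bar> + \<bar>(real N * l) * \<bar>M - u y\<bar> * r powr (1 - s)\<bar>"
        using r l by (simp add: Ds_def r_def add_divide_distrib powr_diff abs_mult)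
      finally have "\<bar>Ds s ?v x y\<bar> \<le> \<bar>Ds s u x y\<bar> + \<bar>(real N * l) * \<bar>M - u y\<bar> * r powr (1 - s)\<bar>"
        by (simp add: Ds_def r_def)
      then have "G \<bar>Ds s ?v x y\<bar> \<le> G (\<bar>Ds s u x y\<bar> + \<bar>(real N * l) * \<bar>M - u y\<bar> * r powr (1 - s)\<bar>)"
        by (intro G_mono) auto
      also have "\<dots> \<le> C * (G \<bar>Ds s u x y\<bar> + G \<bar>(real N * l) * \<bar>M - u y\<bar> * r powr (1 - s)\<bar>)"
        unfolding C_def by (intro G_add) auto
      finally show ?thesis .
    qed
    then have "G \<bar>Ds s ?v x y\<bar> / r ^ n
        \<le> C * (G \<bar>Ds s u x y\<bar> + G \<bar>(real N * l) * \<bar>M - u y\<bar> * r powr (1 - s)\<bar>) / r ^ n"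
      by (intro divide_right_mono) (auto simp: r_def)
    also have "\<dots> = C * (G \<bar>Ds s u x y\<bar> / r ^ n + G \<bar>(real N * l) * \<bar>M - u y\<bar> * r powr (1 - s)\<bar> / r ^ n)"
      by (simp add: add_divide_distrib distrib_left)
    finally have "ennreal (G \<bar>Ds s ?v x y\<bar> / r ^ n)
      \<le> ennreal (C * (G \<bar>Ds s u x y\<bar> / r ^ n + G \<bar>(real N * l) * \<bar>M - u y\<bar> * r powr (1 - s)\<bar> / r ^ n))"
      by (rule ennreal_leI)
    also have "\<dots> = ennreal C * (ennreal (G \<bar>Ds s u x y\<bar> / r ^ n) + ennreal (G \<bar>(real N * l) * \<bar>M - u y\<bar> * r powr (1 - s)\<bar> / r ^ n))"
      using C G_nonneg by (simp add: ennreal_mult ennreal_plus r_def)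
    finally show "indicator (D \<times> D) z * ennreal (G \<bar>Ds s ?v (fst z) (snd z)\<bar> / ?r z ^ DIM('a)) \<le> ennreal C * (?F z + ?H z)"
      by (auto simp: indicator_def xy r_def n_def)
  qed
  also have "\<dots> = ennreal C * (integral\<^sup>N leb2 ?F + integral\<^sup>N leb2 ?H)"
    using Fm Hm by (simp add: nn_integral_cmult nn_integral_add)
  also have "\<dots> < \<infinity>"
    using u(2) H by (simp add: energy_def n_def ennreal_mult_less_top)
  finally show ?thesis .
qed

end

context form_setting
begin

lemma supersolution_form:
  assumes "supersolution s G g k Om u" "test_fun Om phi" "\<And>x. 0 \<le> phi x"
  shows "integrable leb2 (form u phi)" "0 \<le> integral\<^sup>L leb2 (form u phi)"
  using assms unfolding supersolution_def Let_def form_def[abs_def] by auto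

text \<open>The mollifications of \<open>v\<close> are genuine test functions, since their supports
  stay in the compact set \<open>S\<close>; the inequality for them passes to the limit with
  \<open>u\<close> fixed.\<close>

lemma supersolution_test:
  assumes sup: "supersolution s G g k Om u" and uh: "AE x in lebesgue. \<bar>u x\<bar> \<le> h x"
    and v: "integrable lebesgue v" and v0: "AE x in lebesgue. 0 \<le> v x"
    and S: "compact S" "S \<subseteq> Om" and e: "0 < e"
    and vS: "\<And>x y. v y \<noteq> 0 \<Longrightarrow> norm (x - y) \<le> e \<Longrightarrow> x \<in> S"
    and D: "D \<in> sets borel" "D' \<in> sets borel" and DD: "\<And>x z. x \<in> D \<Longrightarrow> norm z \<le> e \<Longrightarrow> x - z \<in> D'"
    and fin: "energy s D' v < \<infinity>" "energy s D u < \<infinity>" "(\<integral>\<^sup>+ x. ennreal (G \<bar>v x\<bar>) \<partial>lebesgue) < \<infinity>"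
  shows "integrable leb2 (form u v) \<and> 0 \<le> integral\<^sup>L leb2 (form u v)"
proof -
  have u [measurable]: "u \<in> borel_measurable lebesgue"
    using sup by (simp add: supersolution_def W_sG_loc_def)
  have vS': "x \<in> S" if "v x \<noteq> 0" for x using vS[of x x] that e by simp
  obtain R where "\<And>x. x \<in> S \<Longrightarrow> norm x \<le> R"
    using compact_imp_bounded[OF S(1)] by (auto simp: bounded_iff)
  then have R: "v x = 0" if "R < norm x" for x using vS'[of x] that by force
  obtain V where "(\<forall>m k. Ck k (V m)) \<and> (\<forall>m x. 0 \<le> V m x) \<and>
    (\<forall>m x. V m x \<noteq> 0 \<longrightarrow> (\<exists>y. v y \<noteq> 0 \<and> norm (x - y) \<le> e)) \<and>
    (AE x in lebesgue. (\<lambda>m. V m x) \<longlonglongrightarrow> v x) \<and>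
    (\<forall>m. (\<integral>\<^sup>+ x. ennreal (G \<bar>V m x\<bar>) \<partial>lebesgue) \<le> (\<integral>\<^sup>+ x. ennreal (G \<bar>v x\<bar>) \<partial>lebesgue)) \<and>
    (\<forall>m. energy s D (V m) \<le> energy s D' v)"
    by (rule exE[OF mollification[where v=v and R=R and e=e and s=s and D=D and D'=D']])
      (rule v v0 e D | rule R, assumption | rule DD, assumption, assumption | erule that)+
  then have V: "\<And>m k. Ck k (V m)" "\<And>m x. 0 \<le> V m x"
      "\<And>m x. V m x \<noteq> 0 \<Longrightarrow> \<exists>y. v y \<noteq> 0 \<and> norm (x - y) \<le> e"
      "AE x in lebesgue. (\<lambda>m. V m x) \<longlonglongrightarrow> v x"
      "\<And>m. (\<integral>\<^sup>+ x. ennreal (G \<bar>V m x\<bar>) \<partial>lebesgue) \<le> (\<integral>\<^sup>+ x. ennreal (G \<bar>v x\<bar>) \<partial>lebesgue)"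
      "\<And>m. energy s D (V m) \<le> energy s D' v"
    by blast+
  have VS: "V m x = 0" if "x \<notin> S" for m x using V(3)[of m x] vS that by blast
  have tf: "test_fun Om (V m)" for m
  proof -
    have sub: "closure {x. V m x \<noteq> 0} \<subseteq> S"
      using VS S(1) by (intro closure_minimal compact_imp_closed) auto
    moreover have "compact (closure {x. V m x \<noteq> 0})"
      using compact_Int_closed[OF S(1) closed_closure, of "{x. V m x \<noteq> 0}"] sub by (simp add: Int_absorb1)
    ultimately show ?thesis unfolding test_fun_def using V(1) S(2) by auto
  qed
  have Vm: "V m \<in> borel_measurable lebesgue" for m
    using V(1)[of 0 m] by (intro measurable_completion) (auto intro: borel_measurable_continuous_onI)
  define B where "B = max (energy s D u) (max (energy s D' v) (\<integral>\<^sup>+ x. ennreal (G \<bar>v x\<bar>) \<partial>lebesgue))"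
  have B: "B < \<infinity>" using fin by (simp add: B_def)
  have VB: "(\<integral>\<^sup>+ x. indicator S x * ennreal (G \<bar>V m x\<bar>) \<partial>lebesgue) \<le> B" for m
  proof -
    have "(\<integral>\<^sup>+ x. indicator S x * ennreal (G \<bar>V m x\<bar>) \<partial>lebesgue) \<le> (\<integral>\<^sup>+ x. ennreal (G \<bar>V m x\<bar>) \<partial>lebesgue)"
      by (intro nn_integral_mono) (auto simp: indicator_def)
    also have "\<dots> \<le> (\<integral>\<^sup>+ x. ennreal (G \<bar>v x\<bar>) \<partial>lebesgue)" by (rule V(5))
    finally show ?thesis by (auto simp: B_def max_def)
  qed
  have VB': "energy s D (V m) \<le> B" for m
    using V(6)[of m] by (auto simp: B_def le_max_iff_disj)
  have uB: "energy s D u \<le> B" by (simp add: B_def)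
  have vm: "v \<in> borel_measurable lebesgue" using v by auto
  have ul: "AE x in lebesgue. (\<lambda>m::nat. u x) \<longlonglongrightarrow> u x" by simp
  have eq: "(\<forall>m. V m = v) \<or> (\<forall>m::nat. u = u)" by simp
  have lim: "integrable leb2 (form u v)" "(\<lambda>m. integral\<^sup>L leb2 (form u (V m))) \<longlonglongrightarrow> integral\<^sup>L leb2 (form u v)"
    by (rule form_tendsto[where U="\<lambda>_. u" and U'=u and V=V and V'=v and B=B];
      (rule u Vm vm ul V(4) uh B uB VB' VB eq | rule VS, assumption))+
  have "0 \<le> integral\<^sup>L leb2 (form u v)"
    using supersolution_form(2)[OF sup tf V(2)] by (intro LIMSEQ_le_const[OF lim(2)]) auto
  then show ?thesis using lim(1) by simp
qed

end

subsection \<open>Monotone limits of supersolutions\<close>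

locale monotone_limit = growth G g p q for G g :: "real \<Rightarrow> real" and p q :: real +
  fixes s L :: real and k :: "'a::euclidean_space \<Rightarrow> 'a \<Rightarrow> real" and Om :: "'a set"
    and h1 h2 u :: "'a \<Rightarrow> real" and uj :: "nat \<Rightarrow> 'a \<Rightarrow> real"
  assumes s: "0 < s" "s < 1" and k: "kernel_ok L k" and Om: "open Om"
    and h1: "tail_space s g h1" and h2: "tail_space s g h2"
    and incr: "\<And>j. AE x in lebesgue. uj j x \<le> uj (Suc j) x"
    and super: "\<And>j. supersolution s G g k Om (uj j)"
    and bounds: "\<And>j. AE x in lebesgue. h1 x \<le> uj j x \<and> uj j x \<le> h2 x"
    and locbdd: "\<And>D. open D \<Longrightarrow> compactly_contained D Om \<Longrightarrow>
                   \<exists>M. \<forall>j. AE x in lebesgue. x \<in> D \<longrightarrow> uj j x \<le> M"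
    and conv: "AE x in lebesgue. (\<lambda>j. uj j x) \<longlonglongrightarrow> u x"
begin

lemma uj_meas [measurable]: "uj j \<in> borel_measurable lebesgue"
  using super[of j] by (simp add: supersolution_def W_sG_loc_def)

text \<open>\<open>u\<close> is known only as an almost everywhere limit, and nothing is assumed
  about it elsewhere; completeness of Lebesgue measure makes this enough.\<close>

lemma u_meas [measurable]: "u \<in> borel_measurable lebesgue"
proof (rule borel_measurable_lebesgue_AE)
  show "(\<lambda>x. lim (\<lambda>j. uj j x)) \<in> borel_measurable lebesgue" by measurable
  show "AE x in lebesgue. u x = lim (\<lambda>j. uj j x)"
    using conv by eventually_elim (simp add: limI)
qed

lemma uj_ge_uj0: "AE x in lebesgue. uj 0 x \<le> uj j x"
proof (induction j)
  case (Suc j)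
  show ?case using Suc.IH incr[of j] by eventually_elim simp
qed simp

lemma uj_energy: "open D \<Longrightarrow> compactly_contained D Om \<Longrightarrow> energy s D (uj j) < \<infinity>"
  and uj_G: "open D \<Longrightarrow> compactly_contained D Om \<Longrightarrow>
    (\<integral>\<^sup>+ x. indicator D x * ennreal (G \<bar>uj j x\<bar>) \<partial>lebesgue) < \<infinity>"
  using super[of j] unfolding supersolution_def W_sG_loc_def energy_def by blast+

definition tail :: "('a \<Rightarrow> real) \<Rightarrow> 'a \<Rightarrow> real" where
  "tail f x = g (\<bar>f x\<bar> / (1 + norm x) powr s) * (1 + norm x) powr (- real DIM('a) - s)"

definition decay :: "'a \<Rightarrow> real" where
  "decay x = (1 + norm x) powr (- real DIM('a) - s)"

lemma decay_meas [measurable]: "decay \<in> borel_measurable lebesgue"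
proof -
  have "(\<lambda>x::'a. 1 + norm x) \<in> borel_measurable lebesgue"
    by (intro measurable_completion) simp
  then show ?thesis unfolding decay_def by (intro powr_real_measurable borel_measurable_const)
qed

lemma tail_meas [measurable]:
  assumes "f \<in> borel_measurable lebesgue" shows "tail f \<in> borel_measurable lebesgue"
proof -
  have "(\<lambda>x::'a. 1 + norm x) \<in> borel_measurable lebesgue"
    by (intro measurable_completion) simp
  then have "(\<lambda>x. \<bar>f x\<bar> / (1 + norm x) powr s) \<in> borel_measurable lebesgue"
    using assms by (intro borel_measurable_divide borel_measurable_abs powr_real_measurable borel_measurable_const)
  from measurable_g_abs[OF this] show ?thesis
    unfolding tail_def using decay_meas by (auto intro!: borel_measurable_times simp: decay_def[abs_def])
qed

lemma tail_int: "tail_space s g f \<Longrightarrow> (\<integral>\<^sup>+ x. ennreal (tail f x) \<partial>lebesgue) < \<infinity>"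
  by (simp add: tail_space_def tail_def)

lemma decay_int: "(\<integral>\<^sup>+ x. ennreal (decay x) \<partial>lebesgue) < \<infinity>"
  using nn_integral_decay_powr[OF s(1), where 'a='a] by (simp add: decay_def nn_integral_completion)

text \<open>One majorant for all \<open>uj j\<close>: the local upper bound and \<open>uj 0\<close> control it on \<open>D\<close>, the
  barriers control its tail.\<close>
lemma majorant:
  assumes D: "open D" "compactly_contained D Om"
  shows "\<exists>h M. (\<forall>x. 1 \<le> h x) \<and> (\<forall>x. \<bar>M\<bar> \<le> h x) \<and> h \<in> borel_measurable lebesgue \<and>
    (\<forall>j. AE x in lebesgue. \<bar>uj j x\<bar> \<le> h x) \<and> (\<forall>j. AE x in lebesgue. x \<in> D \<longrightarrow> uj j x \<le> M) \<and>
    (\<integral>\<^sup>+ x. indicator D x * ennreal (G \<bar>h x\<bar>) \<partial>lebesgue) < \<infinity> \<and>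
    (\<integral>\<^sup>+ x. indicator (- D) x * ennreal ((1 + g \<bar>h x / (1 + norm x) powr s\<bar>)
        * (1 + norm x) powr (- real DIM('a) - s)) \<partial>lebesgue) < \<infinity>"
proof -
  have Dm [measurable]: "D \<in> sets lebesgue" using D(1) by (simp add: sets_completionI_sets)
  obtain R where R: "D \<subseteq> cball 0 R" using compactly_contained_bounded[OF D(2)] by auto
  have [measurable]: "h1 \<in> borel_measurable lebesgue" "h2 \<in> borel_measurable lebesgue"
    using h1 h2 by (auto simp: tail_space_def)
  obtain M where M: "\<And>j. AE x in lebesgue. x \<in> D \<longrightarrow> uj j x \<le> M" using locbdd[OF D] by auto
  define m where "m = 1 + \<bar>M\<bar>"
  \<comment> \<open>Inside \<open>D\<close>, \<open>uj 0 \<le> uj j \<le> M\<close> bounds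
    \<open>\<bar>uj j\<bar>\<close> by \<open>\<bar>M\<bar> + \<bar>uj 0\<bar>\<close>, and
    \<open>uj 0\<close> has a finite \<open>G\<close>-integral there. Outside \<open>D\<close> only
    the tail matters, and the barriers provide it.\<close>
  define h where "h x = (if x \<in> D then m + \<bar>uj 0 x\<bar> else m + (\<bar>h1 x\<bar> + \<bar>h2 x\<bar>))" for x
  have m: "1 \<le> m" "\<bar>M\<bar> \<le> m" by (auto simp: m_def)
  have h_m: "m \<le> h x" for x by (simp add: h_def)
  have hmeas: "h \<in> borel_measurable lebesgue" unfolding h_def by measurable
  have h_bd: "AE x in lebesgue. \<bar>uj j x\<bar> \<le> h x" for j
    using bounds[of j] uj_ge_uj0[of j] M[of j]
    by eventually_elim (auto simp: h_def m_def abs_if)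
  have hG: "(\<integral>\<^sup>+ x. indicator D x * ennreal (G \<bar>h x\<bar>) \<partial>lebesgue) < \<infinity>"
  proof -
    define C where "C = q * 2 powr q"
    have C: "0 \<le> C" using q_gt_1 by (simp add: C_def)
    have "(\<integral>\<^sup>+ x. indicator D x * ennreal (G \<bar>h x\<bar>) \<partial>lebesgue)
      \<le> (\<integral>\<^sup>+ x. ennreal C * (indicator D x * ennreal (G m) + indicator D x * ennreal (G \<bar>uj 0 x\<bar>)) \<partial>lebesgue)"
    proof (rule nn_integral_mono)
      fix x
      show "indicator D x * ennreal (G \<bar>h x\<bar>)
        \<le> ennreal C * (indicator D x * ennreal (G m) + indicator D x * ennreal (G \<bar>uj 0 x\<bar>))"
      proof (cases "x \<in> D")
        case True
        have "G \<bar>h x\<bar> \<le> C * (G m + G \<bar>uj 0 x\<bar>)"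
          using True m G_add[of m "\<bar>uj 0 x\<bar>"] by (simp add: h_def C_def)
        then have "ennreal (G \<bar>h x\<bar>) \<le> ennreal (C * (G m + G \<bar>uj 0 x\<bar>))" by (rule ennreal_leI)
        then show ?thesis using True C m by (simp add: ennreal_mult G_nonneg)
      qed simp
    qed
    also have "\<dots> = ennreal C * ((\<integral>\<^sup>+ x. indicator D x * ennreal (G m) \<partial>lebesgue)
        + (\<integral>\<^sup>+ x. indicator D x * ennreal (G \<bar>uj 0 x\<bar>) \<partial>lebesgue))"
      by (subst nn_integral_cmult, measurable, subst nn_integral_add, measurable)
    also have "\<dots> < \<infinity>"
      using nn_integral_bounded_const[OF Dm R, of "G m"] uj_G[OF D, of 0] by (simp add: ennreal_mult_less_top)
    finally show ?thesis .
  qed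
  have hT: "(\<integral>\<^sup>+ x. indicator (- D) x * ennreal ((1 + g \<bar>h x / (1 + norm x) powr s\<bar>)
        * (1 + norm x) powr (- real DIM('a) - s)) \<partial>lebesgue) < \<infinity>"
  proof -
    define B where "B = 2 powr (q - 1)"
    have B: "0 \<le> B" by (simp add: B_def)
    \<comment> \<open>The sum inside \<open>g\<close> is split twice, once to separate the constant
      \<open>m\<close> and once to separate the two barriers; hence \<open>B\<close> for the
      constant and \<open>B * B\<close> for the barriers.\<close>
    define C where "C = 1 + B * g m"
    have C: "0 \<le> C" using B m g_nonneg[of m] by (simp add: C_def)
    have "(\<integral>\<^sup>+ x. indicator (- D) x * ennreal ((1 + g \<bar>h x / (1 + norm x) powr s\<bar>)
        * (1 + norm x) powr (- real DIM('a) - s)) \<partial>lebesgue)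
      \<le> (\<integral>\<^sup>+ x. ennreal C * ennreal (decay x) + ennreal (B * B) * (ennreal (tail h1 x) + ennreal (tail h2 x)) \<partial>lebesgue)"
    proof (rule nn_integral_mono)
      fix x
      show "indicator (- D) x * ennreal ((1 + g \<bar>h x / (1 + norm x) powr s\<bar>) * (1 + norm x) powr (- real DIM('a) - s))
        \<le> ennreal C * ennreal (decay x) + ennreal (B * B) * (ennreal (tail h1 x) + ennreal (tail h2 x))"
      proof (cases "x \<in> D")
        case False
        define t where "t = (1 + norm x) powr s"
        have t: "1 \<le> t" unfolding t_def using s by (intro ge_one_powr_ge_zero) auto
        let ?a = "\<bar>h1 x\<bar> / t" and ?b = "\<bar>h2 x\<bar> / t"
        have d: "0 \<le> decay x" by (simp add: decay_def)
        have ab: "0 \<le> ?a" "0 \<le> ?b" using t by auto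
        have "\<bar>h x / t\<bar> = m / t + (?a + ?b)"
          using False t m by (simp add: h_def add_divide_distrib)
        also have "\<dots> \<le> m + (?a + ?b)"
          using t m by (simp add: divide_le_eq mult_le_cancel_left1)
        finally have "g \<bar>h x / t\<bar> \<le> g (m + (?a + ?b))" by (intro g_mono) auto
        also have "\<dots> \<le> B * (g m + g (?a + ?b))"
          unfolding B_def using m ab by (intro g_add add_nonneg_nonneg) auto
        also have "\<dots> \<le> B * (g m + B * (g ?a + g ?b))"
          unfolding B_def using ab by (intro mult_left_mono add_left_mono g_add) auto
        finally have "1 + g \<bar>h x / t\<bar> \<le> C + B * B * (g ?a + g ?b)" by (simp add: C_def algebra_simps)
        then have "(1 + g \<bar>h x / t\<bar>) * decay x \<le> (C + B * B * (g ?a + g ?b)) * decay x"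
          using d by (rule mult_right_mono)
        also have "\<dots> = C * decay x + (B * B) * (tail h1 x + tail h2 x)"
          by (simp add: tail_def decay_def t_def algebra_simps)
        finally have "ennreal ((1 + g \<bar>h x / t\<bar>) * decay x) \<le> ennreal (C * decay x + (B * B) * (tail h1 x + tail h2 x))"
          by (rule ennreal_leI)
        also have "\<dots> = ennreal C * ennreal (decay x) + ennreal (B * B) * (ennreal (tail h1 x) + ennreal (tail h2 x))"
        proof -
          have "0 \<le> tail h1 x" "0 \<le> tail h2 x" using ab g_nonneg by (auto simp: tail_def t_def)
          then show ?thesis using B C d by (simp add: ennreal_mult)
        qed
        finally show ?thesis using False by (simp add: t_def decay_def)
      qed simp
    qed
    also have "\<dots> = ennreal C * (\<integral>\<^sup>+ x. ennreal (decay x) \<partial>lebesgue)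
        + ennreal (B * B) * ((\<integral>\<^sup>+ x. ennreal (tail h1 x) \<partial>lebesgue) + (\<integral>\<^sup>+ x. ennreal (tail h2 x) \<partial>lebesgue))"
      by (simp add: nn_integral_add nn_integral_cmult)
    also have "\<dots> < \<infinity>"
      using decay_int tail_int[OF h1] tail_int[OF h2] by (simp add: ennreal_mult_less_top)
    finally show ?thesis .
  qed
  show ?thesis
    using m order_trans[OF _ h_m] hmeas h_bd M hG hT by (intro exI[of _ h] exI[of _ M]) blast
qed

lemma form_setting_exists:
  assumes D: "open D" "compactly_contained D Om" and S: "compact S" "S \<subseteq> D"
    and r: "0 < r" "\<forall>x\<in>S. \<forall>y. y \<notin> D \<longrightarrow> r \<le> norm (x - y)"
  shows "\<exists>h M c. form_setting G g p q s L c k S D h \<and> (\<forall>x. \<bar>M\<bar> \<le> h x) \<and>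
    (\<forall>j. AE x in lebesgue. \<bar>uj j x\<bar> \<le> h x) \<and> (\<forall>j. AE x in lebesgue. x \<in> D \<longrightarrow> uj j x \<le> M)"
proof -
  from majorant[OF D] obtain h M where h: "\<And>x. 1 \<le> h x" "\<And>x. \<bar>M\<bar> \<le> h x" "h \<in> borel_measurable lebesgue"
    "\<And>j. AE x in lebesgue. \<bar>uj j x\<bar> \<le> h x" "\<And>j. AE x in lebesgue. x \<in> D \<longrightarrow> uj j x \<le> M"
    "(\<integral>\<^sup>+ x. indicator D x * ennreal (G \<bar>h x\<bar>) \<partial>lebesgue) < \<infinity>"
    "(\<integral>\<^sup>+ x. indicator (- D) x * ennreal ((1 + g \<bar>h x / (1 + norm x) powr s\<bar>)
        * (1 + norm x) powr (- real DIM('a) - s)) \<partial>lebesgue) < \<infinity>"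
    by (elim exE conjE) blast
  obtain c where c: "0 < c" "c \<le> 1" "\<And>x y. x \<in> S \<Longrightarrow> y \<notin> D \<Longrightarrow> c * (1 + norm y) \<le> norm (x - y)"
    using uniform_separation[OF compact_imp_bounded[OF S(1)] r] by auto
  have "S \<in> sets lebesgue" "D \<in> sets lebesgue"
    using D(1) S(1) by (auto intro!: sets_completionI_sets simp: borel_compact)
  then have "form_setting G g p q s L c k S D h"
    using s k S c h by unfold_locales auto
  then show ?thesis using h by (intro exI[of _ h] exI[of _ M] exI[of _ c]) blast
qed

lemma uniform_energy:
  assumes D: "open D" "compactly_contained D Om"
  shows "\<exists>Z<\<infinity>. \<forall>j. energy s D (uj j) \<le> Z"
proof (cases "D = {}")
  \<comment> \<open>The empty set is treated apart: the neighbourhoods below are sublevel sets of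
    \<open>infdist\<close>, which is zero everywhere when the set is empty.\<close>
  case True
  then show ?thesis by (intro exI[of _ 0]) (auto simp: energy_def)
next
  case False
  define K where "K = closure D"
  have K: "compact K" "K \<noteq> {}" "K \<subseteq> Om" using D False by (auto simp: K_def compactly_contained_def)
  obtain r where r: "0 < r" and rc: "\<And>t. 0 < t \<Longrightarrow> t \<le> 4 * r \<Longrightarrow> compact {x. infdist x K \<le> t}"
      "\<And>t. 0 < t \<Longrightarrow> t \<le> 4 * r \<Longrightarrow> {x. infdist x K \<le> t} \<subseteq> Om"
    using compact_neighbourhood[OF K(1,2) Om K(3)] by auto
  have idist: "\<bar>infdist x K - infdist y K\<bar> \<le> norm (x - y)" for x y
    using infdist_triangle_abs[of x K y] by (simp add: dist_norm)
  \<comment> \<open>The cutoff lives within distance \<open>r\<close> of \<open>K\<close>. One more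
    \<open>r\<close> makes room for the mollified test functions in \<open>S\<close>, the next
    separates \<open>S\<close> from the complement of \<open>D1\<close>, and the last turns shifts
    of \<open>D1\<close> into subsets of \<open>D2\<close>.\<close>
  define S where "S = {x. infdist x K \<le> 2 * r}"
  define D1 where "D1 = {x. infdist x K < 3 * r}"
  define D2 where "D2 = {x. infdist x K < 4 * r}"
  have S: "compact S" "S \<subseteq> Om" using rc r by (auto simp: S_def)
  have D1: "open D1" "compactly_contained D1 Om"
    unfolding D1_def using rc[of "3 * r"] r by (auto intro!: infdist_sublevel)
  have D2: "open D2" "compactly_contained D2 Om"
    unfolding D2_def using rc[of "4 * r"] r by (auto intro!: infdist_sublevel)
  have sep: "\<forall>x\<in>S. \<forall>y. y \<notin> D1 \<longrightarrow> r \<le> norm (x - y)"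
  proof (intro ballI allI impI)
    fix x y assume "x \<in> S" "y \<notin> D1"
    then show "r \<le> norm (x - y)" using idist[of x y] by (auto simp: S_def D1_def)
  qed
  have SD1: "S \<subseteq> D1" using r by (auto simp: S_def D1_def)
  obtain R1 where R1: "D1 \<subseteq> cball 0 R1" using compactly_contained_bounded[OF D1(2)] by auto
  obtain R2 where R2: "D2 \<subseteq> cball 0 R2" using compactly_contained_bounded[OF D2(2)] by auto
  obtain h M c where fs: "form_setting G g p q s L c k S D1 h" and Mh: "\<And>x. \<bar>M\<bar> \<le> h x"
    and ujh: "\<And>j. AE x in lebesgue. \<bar>uj j x\<bar> \<le> h x" and ujM: "\<And>j. AE x in lebesgue. x \<in> D1 \<longrightarrow> uj j x \<le> M"
    using form_setting_exists[OF D1 S(1) SD1 r sep] by (elim exE conjE) blast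
  interpret fs: form_setting G g p q s L c k S D1 h by (rule fs)
  define eta where "eta x = max 0 (1 - infdist x K / r)" for x
  have eta: "0 \<le> eta x" "eta x \<le> 1" for x using r infdist_nonneg[of x K] by (auto simp: eta_def)
  have eta0: "infdist x K < r" if "eta x \<noteq> 0" for x
    using that r by (auto simp: eta_def max_def field_simps split: if_splits)
  have etaS: "eta x = 0" if "x \<notin> S" for x using eta0[of x] that r by (auto simp: S_def)
  have lip: "\<bar>eta x - eta y\<bar> \<le> 1 / r * norm (x - y)" for x y
  proof -
    have "\<bar>eta x - eta y\<bar> \<le> \<bar>infdist x K / r - infdist y K / r\<bar>" by (auto simp: eta_def)
    also have "\<dots> = \<bar>infdist x K - infdist y K\<bar> / r" using r by (simp add: diff_divide_distrib[symmetric])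
    also have "\<dots> \<le> norm (x - y) / r" using r idist by (intro divide_right_mono) auto
    finally show ?thesis by simp
  qed
  have l: "0 \<le> 1 / r" using r by simp
  define N where "N = nat \<lceil>q\<rceil>"
  have N: "q \<le> real N" unfolding N_def by (rule real_nat_ceiling_ge)
  have N0: "N \<noteq> 0" using N q_gt_1 by auto
  from fs.caccioppoli[OF s(2) N R1 eta etaS lip l] obtain Z where Z: "Z < \<infinity>"
    "\<And>u M. u \<in> borel_measurable lebesgue \<Longrightarrow> AE x in lebesgue. \<bar>u x\<bar> \<le> h x \<Longrightarrow>
      AE x in lebesgue. x \<in> D1 \<longrightarrow> u x \<le> M \<Longrightarrow> \<forall>x. \<bar>M\<bar> \<le> h x \<Longrightarrow>
      integrable leb2 (fs.form u (\<lambda>x. (M - u x) * eta x ^ N)) \<Longrightarrow>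
      0 \<le> integral\<^sup>L leb2 (fs.form u (\<lambda>x. (M - u x) * eta x ^ N)) \<Longrightarrow>
      energy s {x. eta x = 1} u \<le> Z"
    by blast
  have "energy s D (uj j) \<le> Z" for j
  proof -
    define v where "v = (\<lambda>x. (M - uj j x) * eta x ^ N)"
    have eta_meas: "eta \<in> borel_measurable lebesgue"
      unfolding eta_def using r
      by (intro measurable_completion) (auto intro!: borel_measurable_continuous_onI continuous_intros)
    have vm [measurable]: "v \<in> borel_measurable lebesgue"
      unfolding v_def using eta_meas by measurable
    have vS: "v x = 0" if "x \<notin> S" for x using etaS[OF that] N0 by (simp add: v_def)
    have v_le: "AE x in lebesgue. \<bar>v x\<bar> \<le> indicator D1 x * (2 * h x)"
      using ujh[of j]
    proof eventually_elim
      fix x assume x: "\<bar>uj j x\<bar> \<le> h x"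
      show "\<bar>v x\<bar> \<le> indicator D1 x * (2 * h x)"
      proof (cases "x \<in> D1")
        case True
        have "\<bar>v x\<bar> \<le> (2 * h x) * 1"
          unfolding v_def abs_mult using x Mh[of x] eta[of x]
          by (intro mult_mono) (auto simp: power_le_one)
        then show ?thesis using True by simp
      next
        case False
        then show ?thesis using vS[of x] SD1 by auto
      qed
    qed
    obtain C where C: "0 < C" "\<And>t. 0 \<le> t \<Longrightarrow> G (2 * t) \<le> C * G t" using G_scale_ex[of 2] by auto
    have vG: "(\<integral>\<^sup>+ x. ennreal (G \<bar>v x\<bar>) \<partial>lebesgue) < \<infinity>"
    proof -
      have "(\<integral>\<^sup>+ x. ennreal (G \<bar>v x\<bar>) \<partial>lebesgue) \<le> (\<integral>\<^sup>+ x. ennreal C * (indicator D1 x * ennreal (G \<bar>h x\<bar>)) \<partial>lebesgue)"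
      proof (intro nn_integral_mono_AE, use v_le in eventually_elim)
        fix x assume x: "\<bar>v x\<bar> \<le> indicator D1 x * (2 * h x)"
        show "ennreal (G \<bar>v x\<bar>) \<le> ennreal C * (indicator D1 x * ennreal (G \<bar>h x\<bar>))"
        proof (cases "x \<in> D1")
          case True
          have "G \<bar>v x\<bar> \<le> G (2 * h x)" using x True by (intro G_mono) auto
          also have "\<dots> \<le> C * G \<bar>h x\<bar>" using C(2)[of "h x"] fs.h_nonneg by simp
          finally have "ennreal (G \<bar>v x\<bar>) \<le> ennreal (C * G \<bar>h x\<bar>)" by (rule ennreal_leI)
          then show ?thesis using True C(1) by (simp add: ennreal_mult G_nonneg)
        next
          case False
          then show ?thesis using x by simp
        qed
      qed
      also have "\<dots> = ennreal C * (\<integral>\<^sup>+ x. indicator D1 x * ennreal (G \<bar>h x\<bar>) \<partial>lebesgue)"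
        by (rule nn_integral_cmult) (intro borel_measurable_times_ennreal borel_measurable_indicator fs.D_meas
          measurable_compose[OF _ measurable_ennreal] measurable_G_abs fs.h_meas)
      also have "\<dots> < \<infinity>" using fs.h_G by (simp add: ennreal_mult_less_top)
      finally show ?thesis .
    qed
    have vint: "integrable lebesgue v"
    proof -
      have "(\<integral>\<^sup>+ x. ennreal (norm (v x)) \<partial>lebesgue) \<le> (\<integral>\<^sup>+ x. indicator S x * ennreal 1 + ennreal (G \<bar>v x\<bar>) \<partial>lebesgue)"
      proof (rule nn_integral_mono)
        fix x
        show "ennreal (norm (v x)) \<le> indicator S x * ennreal 1 + ennreal (G \<bar>v x\<bar>)"
        proof (cases "x \<in> S")
          case True
          have "ennreal \<bar>v x\<bar> \<le> ennreal (1 + G \<bar>v x\<bar>)" using le_one_plus_G[of "\<bar>v x\<bar>"] by (intro ennreal_leI) simp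
          then show ?thesis using True by (simp add: G_nonneg ennreal_plus)
        qed (simp add: vS)
      qed
      also have "\<dots> = (\<integral>\<^sup>+ x. indicator S x * ennreal 1 \<partial>lebesgue) + (\<integral>\<^sup>+ x. ennreal (G \<bar>v x\<bar>) \<partial>lebesgue)"
        by (intro nn_integral_add borel_measurable_times_ennreal borel_measurable_indicator fs.S_meas borel_measurable_const
          measurable_compose[OF _ measurable_ennreal] measurable_G_abs vm)
      also have "\<dots> < \<infinity>"
        using vG nn_integral_bounded_const[OF fs.S_meas order_trans[OF SD1 R1], of 1] by simp
      finally show ?thesis using vm by (simp add: integrable_iff_bounded)
    qed
    have v0: "AE x in lebesgue. 0 \<le> v x"
      using ujM[of j]
    proof eventually_elim
      fix x assume "x \<in> D1 \<longrightarrow> uj j x \<le> M"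
      then show "0 \<le> v x"
      proof (cases "x \<in> S")
        case True
        then show ?thesis using \<open>x \<in> D1 \<longrightarrow> uj j x \<le> M\<close> SD1 eta(1)[of x] by (auto simp: v_def)
      qed (simp add: vS)
    qed
    have MG: "(\<integral>\<^sup>+ x. indicator D2 x * ennreal (G \<bar>M - uj j x\<bar>) \<partial>lebesgue) < \<infinity>"
    proof -
      have D2m: "D2 \<in> sets lebesgue" using D2(1) by (simp add: sets_completionI_sets)
      define B where "B = q * 2 powr q"
      have B: "0 \<le> B" using q_gt_1 by (simp add: B_def)
      have "(\<integral>\<^sup>+ x. indicator D2 x * ennreal (G \<bar>M - uj j x\<bar>) \<partial>lebesgue)
        \<le> (\<integral>\<^sup>+ x. ennreal B * (indicator D2 x * ennreal (G \<bar>M\<bar>) + indicator D2 x * ennreal (G \<bar>uj j x\<bar>)) \<partial>lebesgue)"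
      proof (rule nn_integral_mono)
        fix x
        have "G \<bar>M - uj j x\<bar> \<le> G (\<bar>M\<bar> + \<bar>uj j x\<bar>)" by (intro G_mono) auto
        also have "\<dots> \<le> B * (G \<bar>M\<bar> + G \<bar>uj j x\<bar>)" unfolding B_def by (intro G_add) auto
        finally have "ennreal (G \<bar>M - uj j x\<bar>) \<le> ennreal (B * (G \<bar>M\<bar> + G \<bar>uj j x\<bar>))" by (rule ennreal_leI)
        then show "indicator D2 x * ennreal (G \<bar>M - uj j x\<bar>)
          \<le> ennreal B * (indicator D2 x * ennreal (G \<bar>M\<bar>) + indicator D2 x * ennreal (G \<bar>uj j x\<bar>))"
          using B by (cases "x \<in> D2") (auto simp: ennreal_mult G_nonneg)
      qed
      also have "\<dots> = ennreal B * ((\<integral>\<^sup>+ x. indicator D2 x * ennreal (G \<bar>M\<bar>) \<partial>lebesgue)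
          + (\<integral>\<^sup>+ x. indicator D2 x * ennreal (G \<bar>uj j x\<bar>) \<partial>lebesgue))"
        using D2m by (subst nn_integral_cmult, measurable, subst nn_integral_add, measurable)
      also have "\<dots> < \<infinity>"
        using nn_integral_bounded_const[OF D2m R2, of "G \<bar>M\<bar>"] uj_G[OF D2, of j] by (simp add: ennreal_mult_less_top)
      finally show ?thesis .
    qed
    \<comment> \<open>Finiteness is required on \<open>D2\<close>, because the energy of a
      mollification on \<open>D1\<close> is bounded by that of \<open>v\<close> on the larger
      set.\<close>
    have ven: "energy s D2 v < \<infinity>"
      unfolding v_def using D2(1) R2 uj_energy[OF D2] MG eta lip l s
      by (intro energy_finite_cutoff[where R=R2 and l="1 / r"]) (auto intro: sets_completionI_sets)
    have vS': "x \<in> S" if "v y \<noteq> 0" "norm (x - y) \<le> r" for x y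
    proof -
      have "infdist y K < r" using that(1) eta0[of y] N0 by (auto simp: v_def)
      then show ?thesis using idist[of x y] that(2) by (auto simp: S_def)
    qed
    have D12: "x - z \<in> D2" if "x \<in> D1" "norm z \<le> r" for x z
      using idist[of x "x - z"] that by (auto simp: D1_def D2_def)
    have "integrable leb2 (fs.form (uj j) v) \<and> 0 \<le> integral\<^sup>L leb2 (fs.form (uj j) v)"
      using D1(1) D2(1)
      by (intro fs.supersolution_test[OF super ujh vint v0 S r vS' _ _ D12 ven uj_energy[OF D1] vG]) auto
    then have "energy s {x. eta x = 1} (uj j) \<le> Z"
      unfolding v_def using ujh ujM Mh by (intro Z(2)) auto
    moreover have "D \<subseteq> {x. eta x = 1}"
    proof
      fix x assume "x \<in> D"
      then have "x \<in> K" using closure_subset by (auto simp: K_def)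
      then show "x \<in> {x. eta x = 1}" by (simp add: eta_def)
    qed
    ultimately show ?thesis using energy_mono order_trans by blast
  qed
  then show ?thesis using Z(1) by blast
qed

lemma u_energy:
  assumes D: "open D" "compactly_contained D Om"
  shows "energy s D u < \<infinity>"
proof -
  obtain Z where Z: "Z < \<infinity>" "\<And>j. energy s D (uj j) \<le> Z" using uniform_energy[OF D] by auto
  have Dm: "D \<in> sets lebesgue" using D(1) by (simp add: sets_completionI_sets)
  let ?F = "\<lambda>w z. indicator (D \<times> D) z * ennreal (G \<bar>Ds s w (fst z) (snd z)\<bar> / norm (fst z - snd z) ^ DIM('a))"
  have "?F (uj j) \<in> borel_measurable leb2" for j
    using Dm norm_leb2 by (intro borel_measurable_times_ennreal borel_measurable_indicator
      measurable_compose[OF _ measurable_ennreal] borel_measurable_divide measurable_G_abs Ds_measurable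
      borel_measurable_power pair_measureI uj_meas)
  note Fm = this
  have "energy s D u = (\<integral>\<^sup>+ z. liminf (\<lambda>j. ?F (uj j) z) \<partial>leb2)"
    unfolding energy_def
  proof (intro nn_integral_cong_AE, use AE_leb2_fst[OF conv] AE_leb2_snd[OF conv] in eventually_elim)
    fix z :: "'a \<times> 'a"
    assume l: "(\<lambda>j. uj j (fst z)) \<longlonglongrightarrow> u (fst z)" "(\<lambda>j. uj j (snd z)) \<longlonglongrightarrow> u (snd z)"
    have "(\<lambda>j. Ds s (uj j) (fst z) (snd z)) \<longlonglongrightarrow> Ds s u (fst z) (snd z)"
      unfolding Ds_def divide_inverse by (intro tendsto_intros l)
    then have "(\<lambda>j. G \<bar>Ds s (uj j) (fst z) (snd z)\<bar>) \<longlonglongrightarrow> G \<bar>Ds s u (fst z) (snd z)\<bar>"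
      using continuous_G_abs isCont_tendsto_compose[of _ "\<lambda>t. G \<bar>t\<bar>"]
      by (simp add: continuous_on_eq_continuous_at)
    then have "(\<lambda>j. ennreal (G \<bar>Ds s (uj j) (fst z) (snd z)\<bar> * inverse (norm (fst z - snd z) ^ DIM('a))))
        \<longlonglongrightarrow> ennreal (G \<bar>Ds s u (fst z) (snd z)\<bar> * inverse (norm (fst z - snd z) ^ DIM('a)))"
      by (intro tendsto_intros)
    then have "(\<lambda>j. ?F (uj j) z) \<longlonglongrightarrow> ?F u z"
      by (cases "z \<in> D \<times> D") (simp_all add: divide_inverse)
    then show "?F u z = liminf (\<lambda>j. ?F (uj j) z)" by (simp add: lim_imp_Liminf)
  qed
  also have "\<dots> \<le> liminf (\<lambda>j. energy s D (uj j))"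
    unfolding energy_def by (intro nn_integral_liminf Fm)
  also have "\<dots> \<le> Z" using Z(2) by (intro Liminf_le) (auto intro!: always_eventually)
  finally show ?thesis using Z(1) by (rule le_less_trans)
qed

lemma u_majorized:
  assumes "\<And>j. AE x in lebesgue. \<bar>uj j x\<bar> \<le> h x"
  shows "AE x in lebesgue. \<bar>u x\<bar> \<le> h x"
proof -
  have "AE x in lebesgue. \<forall>j. \<bar>uj j x\<bar> \<le> h x" using assms by (simp add: AE_all_countable)
  then show ?thesis using conv
    by eventually_elim (auto intro!: LIMSEQ_le_const2[OF tendsto_rabs])
qed

lemma u_W: "W_sG_loc s G Om u"
  unfolding W_sG_loc_def
proof (intro conjI allI impI u_meas)
  fix D assume "open D \<and> compactly_contained D Om"
  then have D: "open D" "compactly_contained D Om" by auto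
  show "(\<integral>\<^sup>+ z. indicator (D \<times> D) z *
            ennreal (G \<bar>Ds s u (fst z) (snd z)\<bar> / norm (fst z - snd z) ^ DIM('a)) \<partial>leb2) < \<infinity>"
    using u_energy[OF D] by (simp add: energy_def)
  obtain h where h: "\<And>j. AE x in lebesgue. \<bar>uj j x\<bar> \<le> h x"
    "(\<integral>\<^sup>+ x. indicator D x * ennreal (G \<bar>h x\<bar>) \<partial>lebesgue) < \<infinity>"
    using majorant[OF D] by (elim exE conjE) blast
  have "(\<integral>\<^sup>+ x. indicator D x * ennreal (G \<bar>u x\<bar>) \<partial>lebesgue) \<le> (\<integral>\<^sup>+ x. indicator D x * ennreal (G \<bar>h x\<bar>) \<partial>lebesgue)"
    by (intro nn_integral_mono_AE, use u_majorized[OF h(1)] in eventually_elim)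
      (auto intro!: mult_left_mono ennreal_leI G_mono)
  then show "(\<integral>\<^sup>+ x. indicator D x * ennreal (G \<bar>u x\<bar>) \<partial>lebesgue) < \<infinity>" using h(2) by (rule le_less_trans)
qed

text \<open>The lower barrier passes to the limit, so the negative part of \<open>u\<close> is at
  most \<open>\<bar>h1\<bar>\<close> almost everywhere; monotonicity of \<open>g\<close> transfers
  both conditions of the tail space.\<close>

lemma u_tail: "tail_space s g (\<lambda>x. max (- u x) 0)"
proof -
  let ?w = "\<lambda>x. max (- u x) 0"
  have "AE x in lebesgue. \<forall>j. h1 x \<le> uj j x" using bounds by (simp add: AE_all_countable)
  then have le: "AE x in lebesgue. \<bar>?w x\<bar> \<le> \<bar>h1 x\<bar>" using conv
  proof eventually_elim
    fix x assume "\<forall>j. h1 x \<le> uj j x" "(\<lambda>j. uj j x) \<longlonglongrightarrow> u x"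
    then have "h1 x \<le> u x" by (intro LIMSEQ_le_const) auto
    then show "\<bar>?w x\<bar> \<le> \<bar>h1 x\<bar>" by (auto simp: max_def)
  qed
  have wm: "?w \<in> borel_measurable lebesgue" by measurable
  have "set_integrable lebesgue K (\<lambda>x. g \<bar>?w x\<bar>)" if K: "compact K" for K
  proof -
    have Km: "K \<in> sets lebesgue" using K by (auto intro!: sets_completionI_sets simp: borel_compact)
    have "set_integrable lebesgue K (\<lambda>x. g \<bar>h1 x\<bar>)" using h1 K by (simp add: tail_space_def)
    then show ?thesis
      unfolding set_integrable_def
    proof (rule Bochner_Integration.integrable_bound)
      show "(\<lambda>x. indicat_real K x *\<^sub>R g \<bar>?w x\<bar>) \<in> borel_measurable lebesgue"
        using Km measurable_g_abs[OF wm] by (intro borel_measurable_scaleR borel_measurable_indicator)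
      show "AE x in lebesgue. norm (indicat_real K x *\<^sub>R g \<bar>?w x\<bar>) \<le> norm (indicat_real K x *\<^sub>R g \<bar>h1 x\<bar>)"
        using le
      proof eventually_elim
        fix x assume "\<bar>?w x\<bar> \<le> \<bar>h1 x\<bar>"
        then have "g \<bar>?w x\<bar> \<le> g \<bar>h1 x\<bar>" by (intro g_mono) auto
        then show "norm (indicat_real K x *\<^sub>R g \<bar>?w x\<bar>) \<le> norm (indicat_real K x *\<^sub>R g \<bar>h1 x\<bar>)"
          using g_nonneg[of "\<bar>?w x\<bar>"] g_nonneg[of "\<bar>h1 x\<bar>"] by (cases "x \<in> K") auto
      qed
    qed
  qed
  moreover have "(\<integral>\<^sup>+ x. ennreal (tail ?w x) \<partial>lebesgue) < \<infinity>"
  proof -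
    have "(\<integral>\<^sup>+ x. ennreal (tail ?w x) \<partial>lebesgue) \<le> (\<integral>\<^sup>+ x. ennreal (tail h1 x) \<partial>lebesgue)"
    proof (intro nn_integral_mono_AE, use le in eventually_elim)
      fix x assume "\<bar>?w x\<bar> \<le> \<bar>h1 x\<bar>"
      then show "ennreal (tail ?w x) \<le> ennreal (tail h1 x)"
        unfolding tail_def by (intro ennreal_leI mult_right_mono g_mono divide_right_mono divide_nonneg_nonneg) auto
    qed
    then show ?thesis using tail_int[OF h1] by (rule le_less_trans)
  qed
  ultimately show ?thesis using wm unfolding tail_space_def tail_def by blast
qed

text \<open>The setting is rebuilt around the support of \<open>phi\<close>, which itself serves as
  \<open>S\<close> since nothing is mollified here. Now the test function is fixed and the solutions
  move, with energies bounded by \<open>uniform_energy\<close>.\<close>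

lemma u_test:
  assumes phi: "test_fun Om phi" and phi0: "\<And>x. 0 \<le> phi x"
  shows "let F = (\<lambda>z. g \<bar>Ds s u (fst z) (snd z)\<bar> * sgn (Ds s u (fst z) (snd z)) *
      Ds s phi (fst z) (snd z) * k (fst z) (snd z) / norm (fst z - snd z) ^ DIM('a))
    in integrable leb2 F \<and> 0 \<le> (\<integral>z. F z \<partial>leb2)"
proof (cases "\<forall>x. phi x = 0")
  case True
  then have "Ds s phi x y = 0" for x y by (simp add: Ds_def)
  then show ?thesis by simp
next
  case False
  define K where "K = closure {x. phi x \<noteq> 0}"
  have K: "compact K" "K \<noteq> {}" "K \<subseteq> Om"
    using phi False closure_subset[of "{x. phi x \<noteq> 0}"] by (auto simp: K_def test_fun_def)
  have phiK: "phi x = 0" if "x \<notin> K" for x using that closure_subset[of "{x. phi x \<noteq> 0}"] by (auto simp: K_def)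
  obtain r where r: "0 < r" and rc: "\<And>t. 0 < t \<Longrightarrow> t \<le> 4 * r \<Longrightarrow> compact {x. infdist x K \<le> t}"
      "\<And>t. 0 < t \<Longrightarrow> t \<le> 4 * r \<Longrightarrow> {x. infdist x K \<le> t} \<subseteq> Om"
    using compact_neighbourhood[OF K(1,2) Om K(3)] by auto
  define D where "D = {x. infdist x K < r}"
  have D: "open D" "compactly_contained D Om"
    unfolding D_def using rc[of r] r by (auto intro!: infdist_sublevel)
  have KD: "K \<subseteq> D" using r by (auto simp: D_def)
  have sep: "\<forall>x\<in>K. \<forall>y. y \<notin> D \<longrightarrow> r \<le> norm (x - y)"
  proof (intro ballI allI impI)
    fix x y assume "x \<in> K" "y \<notin> D"
    then show "r \<le> norm (x - y)" using infdist_triangle_abs[of x K y] by (auto simp: D_def dist_norm)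
  qed
  obtain R where R: "D \<subseteq> cball 0 R" using compactly_contained_bounded[OF D(2)] by auto
  obtain h M c where fs: "form_setting G g p q s L c k K D h"
    and ujh: "\<And>j. AE x in lebesgue. \<bar>uj j x\<bar> \<le> h x"
    using form_setting_exists[OF D K(1) KD r sep] by (elim exE conjE) blast
  interpret fs: form_setting G g p q s L c k K D h by (rule fs)
  have Ck: "Ck n phi" for n using phi by (simp add: test_fun_def)
  have phiR: "phi x = 0" if "R < norm x" for x using phiK[of x] KD R that by force
  have phim: "phi \<in> borel_measurable lebesgue"
    using Ck[of 0] by (intro measurable_completion) (auto intro: borel_measurable_continuous_onI)
  obtain l where l: "0 \<le> l" "\<And>x y. \<bar>phi x - phi y\<bar> \<le> l * norm (x - y)"
    using Ck_lipschitz_bounded_support[where R=R, OF Ck phiR] by auto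
  obtain b where b: "0 < b" "\<And>x. \<bar>phi x\<bar> \<le> b"
    using bounded_bounded_support[where R=R, OF Ck_imp_continuous[OF Ck] phiR] by metis
  \<comment> \<open>A smooth function with compact support is Lipschitz, so its energy is dominated
    by the Lipschitz one with the constant function 1 in place of \<open>f\<close>.\<close>
  have en: "energy s D phi < \<infinity>"
  proof -
    have "energy s D phi \<le> (\<integral>\<^sup>+ z. indicator (D \<times> D) z * ennreal (G \<bar>l * 1 * norm (fst z - snd z) powr (1 - s)\<bar>
      / norm (fst z - snd z) ^ DIM('a)) \<partial>leb2)"
      unfolding energy_def
    proof (intro nn_integral_mono mult_left_mono ennreal_leI divide_right_mono)
      fix z :: "'a \<times> 'a"
      have "\<bar>Ds s phi (fst z) (snd z)\<bar> \<le> l * norm (fst z - snd z) / norm (fst z - snd z) powr s"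
        unfolding Ds_def using l(2) by (simp add: divide_right_mono)
      also have "\<dots> = l * 1 * norm (fst z - snd z) powr (1 - s)"
        by (cases "fst z = snd z") (auto simp: powr_diff)
      finally show "G \<bar>Ds s phi (fst z) (snd z)\<bar> \<le> G \<bar>l * 1 * norm (fst z - snd z) powr (1 - s)\<bar>"
        by (intro G_mono) auto
    qed auto
    also have "\<dots> < \<infinity>"
      using lipschitz_energy(1)[OF s fs.D_meas R borel_measurable_const _ l(1), of 1]
        nn_integral_bounded_const[OF fs.D_meas R, of "G 1"] by simp
    finally show ?thesis .
  qed
  obtain Z where Z: "Z < \<infinity>" "\<And>j. energy s D (uj j) \<le> Z" using uniform_energy[OF D] by auto
  define B where "B = max Z (max (energy s D phi) (\<integral>\<^sup>+ x. indicator K x * ennreal (G \<bar>phi x\<bar>) \<partial>lebesgue))"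
  have phiG: "(\<integral>\<^sup>+ x. indicator K x * ennreal (G \<bar>phi x\<bar>) \<partial>lebesgue) < \<infinity>"
  proof -
    have "(\<integral>\<^sup>+ x. indicator K x * ennreal (G \<bar>phi x\<bar>) \<partial>lebesgue) \<le> (\<integral>\<^sup>+ x. indicator K x * ennreal (G b) \<partial>lebesgue)"
      using b by (intro nn_integral_mono mult_left_mono ennreal_leI G_mono) auto
    also have "\<dots> < \<infinity>" by (rule nn_integral_bounded_const[OF fs.S_meas order_trans[OF KD R]])
    finally show ?thesis .
  qed
  have B: "B < \<infinity>" using Z en phiG by (simp add: B_def)
  have ZB: "energy s D (uj j) \<le> B" for j using Z(2)[of j] by (auto simp: B_def le_max_iff_disj)
  have enB: "energy s D phi \<le> B" "(\<integral>\<^sup>+ x. indicator K x * ennreal (G \<bar>phi x\<bar>) \<partial>lebesgue) \<le> B"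
    by (simp_all add: B_def le_max_iff_disj)
  have l2: "AE x in lebesgue. (\<lambda>m::nat. phi x) \<longlonglongrightarrow> phi x" by simp
  have eq: "(\<forall>m::nat. phi = phi) \<or> (\<forall>m. uj m = u)" by simp
  have lim: "integrable leb2 (fs.form u phi)"
    "(\<lambda>j. integral\<^sup>L leb2 (fs.form (uj j) phi)) \<longlonglongrightarrow> integral\<^sup>L leb2 (fs.form u phi)"
    by (rule fs.form_tendsto[where U=uj and U'=u and V="\<lambda>_. phi" and V'=phi and B=B];
      (rule uj_meas u_meas phim conv l2 ujh B ZB enB eq | rule phiK, assumption))+
  have "0 \<le> integral\<^sup>L leb2 (fs.form u phi)"
    using fs.supersolution_form(2)[OF super phi phi0] by (intro LIMSEQ_le_const[OF lim(2)]) auto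
  then show ?thesis using lim(1) unfolding Let_def fs.form_def[abs_def] by blast
qed

lemma u_supersolution: "supersolution s G g k Om u"
  unfolding supersolution_def
proof (intro conjI allI impI u_W u_tail, elim conjE)
  fix phi :: "'a \<Rightarrow> real" assume "test_fun Om phi" "\<forall>x. 0 \<le> phi x"
  then show "let F = (\<lambda>z. g \<bar>Ds s u (fst z) (snd z)\<bar> * sgn (Ds s u (fst z) (snd z)) *
      Ds s phi (fst z) (snd z) * k (fst z) (snd z) / norm (fst z - snd z) ^ DIM('a))
    in integrable leb2 F \<and> 0 \<le> (\<integral>z. F z \<partial>leb2)"
    by (intro u_test) auto
qed

end

theorem theorem5p6:
  fixes G g :: "real \<Rightarrow> real" and p q s \<Lambda> :: real
    and k :: "'a::euclidean_space \<Rightarrow> 'a \<Rightarrow> real"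
    and \<Omega> :: "'a set" and h1 h2 u :: "'a \<Rightarrow> real" and uj :: "nat \<Rightarrow> 'a \<Rightarrow> real"
  assumes s: "0 < s" "s < 1"
    and G: "young_growth G g p q"
    and k: "kernel_ok \<Lambda> k"
    and noninc: "antimono_on {0<..} (\<lambda>t. g t / t powr (q - 1))"
    and \<Omega>: "open \<Omega>"
    and h1: "tail_space s g h1" and h2: "tail_space s g h2"
    and h12: "AE x in lebesgue. h1 x \<le> h2 x"
    and incr: "\<And>j. AE x in lebesgue. uj j x \<le> uj (Suc j) x"
    and super: "\<And>j. supersolution s G g k \<Omega> (uj j)"
    and bounds: "\<And>j. AE x in lebesgue. h1 x \<le> uj j x \<and> uj j x \<le> h2 x"
    and locbdd: "\<And>D. open D \<Longrightarrow> compactly_contained D \<Omega> \<Longrightarrow>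
                   \<exists>M. \<forall>j. AE x in lebesgue. x \<in> D \<longrightarrow> uj j x \<le> M"
    and conv: "AE x in lebesgue. (\<lambda>j. uj j x) \<longlonglongrightarrow> u x"
  shows "supersolution s G g k \<Omega> u"
proof -
  interpret monotone_limit G g p q s \<Lambda> k \<Omega> h1 h2 u uj
    by (intro monotone_limit.intro growth.intro monotone_limit_axioms.intro
      G noninc s k \<Omega> h1 h2 incr super bounds conv; rule locbdd; assumption)
  show ?thesis by (rule u_supersolution)
qed

end
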